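(* Let $\phi:(M^m,g)\to(N^n,h)$, $m>n$, be a Riemannian submersion such that the mean curvature vector field of the fibers is basic. Then $\phi$ is biharmonic if and only if $$\mathrm{Tr}_h(\nabla^N)^2\tau(\phi)+\nabla^N_{\tau(\phi)}\tau(\phi)+\mathrm{Ricci}^N(\tau(\phi))=0,$$ where $\tau(\phi)$ is the tension field of $\phi$, regarded as a vector field on the open set $\phi(M)\subseteq N$ (which is all of $N$ when $\phi$ is onto).
   Context: For a map $\phi:(M,g)\to(N,h)$ between Riemannian manifolds, the tension field is $\tau(\phi)=\mathrm{Trace}_g\nabla \mathrm d\phi$, a section of $\phi^{-1}TN$. The map $\phi$ is biharmonic if its bitension field $\tau_2(\phi)=-\Delta^\phi(\tau(\phi))-\mathrm{Trace}_g R^N(\mathrm d\phi,\tau(\phi))\mathrm d\phi$ vanishes, where $\Delta^\phi=-\mathrm{Trace}_g(\nabla^\phi\nabla^\phi-\nabla^\phi_{\nabla^M})$, $\nabla^\phi$ is the pull-back connection, and $R^N(X,Y)Z=[\nabla^N_X,\nabla^N_Y]Z-\nabla^N_{[X,Y]}Z$. $\nabla^M,\nabla^N$ are the Levi-Civita connections. For a Riemannian submersion, the mean curvature vector field of the fibers is $\mu=\frac{1}{m-n}\sum_{s}(\nabla^M_{e_s}e_s)^{\mathcal H}$, where $\{e_s\}$ is a local orthonormal frame of the vertical distribution $\ker\mathrm d\phi$ and $(\cdot)^{\mathcal H}$ is the projection onto the horizontal distribution $(\ker\mathrm d\phi)^\perp$. A vector field on $M$ is basic if it is horizontal and $\phi$-related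 to a vector field on $N$. One has $\tau(\phi)=-(m-n)\mathrm d\phi(\mu)$, so when $\mu$ is basic $\tau(\phi)=T\circ\phi$ for a vector field $T$ on $\phi(M)$, and $\tau(\phi)$ is identified with $T$. $\mathrm{Tr}_h(\nabla^N)^2T=\sum_{i}\big(\nabla^N_{\varepsilon_i}\nabla^N_{\varepsilon_i}T-\nabla^N_{\nabla^N_{\varepsilon_i}\varepsilon_i}T\big)$ and $\mathrm{Ricci}^N(T)=\sum_i R^N(T,\varepsilon_i)\varepsilon_i$ for a local orthonormal frame $\{\varepsilon_i\}$ of $N$. *)

theory Defs
  imports "HOL-Analysis.Analysis"
begin

text \<open>
  Manifolds are given by smooth atlases; the underlying set is the union of the chart domains.
  A tangent vector is represented by the family of its components in all charts around the base
  point, related by the derivatives of the coordinate changes. Hence a vector field is a function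
  \<open>X\<close> with \<open>X c p\<close> the components of the vector at \<open>p\<close> in the chart \<open>c\<close>. Likewise, for a section
  \<open>V\<close> of the pull-back bundle of a map \<open>\<phi>\<close>, \<open>V d p\<close> are the components of the vector
  \<open>V(p)\<close> at \<open>\<phi> p\<close> in the chart \<open>d\<close> of the target. Values in charts that do not contain the base
  point carry no meaning.
\<close>

subsection \<open>Smooth manifolds and vector fields\<close>

text \<open>Meant for open \<open>S\<close>; \<open>C\<^sup>k\<close> by iterated directional derivatives.\<close>

primrec Ck_on ::
    "nat \<Rightarrow> 'e::euclidean_space set \<Rightarrow> ('e \<Rightarrow> 'b::real_normed_vector) \<Rightarrow> bool" where
  "Ck_on 0 S f \<longleftrightarrow> continuous_on S f"
| "Ck_on (Suc k) S f \<longleftrightarrow> (\<forall>x\<in>S. f differentiable (at x)) \<and>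
     (\<forall>v. Ck_on k S (\<lambda>x. frechet_derivative f (at x) v))"

definition smooth_on :: "'e::euclidean_space set \<Rightarrow> ('e \<Rightarrow> 'b::real_normed_vector) \<Rightarrow> bool" where
  "smooth_on S f \<longleftrightarrow> (\<forall>k. Ck_on k S f)"

type_synonym ('a, 'e) chart = "'a set \<times> ('a \<Rightarrow> 'e)"
type_synonym ('a, 'e) vfield = "('a, 'e) chart \<Rightarrow> 'a \<Rightarrow> 'e"
type_synonym ('a, 'e) metric = "('a, 'e) chart \<Rightarrow> 'a \<Rightarrow> 'e \<Rightarrow> 'e \<Rightarrow> real"

abbreviation cdom :: "('a, 'e) chart \<Rightarrow> 'a set" where "cdom c \<equiv> fst c"
abbreviation cmap :: "('a, 'e) chart \<Rightarrow> 'a \<Rightarrow> 'e" where "cmap c \<equiv> snd c"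

definition cinv :: "('a, 'e) chart \<Rightarrow> 'e \<Rightarrow> 'a" where
  "cinv c = inv_into (cdom c) (cmap c)"

definition carrier :: "('a, 'e) chart set \<Rightarrow> 'a set" where
  "carrier A = (\<Union>c\<in>A. cdom c)"

definition chart :: "('a::topological_space, 'e::euclidean_space) chart \<Rightarrow> bool" where
  "chart c \<longleftrightarrow> open (cdom c) \<and> open (cmap c ` cdom c) \<and>
     homeomorphism (cdom c) (cmap c ` cdom c) (cmap c) (cinv c)"

definition smooth_atlas ::
    "('a::{t2_space,second_countable_topology}, 'e::euclidean_space) chart set \<Rightarrow> bool" where
  "smooth_atlas A \<longleftrightarrow> (\<forall>c\<in>A. chart c) \<and>
     (\<forall>c\<in>A. \<forall>d\<in>A. smooth_on (cmap c ` (cdom c \<inter> cdom d)) (cmap d \<circ> cinv c))"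

text \<open>
  Operations that need a chart but do not depend on its choice use this one.
\<close>
definition chart_at :: "('a, 'e) chart set \<Rightarrow> 'a \<Rightarrow> ('a, 'e) chart" where
  "chart_at A p = (SOME c. c \<in> A \<and> p \<in> cdom c)"

text \<open>
  The differential of \<open>f\<close> at \<open>p\<close> in the charts \<open>c\<close> and \<open>d\<close>; for the identity it is the Jacobian of
  the coordinate change from \<open>c\<close> to \<open>d\<close>.
\<close>
definition tangent_map :: "('a \<Rightarrow> 'b) \<Rightarrow> ('a, 'e::euclidean_space) chart \<Rightarrow>
    ('b, 'f::euclidean_space) chart \<Rightarrow> 'a \<Rightarrow> 'e \<Rightarrow> 'f" where
  "tangent_map f c d p = frechet_derivative (cmap d \<circ> f \<circ> cinv c) (at (cmap c p))"

definition smooth_vfield_on ::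
    "('a, 'e::euclidean_space) chart set \<Rightarrow> 'a set \<Rightarrow> ('a, 'e) vfield \<Rightarrow> bool" where
  "smooth_vfield_on A U X \<longleftrightarrow>
     (\<forall>c\<in>A. \<forall>d\<in>A. \<forall>p \<in> U \<inter> cdom c \<inter> cdom d. X d p = tangent_map (\<lambda>x. x) c d p (X c p)) \<and>
     (\<forall>c\<in>A. smooth_on (cmap c ` (U \<inter> cdom c)) (X c \<circ> cinv c))"

definition smooth_map :: "('a::topological_space, 'e::euclidean_space) chart set \<Rightarrow>
    ('b::topological_space, 'f::euclidean_space) chart set \<Rightarrow> ('a \<Rightarrow> 'b) \<Rightarrow> bool" where
  "smooth_map A B f \<longleftrightarrow> f ` carrier A \<subseteq> carrier B \<and> continuous_on (carrier A) f \<and>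
     (\<forall>c\<in>A. \<forall>d\<in>B. smooth_on (cmap c ` (cdom c \<inter> f -` cdom d)) (cmap d \<circ> f \<circ> cinv c))"

text \<open>The derivative \<open>X(f)\<close> of a vector-valued function along a vector field.\<close>

definition deriv_along :: "('a, 'e::euclidean_space) chart set \<Rightarrow> ('a, 'e) vfield \<Rightarrow>
    ('a \<Rightarrow> 'b::real_normed_vector) \<Rightarrow> 'a \<Rightarrow> 'b" where
  "deriv_along A X f p =
     (let c = chart_at A p in frechet_derivative (f \<circ> cinv c) (at (cmap c p)) (X c p))"

text \<open>The section \<open>d\<phi>(X)\<close> along \<open>\<phi>\<close>.\<close>

definition push :: "('a, 'e::euclidean_space) chart set \<Rightarrow> ('a \<Rightarrow> 'b) \<Rightarrow> ('a, 'e) vfield \<Rightarrow>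
    ('b, 'f::euclidean_space) chart \<Rightarrow> 'a \<Rightarrow> 'f" where
  "push A \<phi> X d p = deriv_along A X (cmap d \<circ> \<phi>) p"

definition bracket :: "('a, 'e::euclidean_space) chart set \<Rightarrow>
    ('a, 'e) vfield \<Rightarrow> ('a, 'e) vfield \<Rightarrow> ('a, 'e) vfield" where
  "bracket A X Y c p = deriv_along A X (Y c) p - deriv_along A Y (X c) p"

subsection \<open>Riemannian metrics, connections and curvature\<close>

definition riemannian_metric ::
    "('a, 'e::euclidean_space) chart set \<Rightarrow> ('a, 'e) metric \<Rightarrow> bool" where
  "riemannian_metric A g \<longleftrightarrow>
     (\<forall>c\<in>A. \<forall>p\<in>cdom c. bilinear (g c p) \<and> (\<forall>u v. g c p u v = g c p v u) \<and>
        (\<forall>u. u \<noteq> 0 \<longrightarrow> g c p u u > 0)) \<and>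
     (\<forall>c\<in>A. \<forall>d\<in>A. \<forall>p \<in> cdom c \<inter> cdom d. \<forall>u v.
        g d p (tangent_map (\<lambda>x. x) c d p u) (tangent_map (\<lambda>x. x) c d p v) = g c p u v) \<and>
     (\<forall>c\<in>A. \<forall>u v. smooth_on (cmap c ` cdom c) (\<lambda>x. g c (cinv c x) u v))"

definition riemannian_manifold ::
    "('a::{t2_space,second_countable_topology}, 'e::euclidean_space) chart set \<Rightarrow>
     ('a, 'e) metric \<Rightarrow> bool" where
  "riemannian_manifold A g \<longleftrightarrow> smooth_atlas A \<and> riemannian_metric A g"

text \<open>
  The connection coefficients \<open>\<Gamma>(u, v) = \<nabla>\<^bsub>u\<^esub> v\<close> (for \<open>u\<close>, \<open>v\<close> constant in the chart) of the
  Levi-Civita connection: the unique ones that are torsion-free, i.e. symmetric, and compatible with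
  the metric, \<open>w(g(u, v)) = g(\<nabla>\<^bsub>w\<^esub> u, v) + g(u, \<nabla>\<^bsub>w\<^esub> v)\<close>.
\<close>
definition christoffel :: "('a, 'e::euclidean_space) metric \<Rightarrow> ('a, 'e) chart \<Rightarrow>
    'a \<Rightarrow> 'e \<Rightarrow> 'e \<Rightarrow> 'e" where
  "christoffel g c p = (THE \<Gamma>. (\<forall>u v. \<Gamma> u v = \<Gamma> v u) \<and>
     (\<forall>u v w. frechet_derivative (\<lambda>x. g c (cinv c x) u v) (at (cmap c p)) w =
        g c p (\<Gamma> w u) v + g c p u (\<Gamma> w v)))"

text \<open>The Levi-Civita connection \<open>\<nabla>\<^bsub>X\<^esub> Y\<close>.\<close>

definition nabla :: "('a, 'e::euclidean_space) chart set \<Rightarrow> ('a, 'e) metric \<Rightarrow>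
    ('a, 'e) vfield \<Rightarrow> ('a, 'e) vfield \<Rightarrow> ('a, 'e) vfield" where
  "nabla A g X Y c p = deriv_along A X (Y c) p + christoffel g c p (X c p) (Y c p)"

text \<open>
  The pull-back \<open>\<nabla>\<^sup>\<phi>\<^bsub>X\<^esub> V\<close> of the Levi-Civita connection of the target: the connection on
  sections along \<open>\<phi>\<close> with \<open>\<nabla>\<^sup>\<phi>\<^bsub>X\<^esub> (Y \<circ> \<phi>) = \<nabla>\<^sup>N\<^bsub>d\<phi>(X)\<^esub> Y\<close>.
\<close>
definition nabla_along :: "('a, 'e::euclidean_space) chart set \<Rightarrow>
    ('b, 'f::euclidean_space) metric \<Rightarrow> ('a \<Rightarrow> 'b) \<Rightarrow> ('a, 'e) vfield \<Rightarrow>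
    (('b, 'f) chart \<Rightarrow> 'a \<Rightarrow> 'f) \<Rightarrow> ('b, 'f) chart \<Rightarrow> 'a \<Rightarrow> 'f" where
  "nabla_along A h \<phi> X V d p =
     deriv_along A X (V d) p + christoffel h d (\<phi> p) (push A \<phi> X d p) (V d p)"

definition curvature_op :: "('a, 'e::euclidean_space) chart set \<Rightarrow> ('a, 'e) metric \<Rightarrow>
    ('a, 'e) vfield \<Rightarrow> ('a, 'e) vfield \<Rightarrow> ('a, 'e) vfield \<Rightarrow> ('a, 'e) vfield" where
  "curvature_op A g X Y Z c p = nabla A g X (nabla A g Y Z) c p - nabla A g Y (nabla A g X Z) c p
     - nabla A g (bracket A X Y) Z c p"

text \<open>
  Since \<open>R(X, Y) Z\<close> is tensorial, its value on tangent vectors is obtained from any extensions to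
  vector fields; we take the fields with constant components in the chart at hand.
\<close>
definition const_field :: "('a, 'e::euclidean_space) chart \<Rightarrow> 'e \<Rightarrow> ('a, 'e) vfield" where
  "const_field c u = (\<lambda>d p. tangent_map (\<lambda>x. x) c d p u)"

definition curvature :: "('a, 'e::euclidean_space) chart set \<Rightarrow> ('a, 'e) metric \<Rightarrow>
    ('a, 'e) chart \<Rightarrow> 'a \<Rightarrow> 'e \<Rightarrow> 'e \<Rightarrow> 'e \<Rightarrow> 'e" where
  "curvature A g c p u v w =
     curvature_op A g (const_field c u) (const_field c v) (const_field c w) c p"

subsection \<open>Traces\<close>

definition orthonormal_on :: "('a, 'e::euclidean_space) chart set \<Rightarrow> ('a, 'e) metric \<Rightarrow>
    'a set \<Rightarrow> nat \<Rightarrow> (nat \<Rightarrow> ('a, 'e) vfield) \<Rightarrow> bool" where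
  "orthonormal_on A g U k e \<longleftrightarrow> (\<forall>i<k. smooth_vfield_on A U (e i)) \<and>
     (\<forall>c\<in>A. \<forall>p \<in> U \<inter> cdom c. \<forall>i<k. \<forall>j<k. g c p (e i c p) (e j c p) = (if i = j then 1 else 0))"

definition onframe_at :: "('a::topological_space, 'e::euclidean_space) chart set \<Rightarrow>
    ('a, 'e) metric \<Rightarrow> 'a \<Rightarrow> nat \<Rightarrow> ('a, 'e) vfield" where
  "onframe_at A g p = (SOME e. \<exists>U. open U \<and> p \<in> U \<and> U \<subseteq> carrier A \<and>
     orthonormal_on A g U DIM('e) e)"

text \<open>
  The trace of a bilinear form \<open>\<beta>\<close> on vector fields, with values in sections, by means of a local
  orthonormal frame around each point. For tensorial \<open>\<beta>\<close> it does not depend on the frame.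
\<close>
definition metric_trace :: "('a::topological_space, 'e::euclidean_space) chart set \<Rightarrow>
    ('a, 'e) metric \<Rightarrow> (('a, 'e) vfield \<Rightarrow> ('a, 'e) vfield \<Rightarrow> 'k \<Rightarrow> 'a \<Rightarrow> 'f::real_vector) \<Rightarrow>
    'k \<Rightarrow> 'a \<Rightarrow> 'f" where
  "metric_trace A g \<beta> d p =
     (\<Sum>i<DIM('e). \<beta> (onframe_at A g p i) (onframe_at A g p i) d p)"

subsection \<open>Tension and bitension field\<close>

definition tension :: "('a::topological_space, 'e::euclidean_space) chart set \<Rightarrow>
    ('a, 'e) metric \<Rightarrow> ('b, 'f::euclidean_space) metric \<Rightarrow> ('a \<Rightarrow> 'b) \<Rightarrow>
    ('b, 'f) chart \<Rightarrow> 'a \<Rightarrow> 'f" where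
  "tension A g h \<phi> = metric_trace A g (\<lambda>X Y d p.
     nabla_along A h \<phi> X (push A \<phi> Y) d p - push A \<phi> (nabla A g X Y) d p)"

definition laplacian_along :: "('a::topological_space, 'e::euclidean_space) chart set \<Rightarrow>
    ('a, 'e) metric \<Rightarrow> ('b, 'f::euclidean_space) metric \<Rightarrow> ('a \<Rightarrow> 'b) \<Rightarrow>
    (('b, 'f) chart \<Rightarrow> 'a \<Rightarrow> 'f) \<Rightarrow> ('b, 'f) chart \<Rightarrow> 'a \<Rightarrow> 'f" where
  "laplacian_along A g h \<phi> V d p = - metric_trace A g (\<lambda>X Y d p.
     nabla_along A h \<phi> X (nabla_along A h \<phi> Y V) d p
     - nabla_along A h \<phi> (nabla A g X Y) V d p) d p"

definition bitension :: "('a::topological_space, 'e::euclidean_space) chart set \<Rightarrow>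
    ('a, 'e) metric \<Rightarrow> ('b, 'f::euclidean_space) chart set \<Rightarrow> ('b, 'f) metric \<Rightarrow> ('a \<Rightarrow> 'b) \<Rightarrow>
    ('b, 'f) chart \<Rightarrow> 'a \<Rightarrow> 'f" where
  "bitension A g B h \<phi> d p =
     - laplacian_along A g h \<phi> (tension A g h \<phi>) d p
     - metric_trace A g (\<lambda>X Y d p. curvature B h d (\<phi> p)
         (push A \<phi> X d p) (tension A g h \<phi> d p) (push A \<phi> Y d p)) d p"

definition biharmonic :: "('a::topological_space, 'e::euclidean_space) chart set \<Rightarrow>
    ('a, 'e) metric \<Rightarrow> ('b, 'f::euclidean_space) chart set \<Rightarrow> ('b, 'f) metric \<Rightarrow>
    ('a \<Rightarrow> 'b) \<Rightarrow> bool" where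
  "biharmonic A g B h \<phi> \<longleftrightarrow>
     (\<forall>p\<in>carrier A. \<forall>d\<in>B. \<phi> p \<in> cdom d \<longrightarrow> bitension A g B h \<phi> d p = 0)"

text \<open>\<open>Tr\<^sub>h (\<nabla>\<^sup>N)\<^sup>2 T\<close> and \<open>Ricci\<^sup>N(T)\<close>.\<close>

definition trace_nabla2 :: "('b::topological_space, 'f::euclidean_space) chart set \<Rightarrow>
    ('b, 'f) metric \<Rightarrow> ('b, 'f) vfield \<Rightarrow> ('b, 'f) vfield" where
  "trace_nabla2 B h T = metric_trace B h (\<lambda>X Y d q.
     nabla B h X (nabla B h Y T) d q - nabla B h (nabla B h X Y) T d q)"

definition ricci :: "('b::topological_space, 'f::euclidean_space) chart set \<Rightarrow>
    ('b, 'f) metric \<Rightarrow> ('b, 'f) vfield \<Rightarrow> ('b, 'f) vfield" where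
  "ricci B h T = metric_trace B h (\<lambda>X Y d q. curvature B h d q (T d q) (X d q) (Y d q))"

subsection \<open>Riemannian submersions\<close>

text \<open>Vertical and horizontal space at \<open>p\<close>, in the components of the chart \<open>c\<close>.\<close>

definition vertical_space :: "('b, 'f::euclidean_space) chart set \<Rightarrow> ('a \<Rightarrow> 'b) \<Rightarrow>
    ('a, 'e::euclidean_space) chart \<Rightarrow> 'a \<Rightarrow> 'e set" where
  "vertical_space B \<phi> c p = {u. \<forall>d\<in>B. \<phi> p \<in> cdom d \<longrightarrow> tangent_map \<phi> c d p u = 0}"

definition horizontal_space :: "('a, 'e::euclidean_space) metric \<Rightarrow>
    ('b, 'f::euclidean_space) chart set \<Rightarrow> ('a \<Rightarrow> 'b) \<Rightarrow> ('a, 'e) chart \<Rightarrow> 'a \<Rightarrow> 'e set" where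
  "horizontal_space g B \<phi> c p = {u. \<forall>v\<in>vertical_space B \<phi> c p. g c p u v = 0}"

definition riemannian_submersion ::
    "('a::topological_space, 'e::euclidean_space) chart set \<Rightarrow> ('a, 'e) metric \<Rightarrow>
     ('b::topological_space, 'f::euclidean_space) chart set \<Rightarrow> ('b, 'f) metric \<Rightarrow>
     ('a \<Rightarrow> 'b) \<Rightarrow> bool" where
  "riemannian_submersion A g B h \<phi> \<longleftrightarrow> smooth_map A B \<phi> \<and>
     (\<forall>c\<in>A. \<forall>d\<in>B. \<forall>p\<in>cdom c. \<phi> p \<in> cdom d \<longrightarrow>
        surj (tangent_map \<phi> c d p) \<and>
        (\<forall>u\<in>horizontal_space g B \<phi> c p. \<forall>v\<in>horizontal_space g B \<phi> c p.
           h d (\<phi> p) (tangent_map \<phi> c d p u) (tangent_map \<phi> c d p v) = g c p u v))"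

definition horizontal_part :: "('a, 'e::euclidean_space) metric \<Rightarrow>
    ('b, 'f::euclidean_space) chart set \<Rightarrow> ('a \<Rightarrow> 'b) \<Rightarrow> ('a, 'e) vfield \<Rightarrow> ('a, 'e) vfield" where
  "horizontal_part g B \<phi> X c p = (THE u. u \<in> horizontal_space g B \<phi> c p \<and>
     X c p - u \<in> vertical_space B \<phi> c p)"

definition vertical_onframe_at :: "('a::topological_space, 'e::euclidean_space) chart set \<Rightarrow>
    ('a, 'e) metric \<Rightarrow> ('b, 'f::euclidean_space) chart set \<Rightarrow> ('a \<Rightarrow> 'b) \<Rightarrow>
    'a \<Rightarrow> nat \<Rightarrow> ('a, 'e) vfield" where
  "vertical_onframe_at A g B \<phi> p = (SOME e. \<exists>U. open U \<and> p \<in> U \<and> U \<subseteq> carrier A \<and>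
     orthonormal_on A g U (DIM('e) - DIM('f)) e \<and>
     (\<forall>c\<in>A. \<forall>q \<in> U \<inter> cdom c. \<forall>s < DIM('e) - DIM('f). e s c q \<in> vertical_space B \<phi> c q))"

definition mean_curvature :: "('a::topological_space, 'e::euclidean_space) chart set \<Rightarrow>
    ('a, 'e) metric \<Rightarrow> ('b, 'f::euclidean_space) chart set \<Rightarrow> ('a \<Rightarrow> 'b) \<Rightarrow> ('a, 'e) vfield" where
  "mean_curvature A g B \<phi> c p =
     (let e = vertical_onframe_at A g B \<phi> p; k = DIM('e) - DIM('f) in
      (1 / real k) *\<^sub>R (\<Sum>s<k. horizontal_part g B \<phi> (nabla A g (e s) (e s)) c p))"

text \<open>The section \<open>V\<close> along \<open>\<phi>\<close> is \<open>T \<circ> \<phi>\<close>.\<close>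

definition factors_through :: "('a, 'e) chart set \<Rightarrow> ('b, 'f::euclidean_space) chart set \<Rightarrow>
    ('a \<Rightarrow> 'b) \<Rightarrow> (('b, 'f) chart \<Rightarrow> 'a \<Rightarrow> 'f) \<Rightarrow> ('b, 'f) vfield \<Rightarrow> bool" where
  "factors_through A B \<phi> V T \<longleftrightarrow>
     (\<forall>p\<in>carrier A. \<forall>d\<in>B. \<phi> p \<in> cdom d \<longrightarrow> V d p = T d (\<phi> p))"

definition basic :: "('a, 'e::euclidean_space) chart set \<Rightarrow> ('a, 'e) metric \<Rightarrow>
    ('b, 'f::euclidean_space) chart set \<Rightarrow> ('a \<Rightarrow> 'b) \<Rightarrow> ('a, 'e) vfield \<Rightarrow> bool" where
  "basic A g B \<phi> X \<longleftrightarrow> smooth_vfield_on A (carrier A) X \<and>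
     (\<forall>c\<in>A. \<forall>p\<in>cdom c. X c p \<in> horizontal_space g B \<phi> c p) \<and>
     (\<exists>W. smooth_vfield_on B (carrier B) W \<and> factors_through A B \<phi> (push A \<phi> X) W)"

end

theory Submission
  imports Defs
begin

text \<open>
  For a vector field \<open>T\<close> on the target, the second covariant derivative of \<open>T \<circ> \<phi>\<close> along \<open>\<phi>\<close> is
  \<open>\<nabla>\<^sup>2T(d\<phi> X, d\<phi> Y) + \<nabla>\<^bsub>\<nabla>d\<phi>(X, Y)\<^esub> T\<close>. Tracing over an orthonormal frame and using \<open>d\<phi> d\<phi>\<^sup>* = id\<close>,
  the first term gives \<open>Tr\<^sub>h \<nabla>\<^sup>2T\<close> and the second \<open>\<nabla>\<^bsub>\<tau>(\<phi>)\<^esub> T\<close>, because \<open>\<tau>(\<phi>)\<close> is the trace of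
  \<open>\<nabla>d\<phi>\<close>; the curvature term becomes \<open>Ricci(T)\<close> in the same way. With \<open>T = \<tau>(\<phi>)\<close> this shows that the
  bitension field at \<open>p\<close> is the left-hand side of the equation at \<open>\<phi>(p)\<close>.

  That \<open>\<tau>(\<phi>)\<close> descends to the target follows from \<open>\<nabla>d\<phi> = 0\<close> on horizontal vectors: in a frame
  adapted to the submersion only the vertical vectors contribute to the trace of \<open>\<nabla>d\<phi>\<close>, and they
  contribute \<open>-(m - n) d\<phi>(\<mu>)\<close>, where \<open>d\<phi>(\<mu>)\<close> descends because \<open>\<mu>\<close> is basic.
\<close>

section \<open>Calculus of smooth functions\<close>

text \<open>The obstacle is the encoding. Derivatives, traces and the mean curvature are evaluated
  through a chart or a frame taken from a choice operator, and the choice may vary from point to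
  point; moreover nothing says at once that the components \<open>nabla A g X Y\<close> transform
  like those of a vector field. The computation is therefore made for smooth metrics on open subsets
  of Euclidean space and transferred at a single point p: on the source in the default chart of p,
  the very one that \<open>deriv_along\<close> uses there, on the target in an arbitrary chart d. On
  the target the transformation law cannot be bypassed, since \<open>trace_nabla2\<close> is read in
  d; it comes out of the same theory, applied to the identity map. Two facts give the objects their
  meaning: \<phi>(M) is open, so that a field on it can be differentiated, and the frames behind the
  traces and the mean curvature exist, by a smooth Gram-Schmidt process.\<close>

abbreviation fd ::
    "('e::real_normed_vector \<Rightarrow> 'b::real_normed_vector) \<Rightarrow> 'e \<Rightarrow> 'e \<Rightarrow> 'b" where
  "fd f x \<equiv> frechet_derivative f (at x)"

lemma fd_works: "f differentiable (at x) \<Longrightarrow> (f has_derivative fd f x) (at x)"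
  using frechet_derivative_works by blast

lemma fd_eq: "(f has_derivative f') (at x) \<Longrightarrow> fd f x = f'"
  using frechet_derivative_at by metis

lemma has_derivative_cong_nhds:
  assumes "eventually (\<lambda>y. f y = g y) (nhds x)"
  shows "(f has_derivative D) (at x) \<longleftrightarrow> (g has_derivative D) (at x)"
proof -
  obtain T where T: "open T" "x \<in> T" "\<And>y. y \<in> T \<Longrightarrow> f y = g y"
    using assms unfolding eventually_nhds by blast
  show ?thesis
    using has_derivative_transform_within_open[OF _ T(1,2)] T(3) by metis
qed

text \<open>Holds even where no derivative exists: \<open>frechet_derivative\<close> selects from
  the set of all derivatives at the point, and that set depends only on the germ.\<close>

lemma fd_cong: "eventually (\<lambda>y. f y = g y) (nhds x) \<Longrightarrow> fd f x = fd g x"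
  unfolding frechet_derivative_def by (simp add: has_derivative_cong_nhds)

lemma differentiable_cong_nhds:
  "eventually (\<lambda>y. f y = g y) (nhds x) \<Longrightarrow> f differentiable (at x) \<longleftrightarrow> g differentiable (at x)"
  unfolding differentiable_def by (simp add: has_derivative_cong_nhds)

lemma linear_fd: "f differentiable (at x) \<Longrightarrow> linear (fd f x)"
  by (rule linear_frechet_derivative)

section \<open>Closure properties of the classes C^k\<close>

lemma Ck_on_cong:
  assumes "open S" "\<And>x. x \<in> S \<Longrightarrow> f x = g x"
  shows "Ck_on k S f \<longleftrightarrow> Ck_on k S g"
  using assms(2)
proof (induction k arbitrary: f g)
  case 0
  then show ?case by (simp cong: continuous_on_cong)
next
  case (Suc k)
  have ev: "eventually (\<lambda>y. f y = g y) (nhds x)" if "x \<in> S" for x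
    using that assms(1) Suc.prems eventually_nhds by blast
  have "Ck_on k S (\<lambda>x. fd f x v) \<longleftrightarrow> Ck_on k S (\<lambda>x. fd g x v)" for v
    by (rule Suc.IH) (simp add: fd_cong[OF ev])
  moreover have "f differentiable (at x) \<longleftrightarrow> g differentiable (at x)" if "x \<in> S" for x
    using differentiable_cong_nhds[OF ev[OF that]] .
  ultimately show ?case by simp
qed

lemma Ck_on_continuous: "Ck_on k S f \<Longrightarrow> continuous_on S f"
  by (cases k) (auto intro!: differentiable_imp_continuous_on
      simp: differentiable_on_def differentiable_at_withinI)

lemma Ck_on_Suc_imp: "Ck_on (Suc k) S f \<Longrightarrow> Ck_on k S f"
  by (induction k arbitrary: f) (auto intro!: differentiable_imp_continuous_on
      simp: differentiable_on_def differentiable_at_withinI)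

lemma Ck_on_subset: "Ck_on k S f \<Longrightarrow> T \<subseteq> S \<Longrightarrow> Ck_on k T f"
  by (induction k arbitrary: f) (auto intro: continuous_on_subset)

lemma Ck_on_const: "Ck_on k S (\<lambda>x. c)"
  by (induction k arbitrary: c) auto

lemma Ck_on_add:
  assumes "open S" "Ck_on k S f" "Ck_on k S g"
  shows "Ck_on k S (\<lambda>x. f x + g x)"
  using assms(2,3)
proof (induction k arbitrary: f g)
  case 0
  then show ?case by (simp add: continuous_on_add)
next
  case (Suc k)
  have *: "fd (\<lambda>x. f x + g x) x v = fd f x v + fd g x v" if "x \<in> S" for x v
    using Suc.prems that by (subst fd_eq[OF has_derivative_add[OF fd_works fd_works]]) auto
  have "Ck_on k S (\<lambda>x. fd (\<lambda>x. f x + g x) x v)" for v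
    using Suc.IH[of "\<lambda>x. fd f x v" "\<lambda>x. fd g x v"] Suc.prems
    by (subst Ck_on_cong[OF assms(1) *]) auto
  with Suc.prems show ?case by simp
qed

text \<open>The product rule yields a sum of terms of the same shape, each pairing one function with
  a derivative of the other; hence the induction over arbitrary \<open>f\<close> and
  \<open>g\<close>.\<close>

lemma Ck_on_bilinear:
  assumes "open S" "bounded_bilinear B" "Ck_on k S f" "Ck_on k S g"
  shows "Ck_on k S (\<lambda>x. B (f x) (g x))"
  using assms(3,4)
proof (induction k arbitrary: f g)
  case 0
  then show ?case
    using bounded_bilinear.continuous_on[OF assms(2)] by simp
next
  case (Suc k)
  have d: "((\<lambda>x. B (f x) (g x)) has_derivative (\<lambda>v. B (f x) (fd g x v) + B (fd f x v) (g x))) (at x)"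
    if "x \<in> S" for x
    using Suc.prems that by (intro bounded_bilinear.FDERIV[OF assms(2)] fd_works) auto
  have *: "fd (\<lambda>x. B (f x) (g x)) x v = B (f x) (fd g x v) + B (fd f x v) (g x)"
    if "x \<in> S" for x v
    by (simp add: fd_eq[OF d[OF that]])
  have "Ck_on k S f" "Ck_on k S g"
    using Suc.prems Ck_on_Suc_imp by blast+
  then have "Ck_on k S (\<lambda>x. fd (\<lambda>x. B (f x) (g x)) x v)" for v
    using Suc.prems
    by (subst Ck_on_cong[OF assms(1) *]) (auto intro!: Ck_on_add[OF assms(1)] Suc.IH)
  with d show ?case by (auto simp: differentiable_def)
qed

lemma Ck_on_sum:
  assumes "open S" "\<And>i. i \<in> I \<Longrightarrow> Ck_on k S (f i)"
  shows "Ck_on k S (\<lambda>x. \<Sum>i\<in>I. f i x)"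
  using assms(2)
  by (induction I rule: infinite_finite_induct) (auto simp: Ck_on_const intro: Ck_on_add[OF assms(1)])

lemma fd_basis_sum:
  fixes f :: "'e::euclidean_space \<Rightarrow> 'b::real_normed_vector"
  assumes "f differentiable (at x)"
  shows "fd f x v = (\<Sum>b\<in>Basis. (v \<bullet> b) *\<^sub>R fd f x b)"
proof -
  have "fd f x v = fd f x (\<Sum>b\<in>Basis. (v \<bullet> b) *\<^sub>R b)"
    by (simp add: euclidean_representation)
  then show ?thesis
    using linear_fd[OF assms] by (simp add: linear_sum linear_cmul o_def)
qed

text \<open>The chain rule differentiates \<open>f\<close> along \<open>fd g x v\<close>, a
  direction that moves with x, whereas \<open>Ck_on\<close> speaks of fixed directions. Expanding it
  in the basis leaves scalar coefficients and derivatives of \<open>f\<close> in fixed directions,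
  to which the induction hypothesis applies.\<close>

lemma Ck_on_compose:
  fixes f :: "'f::euclidean_space \<Rightarrow> 'b::real_normed_vector" and g :: "'e::euclidean_space \<Rightarrow> 'f"
  assumes "open S" "Ck_on k T f" "Ck_on k S g" "g ` S \<subseteq> T"
  shows "Ck_on k S (\<lambda>x. f (g x))"
  using assms(2,3)
proof (induction k arbitrary: f)
  case 0
  then show ?case using continuous_on_compose2 assms(4) by auto
next
  case (Suc k)
  have d: "((\<lambda>x. f (g x)) has_derivative (\<lambda>v. fd f (g x) (fd g x v))) (at x)" if "x \<in> S" for x
  proof -
    have "g differentiable (at x)" "f differentiable (at (g x))"
      using Suc.prems that assms(4) by auto
    from diff_chain_at[OF this[THEN fd_works]] show ?thesis by (simp add: o_def)
  qed
  have *: "fd (\<lambda>x. f (g x)) x v = (\<Sum>b\<in>Basis. (fd g x v \<bullet> b) *\<^sub>R fd f (g x) b)" if "x \<in> S" for x v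
    using Suc.prems that assms(4)
    by (subst fd_eq[OF d[OF that]], subst fd_basis_sum) auto
  have g: "Ck_on k S g" using Suc.prems Ck_on_Suc_imp by blast
  have "Ck_on k S (\<lambda>x. fd g x v \<bullet> b)" for v b
    using Suc.prems by (auto intro: Ck_on_bilinear[OF assms(1) bounded_bilinear_inner] Ck_on_const)
  moreover have "Ck_on k S (\<lambda>x. fd f (g x) b)" for b
    using Suc.prems by (intro Suc.IH g) auto
  ultimately have "Ck_on k S (\<lambda>x. fd (\<lambda>x. f (g x)) x v)" for v
    by (subst Ck_on_cong[OF assms(1) *])
      (auto intro!: Ck_on_sum[OF assms(1)] Ck_on_bilinear[OF assms(1) bounded_bilinear_scaleR])
  with d show ?case by (auto simp: differentiable_def)
qed

text \<open>The free coefficient c closes the family under differentiation, as the induction needs.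
  The exponent -1/2 will normalise vectors.\<close>

lemma Ck_on_powr: "Ck_on k {0<..} (\<lambda>x::real. c * x powr a)"
proof (induction k arbitrary: a c)
  case 0
  show ?case by (auto intro!: continuous_intros)
next
  case (Suc k)
  have d: "((\<lambda>x::real. c * x powr a) has_derivative (\<lambda>v. v * (c * (a * x powr (a - 1))))) (at x)"
    if "x \<in> {0<..}" for x
    using that by (auto intro!: derivative_eq_intros simp: powr_diff field_simps)
  have *: "fd (\<lambda>x::real. c * x powr a) x v = (v * c * a) * x powr (a - 1)" if "x \<in> {0<..}" for x v
    by (simp add: fd_eq[OF d[OF that]])
  have "Ck_on k {0<..} (\<lambda>x. fd (\<lambda>x::real. c * x powr a) x v)" for v
    by (subst Ck_on_cong[OF _ *]) (auto intro!: Suc.IH)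
  with d show ?case by (auto simp: differentiable_def)
qed

section \<open>Smooth functions\<close>

lemma smooth_on_cong:
  "open S \<Longrightarrow> (\<And>x. x \<in> S \<Longrightarrow> f x = g x) \<Longrightarrow> smooth_on S f \<longleftrightarrow> smooth_on S g"
  unfolding smooth_on_def using Ck_on_cong by blast

lemma smooth_on_subset: "smooth_on S f \<Longrightarrow> T \<subseteq> S \<Longrightarrow> smooth_on T f"
  unfolding smooth_on_def using Ck_on_subset by blast

lemma smooth_on_const: "smooth_on S (\<lambda>x. c)"
  by (simp add: smooth_on_def Ck_on_const)

lemma smooth_on_add:
  "open S \<Longrightarrow> smooth_on S f \<Longrightarrow> smooth_on S g \<Longrightarrow> smooth_on S (\<lambda>x. f x + g x)"
  by (simp add: smooth_on_def Ck_on_add)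

lemma smooth_on_bilinear:
  "open S \<Longrightarrow> bounded_bilinear B \<Longrightarrow> smooth_on S f \<Longrightarrow> smooth_on S g \<Longrightarrow>
    smooth_on S (\<lambda>x. B (f x) (g x))"
  by (simp add: smooth_on_def Ck_on_bilinear)

lemmas smooth_on_scaleR = smooth_on_bilinear[OF _ bounded_bilinear_scaleR]
lemmas smooth_on_mult = smooth_on_bilinear[OF _ bounded_bilinear_mult]
lemmas smooth_on_inner = smooth_on_bilinear[OF _ bounded_bilinear_inner]

lemma smooth_on_diff:
  assumes "open S" "smooth_on S f" "smooth_on S g"
  shows "smooth_on S (\<lambda>x. f x - g x)"
  using smooth_on_add[OF assms(1,2) smooth_on_scaleR[OF assms(1) smooth_on_const assms(3), of "-1"]]
  by simp

lemma smooth_on_sum: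
  "open S \<Longrightarrow> (\<And>i. i \<in> I \<Longrightarrow> smooth_on S (f i)) \<Longrightarrow> smooth_on S (\<lambda>x. \<Sum>i\<in>I. f i x)"
  by (simp add: smooth_on_def Ck_on_sum)

lemma smooth_on_compose:
  fixes f :: "'f::euclidean_space \<Rightarrow> 'b::real_normed_vector" and g :: "'e::euclidean_space \<Rightarrow> 'f"
  assumes "open S" "smooth_on T f" "smooth_on S g" "g ` S \<subseteq> T"
  shows "smooth_on S (\<lambda>x. f (g x))"
  unfolding smooth_on_def
proof
  fix k
  show "Ck_on k S (\<lambda>x. f (g x))"
    using Ck_on_compose[OF assms(1) _ _ assms(4), of k f] assms(2,3) by (simp add: smooth_on_def)
qed

lemma smooth_on_powr:
  fixes f :: "'e::euclidean_space \<Rightarrow> real"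
  assumes "open S" "smooth_on S f" "\<And>x. x \<in> S \<Longrightarrow> f x > 0"
  shows "smooth_on S (\<lambda>x. f x powr a)"
proof -
  have "smooth_on {0<..} (\<lambda>x::real. x powr a)"
    using Ck_on_powr[of _ 1 a] by (simp add: smooth_on_def)
  then show ?thesis
    by (rule smooth_on_compose[OF assms(1) _ assms(2)]) (use assms(3) in auto)
qed

lemma smooth_on_differentiable: "smooth_on S f \<Longrightarrow> x \<in> S \<Longrightarrow> f differentiable (at x)"
  unfolding smooth_on_def by (metis Ck_on.simps(2))

lemma smooth_on_has_derivative: "smooth_on S f \<Longrightarrow> x \<in> S \<Longrightarrow> (f has_derivative fd f x) (at x)"
  by (simp add: fd_works smooth_on_differentiable)

lemma smooth_on_fd: "smooth_on S f \<Longrightarrow> smooth_on S (\<lambda>x. fd f x v)"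
  unfolding smooth_on_def by (metis Ck_on.simps(2))

lemma smooth_on_continuous: "smooth_on S f \<Longrightarrow> continuous_on S f"
  unfolding smooth_on_def using Ck_on_continuous by blast

section \<open>Linear and bilinear maps that depend on a point\<close>

lemma bilinear_sum_sum:
  assumes "bilinear B"
  shows "B (\<Sum>i\<in>I. f i) (\<Sum>j\<in>J. g j) = (\<Sum>i\<in>I. \<Sum>j\<in>J. B (f i) (g j))"
proof -
  have "B (\<Sum>i\<in>I. f i) y = (\<Sum>i\<in>I. B (f i) y)" for y
    using assms linear_sum[of "\<lambda>x. B x y"] by (simp add: bilinear_def)
  moreover have "B x (\<Sum>j\<in>J. g j) = (\<Sum>j\<in>J. B x (g j))" for x
    using assms linear_sum[of "B x"] by (simp add: bilinear_def)
  ultimately have "B (\<Sum>i\<in>I. f i) (\<Sum>j\<in>J. g j) = (\<Sum>i\<in>I. B (f i) (\<Sum>j\<in>J. g j))"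
    and "B (f i) (\<Sum>j\<in>J. g j) = (\<Sum>j\<in>J. B (f i) (g j))" for i
    by blast+
  then show ?thesis by (simp only:)
qed

text \<open>Smoothness of the family is given for constant arguments, the form in which
  \<open>riemannian_metric\<close> states it. Expanding \<open>X\<close> and \<open>Y\<close> in the
  basis moves their dependence on x into scalar factors.\<close>

lemma smooth_on_bilinear_family:
  fixes L :: "'e::euclidean_space \<Rightarrow> 'f::euclidean_space \<Rightarrow> 'g::euclidean_space \<Rightarrow> 'b::real_normed_vector"
  assumes S: "open S" and L: "\<And>x. x \<in> S \<Longrightarrow> bilinear (L x)" "\<And>u v. smooth_on S (\<lambda>x. L x u v)"
    and XY: "smooth_on S X" "smooth_on S Y"
  shows "smooth_on S (\<lambda>x. L x (X x) (Y x))"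
proof (subst smooth_on_cong[OF S])
  fix x assume "x \<in> S"
  then have b: "bilinear (L x)" by (rule L)
  have "L x (X x) (Y x) = L x (\<Sum>i\<in>Basis. (X x \<bullet> i) *\<^sub>R i) (\<Sum>j\<in>Basis. (Y x \<bullet> j) *\<^sub>R j)"
    by (simp add: euclidean_representation)
  then show "L x (X x) (Y x) = (\<Sum>i\<in>Basis. \<Sum>j\<in>Basis. (X x \<bullet> i) *\<^sub>R (Y x \<bullet> j) *\<^sub>R L x i j)"
    unfolding bilinear_sum_sum[OF b]
    by (simp add: bilinear_lmul[OF b] bilinear_rmul[OF b] mult.commute)
next
  show "smooth_on S (\<lambda>x. \<Sum>i\<in>Basis. \<Sum>j\<in>Basis. (X x \<bullet> i) *\<^sub>R (Y x \<bullet> j) *\<^sub>R L x i j)"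
    by (intro smooth_on_sum smooth_on_scaleR smooth_on_inner smooth_on_const S L XY)
qed

lemma smooth_on_fd_field:
  fixes f :: "'e::euclidean_space \<Rightarrow> 'b::real_normed_vector"
  assumes "open S" "smooth_on S f" "smooth_on S X"
  shows "smooth_on S (\<lambda>x. fd f x (X x))"
proof (subst smooth_on_cong[OF assms(1)])
  show "fd f x (X x) = (\<Sum>b\<in>Basis. (X x \<bullet> b) *\<^sub>R fd f x b)" if "x \<in> S" for x
    using fd_basis_sum smooth_on_differentiable assms(2) that by blast
  show "smooth_on S (\<lambda>x. \<Sum>b\<in>Basis. (X x \<bullet> b) *\<^sub>R fd f x b)"
    using assms by (intro smooth_on_sum smooth_on_scaleR smooth_on_inner smooth_on_fd smooth_on_const)
qed

lemma has_derivative_linear_family: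
  fixes L :: "'e::real_normed_vector \<Rightarrow> 'f::euclidean_space \<Rightarrow> 'b::real_normed_vector"
  assumes L: "\<And>u. ((\<lambda>x. L x u) has_derivative L' u) (at x0)"
    and lin: "eventually (\<lambda>x. linear (L x)) (nhds x0)"
    and X: "(X has_derivative X') (at x0)"
  shows "((\<lambda>x. L x (X x)) has_derivative (\<lambda>w. L' (X x0) w + L x0 (X' w))) (at x0)"
proof -
  have rep: "L x u = (\<Sum>i\<in>Basis. (u \<bullet> i) *\<^sub>R L x i)" if "linear (L x)" for x u
  proof -
    have "L x u = L x (\<Sum>i\<in>Basis. (u \<bullet> i) *\<^sub>R i)" by (simp add: euclidean_representation)
    then show ?thesis using that by (simp add: linear_sum linear_cmul o_def)
  qed
  have lin0: "linear (L x0)" using lin eventually_nhds_x_imp_x by blast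
  have "((\<lambda>x. \<Sum>i\<in>Basis. (X x0 \<bullet> i) *\<^sub>R L x i) has_derivative
      (\<lambda>w. \<Sum>i\<in>Basis. (X x0 \<bullet> i) *\<^sub>R L' i w)) (at x0)"
    by (intro has_derivative_sum has_derivative_scaleR_right L)
  then have "((\<lambda>x. L x (X x0)) has_derivative (\<lambda>w. \<Sum>i\<in>Basis. (X x0 \<bullet> i) *\<^sub>R L' i w)) (at x0)"
    by (subst has_derivative_cong_nhds[OF eventually_mono[OF lin rep]])
  \<comment> \<open>Linearity of \<open>L'\<close> in its vector argument is derived, not assumed:
    both sides are derivatives of the same function.\<close>
  then have L'_rep: "L' (X x0) w = (\<Sum>i\<in>Basis. (X x0 \<bullet> i) *\<^sub>R L' i w)" for w
    by (rule fun_cong[OF has_derivative_unique[OF L]])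
  have "((\<lambda>x. \<Sum>i\<in>Basis. (X x \<bullet> i) *\<^sub>R L x i) has_derivative
      (\<lambda>w. \<Sum>i\<in>Basis. (X x0 \<bullet> i) *\<^sub>R L' i w + (X' w \<bullet> i) *\<^sub>R L x0 i)) (at x0)"
    using X by (intro has_derivative_sum has_derivative_scaleR L has_derivative_inner_left)
  then have "((\<lambda>x. L x (X x)) has_derivative
      (\<lambda>w. \<Sum>i\<in>Basis. (X x0 \<bullet> i) *\<^sub>R L' i w + (X' w \<bullet> i) *\<^sub>R L x0 i)) (at x0)"
    by (subst has_derivative_cong_nhds[OF eventually_mono[OF lin rep]])
  then show ?thesis
    by (simp add: sum.distrib L'_rep rep[OF lin0, of "X' _"])
qed

lemma linear_fd_family:
  fixes L :: "'e::real_normed_vector \<Rightarrow> 'f::real_normed_vector \<Rightarrow> 'b::real_normed_vector"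
  assumes d: "\<And>u. (\<lambda>x. L x u) differentiable (at x0)"
    and lin: "eventually (\<lambda>x. linear (L x)) (nhds x0)"
  shows "linear (\<lambda>u. fd (\<lambda>x. L x u) x0 w)"
proof (rule linearI)
  fix a b
  have "fd (\<lambda>x. L x (a + b)) x0 = fd (\<lambda>x. L x a + L x b) x0"
    by (rule fd_cong) (use lin in \<open>auto elim!: eventually_mono simp: linear_add\<close>)
  then show "fd (\<lambda>x. L x (a + b)) x0 w = fd (\<lambda>x. L x a) x0 w + fd (\<lambda>x. L x b) x0 w"
    using fd_eq[OF has_derivative_add[OF fd_works[OF d[of a]] fd_works[OF d[of b]]]] by simp
next
  fix r a
  have "fd (\<lambda>x. L x (r *\<^sub>R a)) x0 = fd (\<lambda>x. r *\<^sub>R L x a) x0"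
    by (rule fd_cong) (use lin in \<open>auto elim!: eventually_mono simp: linear_cmul\<close>)
  then show "fd (\<lambda>x. L x (r *\<^sub>R a)) x0 w = r *\<^sub>R fd (\<lambda>x. L x a) x0 w"
    using fd_eq[OF has_derivative_scaleR_right[OF fd_works[OF d[of a]], of r]] by simp
qed

lemma has_derivative_bilinear_family:
  fixes L :: "'e::real_normed_vector \<Rightarrow> 'f::euclidean_space \<Rightarrow> 'g::euclidean_space \<Rightarrow> 'b::real_normed_vector"
  assumes L: "\<And>u v. ((\<lambda>x. L x u v) has_derivative L' u v) (at x0)"
    and lin: "eventually (\<lambda>x. bilinear (L x)) (nhds x0)"
    and X: "(X has_derivative X') (at x0)" and Y: "(Y has_derivative Y') (at x0)"
  shows "((\<lambda>x. L x (X x) (Y x)) has_derivative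
    (\<lambda>w. L' (X x0) (Y x0) w + L x0 (X' w) (Y x0) + L x0 (X x0) (Y' w))) (at x0)"
proof -
  have 1: "((\<lambda>x. L x (X x) v) has_derivative (\<lambda>w. L' (X x0) v w + L x0 (X' w) v)) (at x0)" for v
    by (rule has_derivative_linear_family[OF L _ X])
      (use lin in \<open>auto elim!: eventually_mono simp: bilinear_def\<close>)
  show ?thesis
    by (rule has_derivative_linear_family[OF 1 _ Y])
      (use lin in \<open>auto elim!: eventually_mono simp: bilinear_def\<close>)
qed

section \<open>Symmetry of second derivatives\<close>

text \<open>The mean value theorem twice: along u for the difference of \<open>f\<close> between two
  opposite edges of the parallelogram, then along v for the derivative in direction u.\<close>

lemma mixed_derivative_mvt:
  fixes f :: "'e::real_normed_vector \<Rightarrow> real"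
  assumes "s > 0"
    and f: "\<And>a b. 0 \<le> a \<Longrightarrow> a \<le> s \<Longrightarrow> 0 \<le> b \<Longrightarrow> b \<le> s \<Longrightarrow>
      (f has_derivative f' (x + a *\<^sub>R u + b *\<^sub>R v)) (at (x + a *\<^sub>R u + b *\<^sub>R v))"
    and f': "\<And>a b. 0 \<le> a \<Longrightarrow> a \<le> s \<Longrightarrow> 0 \<le> b \<Longrightarrow> b \<le> s \<Longrightarrow>
      ((\<lambda>y. f' y u) has_derivative f'' (x + a *\<^sub>R u + b *\<^sub>R v)) (at (x + a *\<^sub>R u + b *\<^sub>R v))"
  shows "\<exists>a b. 0 \<le> a \<and> a \<le> s \<and> 0 \<le> b \<and> b \<le> s \<and>
    f (x + s *\<^sub>R u + s *\<^sub>R v) - f (x + s *\<^sub>R u) - f (x + s *\<^sub>R v) + f x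
      = s * s * f'' (x + a *\<^sub>R u + b *\<^sub>R v) v"
proof -
  have d1: "((\<lambda>a. f (x + a *\<^sub>R u + b *\<^sub>R v)) has_real_derivative f' (x + a *\<^sub>R u + b *\<^sub>R v) u) (at a)"
    if "0 \<le> a" "a \<le> s" "0 \<le> b" "b \<le> s" for a b
  proof -
    have "((\<lambda>a. x + a *\<^sub>R u + b *\<^sub>R v) has_derivative (\<lambda>t. t *\<^sub>R u)) (at a)"
      by (auto intro!: derivative_eq_intros)
    from diff_chain_at[OF this f[OF that]]
    have "((\<lambda>a. f (x + a *\<^sub>R u + b *\<^sub>R v)) has_derivative
        (\<lambda>t. f' (x + a *\<^sub>R u + b *\<^sub>R v) (t *\<^sub>R u))) (at a)"
      by (simp add: o_def)
    moreover have "linear (f' (x + a *\<^sub>R u + b *\<^sub>R v))"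
      using f[OF that] has_derivative_linear by blast
    ultimately show ?thesis
      by (simp add: has_field_derivative_def linear_cmul mult_commute_abs)
  qed
  have d2: "((\<lambda>b. f' (x + a *\<^sub>R u + b *\<^sub>R v) u) has_real_derivative f'' (x + a *\<^sub>R u + b *\<^sub>R v) v) (at b)"
    if "0 \<le> a" "a \<le> s" "0 \<le> b" "b \<le> s" for a b
  proof -
    have "((\<lambda>b. x + a *\<^sub>R u + b *\<^sub>R v) has_derivative (\<lambda>t. t *\<^sub>R v)) (at b)"
      by (auto intro!: derivative_eq_intros)
    from diff_chain_at[OF this f'[OF that]]
    have "((\<lambda>b. f' (x + a *\<^sub>R u + b *\<^sub>R v) u) has_derivative
        (\<lambda>t. f'' (x + a *\<^sub>R u + b *\<^sub>R v) (t *\<^sub>R v))) (at b)"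
      by (simp add: o_def)
    moreover have "linear (f'' (x + a *\<^sub>R u + b *\<^sub>R v))"
      using f'[OF that] has_derivative_linear by blast
    ultimately show ?thesis
      by (simp add: has_field_derivative_def linear_cmul mult_commute_abs)
  qed
  have "\<exists>a>0. a < s \<and>
      (f (x + s *\<^sub>R u + s *\<^sub>R v) - f (x + s *\<^sub>R u + 0 *\<^sub>R v))
      - (f (x + 0 *\<^sub>R u + s *\<^sub>R v) - f (x + 0 *\<^sub>R u + 0 *\<^sub>R v))
      = (s - 0) * (f' (x + a *\<^sub>R u + s *\<^sub>R v) u - f' (x + a *\<^sub>R u + 0 *\<^sub>R v) u)"
    by (rule MVT2[OF \<open>s > 0\<close>, of "\<lambda>a. f (x + a *\<^sub>R u + s *\<^sub>R v) - f (x + a *\<^sub>R u + 0 *\<^sub>R v)"])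
      (use \<open>s > 0\<close> in \<open>intro DERIV_diff d1; simp\<close>)
  then obtain a where a: "0 < a" "a < s"
    "f (x + s *\<^sub>R u + s *\<^sub>R v) - f (x + s *\<^sub>R u) - f (x + s *\<^sub>R v) + f x
      = s * (f' (x + a *\<^sub>R u + s *\<^sub>R v) u - f' (x + a *\<^sub>R u + 0 *\<^sub>R v) u)"
    by auto
  have "\<exists>b>0. b < s \<and> f' (x + a *\<^sub>R u + s *\<^sub>R v) u - f' (x + a *\<^sub>R u + 0 *\<^sub>R v) u
      = (s - 0) * f'' (x + a *\<^sub>R u + b *\<^sub>R v) v"
    by (rule MVT2[OF \<open>s > 0\<close>, of "\<lambda>b. f' (x + a *\<^sub>R u + b *\<^sub>R v) u"]) (use a in \<open>intro d2; simp\<close>)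
  then obtain b where b: "0 < b" "b < s" "f' (x + a *\<^sub>R u + s *\<^sub>R v) u - f' (x + a *\<^sub>R u + 0 *\<^sub>R v) u
      = s * f'' (x + a *\<^sub>R u + b *\<^sub>R v) v"
    by auto
  show ?thesis
    using a b by (intro exI[of _ a] exI[of _ b]) simp
qed

text \<open>The second difference over a parallelogram is symmetric in u and v, so some value of one
  mixed derivative near x equals some value of the other near x. If the two differed at x,
  continuity would keep these values apart.\<close>

lemma symmetric_second_derivative_real:
  fixes f :: "'e::euclidean_space \<Rightarrow> real"
  assumes "open S" "smooth_on S f" "x \<in> S"
  shows "fd (\<lambda>y. fd f y u) x v = fd (\<lambda>y. fd f y v) x u"
proof (rule ccontr)
  define P where "P = (\<lambda>y. fd (\<lambda>y. fd f y u) y v)"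
  define Q where "Q = (\<lambda>y. fd (\<lambda>y. fd f y v) y u)"
  assume "\<not> ?thesis"
  then have "dist (P x) (Q x) > 0" by (simp add: P_def Q_def)
  then have e: "dist (P x) (Q x) / 2 > 0" by simp
  have "continuous_on S P" "continuous_on S Q"
    unfolding P_def Q_def using assms by (auto intro!: smooth_on_continuous smooth_on_fd)
  then have "isCont P x" "isCont Q x"
    using assms continuous_on_eq_continuous_at by blast+
  then have "eventually (\<lambda>y. dist (P y) (P x) < dist (P x) (Q x) / 2) (nhds x)"
    "eventually (\<lambda>y. dist (Q y) (Q x) < dist (P x) (Q x) / 2) (nhds x)"
    unfolding isCont_def tendsto_at_iff_tendsto_nhds using e by (blast intro: tendstoD)+
  then have "eventually (\<lambda>y. y \<in> S \<and> dist (P y) (P x) < dist (P x) (Q x) / 2 \<and>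
      dist (Q y) (Q x) < dist (P x) (Q x) / 2) (nhds x)"
    using assms by (auto intro!: eventually_conj eventually_nhds_in_open)
  then obtain r where r: "r > 0" "\<And>y. dist y x < r \<Longrightarrow> y \<in> S \<and>
      dist (P y) (P x) < dist (P x) (Q x) / 2 \<and> dist (Q y) (Q x) < dist (P x) (Q x) / 2"
    unfolding eventually_nhds_metric by metis
  \<comment> \<open>Small enough for the whole parallelogram to lie in the ball of radius r; the
    summand 1 covers the case u = v = 0.\<close>
  define s where "s = r / (2 * (norm u + norm v + 1))"
  have pos: "norm u + norm v + 1 > 0" by (simp add: add_nonneg_pos)
  have s: "s > 0" using r pos by (simp add: s_def)
  have near: "dist (x + a *\<^sub>R u + b *\<^sub>R v) x < r" if "0 \<le> a" "a \<le> s" "0 \<le> b" "b \<le> s" for a b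
  proof -
    have "dist (x + a *\<^sub>R u + b *\<^sub>R v) x \<le> a * norm u + b * norm v"
      using that norm_triangle_ineq[of "a *\<^sub>R u" "b *\<^sub>R v"] by (simp add: dist_norm add.assoc)
    also have "\<dots> \<le> s * norm u + s * norm v"
      using that by (intro add_mono mult_right_mono) auto
    also have "\<dots> \<le> s * (norm u + norm v + 1)" using s by (simp add: algebra_simps)
    also have "\<dots> = r / 2"
    proof -
      have "r / (2 * N) * N = r / 2" if "N > 0" for N :: real
        using that by simp
      then show ?thesis unfolding s_def using pos by blast
    qed
    finally show ?thesis using r(1) by simp
  qed
  have smf: "(f has_derivative fd f y) (at y)" "((\<lambda>y. fd f y w) has_derivative fd (\<lambda>y. fd f y w) y) (at y)"
    if "y \<in> S" for y w
    using that assms by (auto intro!: smooth_on_has_derivative smooth_on_fd)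
  have "\<exists>a b. 0 \<le> a \<and> a \<le> s \<and> 0 \<le> b \<and> b \<le> s \<and>
    f (x + s *\<^sub>R u + s *\<^sub>R v) - f (x + s *\<^sub>R u) - f (x + s *\<^sub>R v) + f x
      = s * s * fd (\<lambda>y. fd f y u) (x + a *\<^sub>R u + b *\<^sub>R v) v"
    by (rule mixed_derivative_mvt[OF s, where f' = "fd f"]) (intro smf conjunct1[OF r(2)] near; assumption)+
  then obtain a b where ab: "0 \<le> a" "a \<le> s" "0 \<le> b" "b \<le> s" and 1:
    "f (x + s *\<^sub>R u + s *\<^sub>R v) - f (x + s *\<^sub>R u) - f (x + s *\<^sub>R v) + f x
      = s * s * P (x + a *\<^sub>R u + b *\<^sub>R v)"
    unfolding P_def by metis
  have near': "dist (x + a *\<^sub>R v + b *\<^sub>R u) x < r" if "0 \<le> a" "a \<le> s" "0 \<le> b" "b \<le> s" for a b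
    using near[OF that(3,4,1,2)] by (simp add: ac_simps)
  have "\<exists>a b. 0 \<le> a \<and> a \<le> s \<and> 0 \<le> b \<and> b \<le> s \<and>
    f (x + s *\<^sub>R v + s *\<^sub>R u) - f (x + s *\<^sub>R v) - f (x + s *\<^sub>R u) + f x
      = s * s * fd (\<lambda>y. fd f y v) (x + a *\<^sub>R v + b *\<^sub>R u) u"
    by (rule mixed_derivative_mvt[OF s, where f' = "fd f"]) (intro smf conjunct1[OF r(2)] near'; assumption)+
  then obtain a' b' where ab': "0 \<le> a'" "a' \<le> s" "0 \<le> b'" "b' \<le> s" and 2:
    "f (x + s *\<^sub>R v + s *\<^sub>R u) - f (x + s *\<^sub>R v) - f (x + s *\<^sub>R u) + f x
      = s * s * Q (x + a' *\<^sub>R v + b' *\<^sub>R u)"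
    unfolding Q_def by metis
  have swap: "x + s *\<^sub>R v + s *\<^sub>R u = x + s *\<^sub>R u + s *\<^sub>R v" by simp
  have "s * s * P (x + a *\<^sub>R u + b *\<^sub>R v) = s * s * Q (x + a' *\<^sub>R v + b' *\<^sub>R u)"
    using 1 2[unfolded swap] by linarith
  then have "P (x + a *\<^sub>R u + b *\<^sub>R v) = Q (x + a' *\<^sub>R v + b' *\<^sub>R u)"
    using s by simp
  moreover have "dist (P (x + a *\<^sub>R u + b *\<^sub>R v)) (P x) < dist (P x) (Q x) / 2"
    "dist (Q (x + a' *\<^sub>R v + b' *\<^sub>R u)) (Q x) < dist (P x) (Q x) / 2"
    using r(2) near[OF ab] near'[OF ab'] by blast+
  ultimately show False
    using dist_triangle3[of "P x" "Q x" "P (x + a *\<^sub>R u + b *\<^sub>R v)"] by simp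
qed

lemma symmetric_second_derivative:
  fixes f :: "'e::euclidean_space \<Rightarrow> 'f::euclidean_space"
  assumes "open S" "smooth_on S f" "x \<in> S"
  shows "fd (\<lambda>y. fd f y u) x v = fd (\<lambda>y. fd f y v) x u"
proof (rule euclidean_eqI)
  fix b :: 'f
  have sm: "smooth_on S (\<lambda>y. f y \<bullet> b)"
    using assms by (intro smooth_on_inner smooth_on_const)
  have 1: "fd (\<lambda>y. f y \<bullet> b) y w = fd f y w \<bullet> b" if "y \<in> S" for y w
    by (subst fd_eq[OF has_derivative_inner_left[OF smooth_on_has_derivative[OF assms(2) that]]]) simp
  have 2: "fd (\<lambda>y. fd (\<lambda>y. f y \<bullet> b) y w) x z = fd (\<lambda>y. fd f y w) x z \<bullet> b" for w z
  proof -
    have "fd (\<lambda>y. fd (\<lambda>y. f y \<bullet> b) y w) x = fd (\<lambda>y. fd f y w \<bullet> b) x"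
      using 1 assms by (intro fd_cong) (auto simp: eventually_nhds)
    also have "\<dots> = (\<lambda>z. fd (\<lambda>y. fd f y w) x z \<bullet> b)"
      using assms by (intro fd_eq has_derivative_inner_left smooth_on_has_derivative smooth_on_fd)
    finally show ?thesis by simp
  qed
  show "fd (\<lambda>y. fd f y u) x v \<bullet> b = fd (\<lambda>y. fd f y v) x u \<bullet> b"
    using symmetric_second_derivative_real[OF assms(1) sm assms(3), of u v] by (simp add: 2)
qed

section \<open>Inner products and orthonormal families\<close>

locale inner_form =
  fixes G :: "'e::euclidean_space \<Rightarrow> 'e \<Rightarrow> real"
  assumes bilinear: "bilinear G"
    and sym: "G u v = G v u"
    and pos: "u \<noteq> 0 \<Longrightarrow> G u u > 0"
begin

lemma lin_left: "linear (\<lambda>u. G u v)" and lin_right: "linear (G u)"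
  using bilinear by (auto simp: bilinear_def)

lemma simps [simp]:
  "G (a + b) c = G a c + G b c" "G c (a + b) = G c a + G c b"
  "G (a - b) c = G a c - G b c" "G c (a - b) = G c a - G c b"
  "G (r *\<^sub>R a) c = r * G a c" "G c (r *\<^sub>R a) = r * G c a"
  "G 0 a = 0" "G a 0 = 0"
  using bilinear
  by (auto simp: bilinear_ladd bilinear_radd bilinear_lsub bilinear_rsub bilinear_lmul bilinear_rmul
      bilinear_lzero bilinear_rzero)

lemma sum_left: "G (\<Sum>i\<in>I. f i) c = (\<Sum>i\<in>I. G (f i) c)"
  using linear_sum[OF lin_left] by simp

lemma eq_zero_iff: "G u u = 0 \<longleftrightarrow> u = 0"
  using pos[of u] by force

lemma nondegenerate: "(\<And>w. G u w = G v w) \<Longrightarrow> u = v"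
  using eq_zero_iff[of "u - v"] by simp

text \<open>Definiteness makes the coordinate map \<open>T\<close> injective, hence onto in finite
  dimension; a preimage of the coordinates of \<open>L\<close> represents \<open>L\<close>.\<close>

lemma riesz:
  assumes "linear L"
  shows "\<exists>u. \<forall>w. G u w = L w"
proof -
  define T where "T = (\<lambda>u. \<Sum>b\<in>Basis. G u b *\<^sub>R b)"
  have rep: "f w = (\<Sum>b\<in>Basis. (w \<bullet> b) * f b)" if "linear f" for f :: "'e \<Rightarrow> real" and w
  proof -
    have "f w = f (\<Sum>b\<in>Basis. (w \<bullet> b) *\<^sub>R b)" by (simp add: euclidean_representation)
    then show ?thesis using that by (simp add: linear_sum linear_cmul)
  qed
  have Tb: "T u \<bullet> b = G u b" if "b \<in> Basis" for u b
    using that by (simp add: T_def inner_sum_left inner_Basis if_distrib sum.delta cong: if_cong)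
  have lin: "linear T"
    by (rule linearI) (simp_all add: T_def algebra_simps sum.distrib scaleR_sum_right)
  have "inj T"
  proof (subst linear_injective_0[OF lin], intro allI impI)
    fix u assume "T u = 0"
    then have "G u b = 0" if "b \<in> Basis" for b using Tb[OF that, of u] by simp
    then have "G u u = 0" using rep[OF lin_right, of u u] by simp
    then show "u = 0" using eq_zero_iff by blast
  qed
  then have "surj T" using linear_injective_imp_surjective[OF lin] by blast
  then obtain u where u: "(\<Sum>b\<in>Basis. L b *\<^sub>R b) = T u" by (meson surj_def)
  have "G u b = L b" if "b \<in> Basis" for b
    using Tb[OF that, of u] that
    by (simp add: u[symmetric] inner_sum_left inner_Basis if_distrib sum.delta cong: if_cong)
  then have "G u w = L w" for w
    using rep[OF lin_right, of u w] rep[OF assms, of w] by simp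
  then show ?thesis by blast
qed

definition orthonormal :: "nat \<Rightarrow> (nat \<Rightarrow> 'e) \<Rightarrow> bool" where
  "orthonormal k e \<longleftrightarrow> (\<forall>i<k. \<forall>j<k. G (e i) (e j) = (if i = j then 1 else 0))"

lemma orthonormal_coeff:
  assumes "orthonormal k e" "j < k"
  shows "G (\<Sum>i<k. c i *\<^sub>R e i) (e j) = c j"
proof -
  have "G (\<Sum>i<k. c i *\<^sub>R e i) (e j) = (\<Sum>i<k. if i = j then c i else 0)"
    unfolding sum_left using assms by (intro sum.cong) (auto simp: orthonormal_def)
  then show ?thesis using assms by simp
qed

lemma orthonormal_independent:
  assumes "orthonormal k e"
  shows "inj_on e {..<k}" "independent (e ` {..<k})"
proof -
  show inj: "inj_on e {..<k}"
    using assms unfolding orthonormal_def inj_on_def by (metis lessThan_iff zero_neq_one)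
  show "independent (e ` {..<k})"
  proof (rule independent_if_scalars_zero)
    fix f x assume 0: "(\<Sum>x\<in>e ` {..<k}. f x *\<^sub>R x) = 0" and x: "x \<in> e ` {..<k}"
    obtain j where j: "j < k" "x = e j" using x by blast
    have "(\<Sum>i<k. f (e i) *\<^sub>R e i) = 0" using 0 inj by (simp add: sum.reindex)
    then show "f x = 0"
      using orthonormal_coeff[OF assms j(1), of "\<lambda>i. f (e i)"] j by simp
  qed simp
qed

text \<open>A full orthonormal family spans by counting dimensions, so the remainder, orthogonal to
  each member, is orthogonal to itself.\<close>

lemma orthonormal_expand:
  assumes "orthonormal DIM('e) e"
  shows "u = (\<Sum>i<DIM('e). G u (e i) *\<^sub>R e i)"
proof -
  define v where "v = u - (\<Sum>i<DIM('e). G u (e i) *\<^sub>R e i)"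
  have v: "G v (e j) = 0" if "j < DIM('e)" for j
    using orthonormal_coeff[OF assms that] by (simp add: v_def)
  have "card (e ` {..<DIM('e)}) = DIM('e)"
    using orthonormal_independent(1)[OF assms] by (simp add: card_image)
  then have "span (e ` {..<DIM('e)}) = UNIV"
    using orthonormal_independent(2)[OF assms]
    by (metis dim_eq_full dim_eq_card_independent)
  then have "v \<in> span (e ` {..<DIM('e)})" by simp
  then have "G v v = 0"
    by (rule linear_eq_0_on_span[OF lin_right, rotated]) (use v in auto)
  then show ?thesis using eq_zero_iff[of v] by (simp add: v_def)
qed

lemma parseval:
  assumes "orthonormal DIM('e) e"
  shows "(\<Sum>i<DIM('e). G (e i) u * G (e i) v) = G u v"
proof -
  have "G u v = G (\<Sum>i<DIM('e). G u (e i) *\<^sub>R e i) v"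
    using orthonormal_expand[OF assms] by metis
  also have "\<dots> = (\<Sum>i<DIM('e). G u (e i) * G (e i) v)" by (simp only: sum_left simps)
  finally show ?thesis by (simp only: sym[of u "e _"])
qed

end

text \<open>The hypothesis \<open>lift\<close> says that \<open>L L\<^sup>* = id\<close>.\<close>
lemma trace_push:
  fixes G :: "'e::euclidean_space \<Rightarrow> 'e \<Rightarrow> real" and H :: "'f::euclidean_space \<Rightarrow> 'f \<Rightarrow> real"
    and B :: "'f \<Rightarrow> 'f \<Rightarrow> 'v::real_vector"
  assumes G: "inner_form G" and H: "inner_form H"
    and e: "inner_form.orthonormal G DIM('e) e" and \<epsilon>: "inner_form.orthonormal H DIM('f) \<epsilon>"
    and B: "bilinear B"
    and lift: "\<And>w. \<exists>w'. L w' = w \<and> (\<forall>u. H (L u) w = G u w')"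
  shows "(\<Sum>i<DIM('e). B (L (e i)) (L (e i))) = (\<Sum>j<DIM('f). B (\<epsilon> j) (\<epsilon> j))"
proof -
  interpret G: inner_form G by (fact G)
  interpret H: inner_form H by (fact H)
  have "\<forall>j. \<exists>w. L w = \<epsilon> j \<and> (\<forall>u. H (L u) (\<epsilon> j) = G u w)"
    using lift by blast
  from choice[OF this] obtain w
    where w: "\<And>j. L (w j) = \<epsilon> j" "\<And>j u. H (L u) (\<epsilon> j) = G u (w j)"
    by blast
  \<comment> \<open>The vectors \<open>w j\<close> are the images of \<epsilon> under the adjoint of
    \<open>L\<close>. Since \<open>L\<close> undoes the adjoint they are orthonormal, and Parseval
    reduces the sum over \<open>e\<close> to their Gram matrix.\<close>
  have Gw: "G (w j) (w k) = (if j = k then 1 else 0)" if "j < DIM('f)" "k < DIM('f)" for j k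
    using \<epsilon> that w(1)[of j] w(2)[of "w j" k] by (simp add: H.orthonormal_def)
  have Le: "L (e i) = (\<Sum>j<DIM('f). G (e i) (w j) *\<^sub>R \<epsilon> j)" for i
    using H.orthonormal_expand[OF \<epsilon>, of "L (e i)"] by (simp add: w)
  have "(\<Sum>i<DIM('e). B (L (e i)) (L (e i)))
      = (\<Sum>i<DIM('e). \<Sum>j<DIM('f). \<Sum>k<DIM('f). (G (e i) (w j) * G (e i) (w k)) *\<^sub>R B (\<epsilon> j) (\<epsilon> k))"
    unfolding Le bilinear_sum_sum[OF B]
    by (intro sum.cong refl) (simp add: bilinear_lmul[OF B] bilinear_rmul[OF B] mult.commute)
  also have "\<dots> = (\<Sum>j<DIM('f). \<Sum>k<DIM('f). \<Sum>i<DIM('e). (G (e i) (w j) * G (e i) (w k)) *\<^sub>R B (\<epsilon> j) (\<epsilon> k))"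
    by (subst sum.swap) (simp add: sum.swap[of _ "{..<DIM('e)}"])
  also have "\<dots> = (\<Sum>j<DIM('f). \<Sum>k<DIM('f). G (w j) (w k) *\<^sub>R B (\<epsilon> j) (\<epsilon> k))"
    by (simp add: scaleR_sum_left[symmetric] G.parseval[OF e])
  also have "\<dots> = (\<Sum>j<DIM('f). \<Sum>k<DIM('f). if j = k then B (\<epsilon> j) (\<epsilon> j) else 0)"
    by (intro sum.cong) (auto simp: Gw)
  finally show ?thesis by simp
qed

text \<open>The identity is its own adjoint, so \<open>trace_push\<close> compares the two
  frames.\<close>

lemma trace_frame_independent:
  fixes G :: "'e::euclidean_space \<Rightarrow> 'e \<Rightarrow> real" and B :: "'e \<Rightarrow> 'e \<Rightarrow> 'v::real_vector"
  assumes "inner_form G" "inner_form.orthonormal G DIM('e) e" "inner_form.orthonormal G DIM('e) e'"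
    and "bilinear B"
  shows "(\<Sum>i<DIM('e). B (e i) (e i)) = (\<Sum>i<DIM('e). B (e' i) (e' i))"
  using trace_push[OF assms(1,1,2,3,4), of "\<lambda>x. x"] by blast

section \<open>Smooth metrics on open sets of Euclidean space\<close>

locale smooth_metric =
  fixes S :: "'e::euclidean_space set" and G :: "'e \<Rightarrow> 'e \<Rightarrow> 'e \<Rightarrow> real"
  assumes open_S: "open S"
    and ip: "x \<in> S \<Longrightarrow> inner_form (G x)"
    and smooth_coeff: "smooth_on S (\<lambda>x. G x u v)"
begin

lemma smooth_metric_subset:
  assumes "open T" "T \<subseteq> S"
  shows "smooth_metric T G"
proof (rule smooth_metric.intro)
  show "inner_form (G x)" if "x \<in> T" for x using that assms ip by blast
  show "smooth_on T (\<lambda>x. G x u v)" for u v using assms smooth_coeff smooth_on_subset by blast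
qed (fact assms)

lemma smooth_on_metric:
  assumes "T \<subseteq> S" "open T" "smooth_on T X" "smooth_on T Y"
  shows "smooth_on T (\<lambda>x. G x (X x) (Y x))"
proof (rule smooth_on_bilinear_family[OF assms(2) _ _ assms(3,4)])
  show "bilinear (G x)" if "x \<in> T" for x
    using that assms(1) ip inner_form.bilinear by blast
qed (rule smooth_on_subset[OF smooth_coeff assms(1)])

text \<open>Independence is assumed at \<open>x0\<close> alone: the residual \<open>r\<close> is
  nonzero there, and by continuity on a smaller neighbourhood, so the domain shrinks at each step.
  The span clause lets linear conditions on the \<open>f i\<close>, such as verticality, pass to the
  \<open>e i\<close>.\<close>

lemma gram_schmidt:
  assumes "x0 \<in> S"
    and "\<And>i. i < k \<Longrightarrow> smooth_on S (f i)"
    and "inj_on (\<lambda>i. f i x0) {..<k}" "independent ((\<lambda>i. f i x0) ` {..<k})"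
  shows "\<exists>T e. open T \<and> x0 \<in> T \<and> T \<subseteq> S \<and> (\<forall>i<k. smooth_on T (e i)) \<and>
    (\<forall>x\<in>T. inner_form.orthonormal (G x) k (\<lambda>i. e i x)) \<and>
    (\<forall>x\<in>T. \<forall>i<k. e i x \<in> span ((\<lambda>i. f i x) ` {..<k}))"
  using assms(2-)
proof (induction k)
  case 0
  show ?case
    using open_S assms(1) inner_form.orthonormal_def[OF ip]
    by (intro exI[of _ S] exI[of _ "\<lambda>i x. 0"]) auto
next
  case (Suc k)
  have ind: "independent ((\<lambda>i. f i x0) ` {..<k})"
    using Suc.prems(3) by (rule independent_mono) auto
  have inj: "inj_on (\<lambda>i. f i x0) {..<k}"
    using Suc.prems(2) by (rule inj_on_subset) auto
  obtain T e where T: "open T" "x0 \<in> T" "T \<subseteq> S" and e: "\<And>i. i < k \<Longrightarrow> smooth_on T (e i)"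
    and on: "\<And>x. x \<in> T \<Longrightarrow> inner_form.orthonormal (G x) k (\<lambda>i. e i x)"
    and sp: "\<And>x i. x \<in> T \<Longrightarrow> i < k \<Longrightarrow> e i x \<in> span ((\<lambda>i. f i x) ` {..<k})"
    using Suc.IH[OF Suc.prems(1)[OF less_SucI] inj ind] by metis
  define r where "r = (\<lambda>x. f k x - (\<Sum>i<k. G x (f k x) (e i x) *\<^sub>R e i x))"
  have fk: "smooth_on T (f k)"
    using Suc.prems(1) T smooth_on_subset by blast
  have r: "smooth_on T r"
    unfolding r_def using T e fk
    by (intro smooth_on_diff smooth_on_sum smooth_on_scaleR smooth_on_metric) auto
  have proj: "(\<Sum>i<k. c i *\<^sub>R e i x) \<in> span ((\<lambda>i. f i x) ` {..<k})" if "x \<in> T" for x c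
    using sp that by (intro span_sum span_mul) auto
  have "r x0 \<noteq> 0"
  proof
    assume "r x0 = 0"
    then have *: "f k x0 \<in> span ((\<lambda>i. f i x0) ` {..<k})"
      using proj[OF T(2), of "\<lambda>i. G x0 (f k x0) (e i x0)"] by (simp add: r_def)
    have "f k x0 \<notin> (\<lambda>i. f i x0) ` {..<k}"
    proof
      assume "f k x0 \<in> (\<lambda>i. f i x0) ` {..<k}"
      then obtain i where "i < k" "f k x0 = f i x0" by auto
      then show False using inj_onD[OF Suc.prems(2), of k i] by auto
    qed
    moreover have "independent (insert (f k x0) ((\<lambda>i. f i x0) ` {..<k}))"
      using Suc.prems(3) by (simp add: lessThan_Suc)
    ultimately show False
      using * by (simp add: independent_insert)
  qed
  define T' where "T' = T \<inter> r -` (- {0})"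
  have T': "open T'" "x0 \<in> T'" "T' \<subseteq> T"
    using continuous_open_preimage[OF smooth_on_continuous[OF r] T(1), of "- {0}"] T \<open>r x0 \<noteq> 0\<close>
    by (auto simp: T'_def)
  have rpos: "G x (r x) (r x) > 0" if "x \<in> T'" for x
    using that T T' inner_form.pos[OF ip] by (auto simp: T'_def)
  \<comment> \<open>The norm is inverted as a real power, which is smooth because its base stays
    positive on \<open>T'\<close>.\<close>
  define e' where "e' = (\<lambda>i x. if i < k then e i x else (G x (r x) (r x) powr (-1/2)) *\<^sub>R r x)"
  have rT': "smooth_on T' r" using r T' smooth_on_subset by blast
  have "smooth_on T' (e' i)" if "i < Suc k" for i
  proof (cases "i < k")
    case True
    then have "e' i = e i" by (simp add: e'_def)
    then show ?thesis using e True T' smooth_on_subset by metis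
  next
    case False
    then have "e' i = (\<lambda>x. (G x (r x) (r x) powr (-1/2)) *\<^sub>R r x)" by (simp add: e'_def)
    then show ?thesis
      using T T' rT' rpos by (auto intro!: smooth_on_scaleR smooth_on_powr smooth_on_metric)
  qed
  moreover have "inner_form.orthonormal (G x) (Suc k) (\<lambda>i. e' i x)" if x: "x \<in> T'" for x
  proof -
    interpret inner_form "G x" using ip x T' T by blast
    have on': "orthonormal k (\<lambda>i. e i x)" using on x T' by blast
    have re: "G x (r x) (e j x) = 0" "G x (e j x) (r x) = 0" if "j < k" for j
      using orthonormal_coeff[OF on' that, of "\<lambda>i. G x (f k x) (e i x)"]
      by (auto simp: r_def sym[of "e j x"])
    define c where "c = G x (r x) (r x)"
    have "c > 0" using rpos[OF x] by (simp add: c_def)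
    then have "c powr (-1/2) * (c powr (-1/2) * c) = 1"
      by (simp add: powr_minus powr_half_sqrt field_simps)
    then show ?thesis
      using on' re by (auto simp: orthonormal_def e'_def c_def less_Suc_eq)
  qed
  moreover have "e' i x \<in> span ((\<lambda>i. f i x) ` {..<Suc k})" if x: "x \<in> T'" for i x
  proof -
    have sub: "span ((\<lambda>i. f i x) ` {..<k}) \<subseteq> span ((\<lambda>i. f i x) ` {..<Suc k})"
      by (intro span_mono) auto
    have "f k x \<in> span ((\<lambda>i. f i x) ` {..<Suc k})" by (auto intro: span_base)
    then have "r x \<in> span ((\<lambda>i. f i x) ` {..<Suc k})"
      unfolding r_def using x T' by (intro span_diff subsetD[OF sub, OF proj]) auto
    then show ?thesis
      using sp[of x i] sub x T' by (auto simp: e'_def intro: span_mul)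
  qed
  ultimately show ?case
    using T T' by (intro exI[of _ T'] exI[of _ e']) auto
qed

lemma local_frame:
  assumes "x0 \<in> S"
  shows "\<exists>T e. open T \<and> x0 \<in> T \<and> T \<subseteq> S \<and> (\<forall>i<DIM('e). smooth_on T (e i)) \<and>
    (\<forall>x\<in>T. inner_form.orthonormal (G x) DIM('e) (\<lambda>i. e i x))"
proof -
  obtain f :: "nat \<Rightarrow> 'e" where f: "bij_betw f {..<DIM('e)} Basis"
    using ex_bij_betw_nat_finite[OF finite_Basis] by (metis atLeast0LessThan)
  show ?thesis
    using gram_schmidt[OF assms, of "DIM('e)" "\<lambda>i x. f i"] f
    by (force simp: bij_betw_def smooth_on_const independent_Basis)
qed

end

section \<open>The Levi-Civita connection in a chart\<close>

text \<open>The condition inside \<open>christoffel\<close>, with the metric read as a function of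
  the chart coordinates.\<close>

definition is_lc :: "('e::euclidean_space \<Rightarrow> 'e \<Rightarrow> 'e \<Rightarrow> real) \<Rightarrow> 'e \<Rightarrow> ('e \<Rightarrow> 'e \<Rightarrow> 'e) \<Rightarrow> bool" where
  "is_lc G x \<Gamma> \<longleftrightarrow> (\<forall>u v. \<Gamma> u v = \<Gamma> v u) \<and>
     (\<forall>u v w. fd (\<lambda>y. G y u v) x w = G x (\<Gamma> w u) v + G x u (\<Gamma> w v))"

definition lc :: "('e::euclidean_space \<Rightarrow> 'e \<Rightarrow> 'e \<Rightarrow> real) \<Rightarrow> 'e \<Rightarrow> 'e \<Rightarrow> 'e \<Rightarrow> 'e" where
  "lc G x = (THE \<Gamma>. is_lc G x \<Gamma>)"

text \<open>Right-hand side of the Koszul formula for fields with constant components, whose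
  brackets vanish.\<close>

definition koszul :: "('e::euclidean_space \<Rightarrow> 'e \<Rightarrow> 'e \<Rightarrow> real) \<Rightarrow> 'e \<Rightarrow> 'e \<Rightarrow> 'e \<Rightarrow> 'e \<Rightarrow> real" where
  "koszul G x u v w =
     (fd (\<lambda>y. G y v w) x u + fd (\<lambda>y. G y u w) x v - fd (\<lambda>y. G y u v) x w) / 2"

context smooth_metric
begin

lemma coeff_has_derivative: "x \<in> S \<Longrightarrow> ((\<lambda>y. G y u v) has_derivative fd (\<lambda>y. G y u v) x) (at x)"
  by (rule smooth_on_has_derivative[OF smooth_coeff])

lemma eventually_S: "x \<in> S \<Longrightarrow> eventually (\<lambda>y. y \<in> S) (nhds x)"
  using open_S eventually_nhds_in_open by blast

lemma fd_coeff_linear: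
  assumes "x \<in> S"
  shows "linear (fd (\<lambda>y. G y u v) x)" "linear (\<lambda>u. fd (\<lambda>y. G y u v) x w)"
    "linear (\<lambda>v. fd (\<lambda>y. G y u v) x w)" "fd (\<lambda>y. G y u v) x w = fd (\<lambda>y. G y v u) x w"
proof -
  note d = coeff_has_derivative[OF assms]
  note ev = eventually_S[OF assms]
  show "linear (fd (\<lambda>y. G y u v) x)" for u v using d has_derivative_linear by blast
  show sy: "fd (\<lambda>y. G y u v) x w = fd (\<lambda>y. G y v u) x w" for u v
    by (rule fun_cong[OF fd_cong]) (use ev ip inner_form.sym in \<open>auto elim!: eventually_mono\<close>)
  have add: "fd (\<lambda>y. G y (a + b) v) x w = fd (\<lambda>y. G y a v) x w + fd (\<lambda>y. G y b v) x w" for a b v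
  proof -
    have "fd (\<lambda>y. G y (a + b) v) x = fd (\<lambda>y. G y a v + G y b v) x"
      by (rule fd_cong) (use ev in \<open>auto elim!: eventually_mono simp: inner_form.simps ip\<close>)
    then show ?thesis using fd_eq[OF has_derivative_add[OF d d]] by simp
  qed
  have mul: "fd (\<lambda>y. G y (r *\<^sub>R a) v) x w = r * fd (\<lambda>y. G y a v) x w" for a v r
  proof -
    have "fd (\<lambda>y. G y (r *\<^sub>R a) v) x = fd (\<lambda>y. r * G y a v) x"
      by (rule fd_cong) (use ev in \<open>auto elim!: eventually_mono simp: inner_form.simps ip\<close>)
    then show ?thesis using fd_eq[OF has_derivative_mult_right[OF d]] by simp
  qed
  show "linear (\<lambda>u. fd (\<lambda>y. G y u v) x w)" for v
    by (rule linearI) (simp_all add: add mul)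
  then show "linear (\<lambda>v. fd (\<lambda>y. G y u v) x w)" by (simp add: sy[of u])
qed

lemma koszul_linear:
  assumes "x \<in> S"
  shows "linear (koszul G x u v)" "linear (\<lambda>v. koszul G x u v w)"
  using fd_coeff_linear[OF assms]
  by (auto simp: koszul_def linear_iff field_simps)

text \<open>Compatibility turns the three derivatives into six terms; by symmetry of \<Gamma> four
  of them cancel and the other two agree. This is the uniqueness half of the fundamental theorem of
  Riemannian geometry.\<close>

lemma is_lc_koszul:
  assumes "x \<in> S" "is_lc G x \<Gamma>"
  shows "G x (\<Gamma> u v) w = koszul G x u v w"
proof -
  interpret inner_form "G x" using ip assms by blast
  have s: "\<Gamma> a b = \<Gamma> b a" and c: "fd (\<lambda>y. G y a b) x d = G x (\<Gamma> d a) b + G x a (\<Gamma> d b)" for a b d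
    using assms(2) unfolding is_lc_def by blast+
  show ?thesis
    unfolding koszul_def c using s[of v u] s[of w u] s[of w v] sym[of v] sym[of u] by simp
qed

text \<open>Existence is the Riesz representation of the Koszul form, uniqueness is nondegeneracy;
  together they make the definite description in \<open>lc\<close> denote.\<close>

lemma is_lc_lc:
  assumes "x \<in> S"
  shows "is_lc G x (lc G x)"
proof -
  interpret inner_form "G x" using ip assms by blast
  have "\<forall>u v. \<exists>a. \<forall>w. G x a w = koszul G x u v w"
    using riesz koszul_linear(1)[OF assms] by blast
  then obtain \<Gamma> where \<Gamma>: "\<And>u v w. G x (\<Gamma> u v) w = koszul G x u v w" by metis
  have fs: "fd (\<lambda>y. G y u v) x w = fd (\<lambda>y. G y v u) x w" for u v w
    using fd_coeff_linear(4)[OF assms] .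
  have "koszul G x u v w = koszul G x v u w" for u v w
    using fs[of u v w] by (simp add: koszul_def)
  then have "\<Gamma> u v = \<Gamma> v u" for u v by (intro nondegenerate) (simp add: \<Gamma>)
  moreover have "fd (\<lambda>y. G y u v) x w = G x (\<Gamma> w u) v + G x u (\<Gamma> w v)" for u v w
    unfolding sym[of u] \<Gamma> koszul_def fs[of v u w] fs[of w u v] fs[of w v u]
    by (simp add: field_simps)
  ultimately have "is_lc G x \<Gamma>" by (simp add: is_lc_def)
  moreover have "\<Gamma>' = \<Gamma>" if "is_lc G x \<Gamma>'" for \<Gamma>'
    by (intro ext nondegenerate) (simp add: \<Gamma> is_lc_koszul[OF assms that])
  ultimately show ?thesis unfolding lc_def by (rule theI)
qed

lemma lc_koszul: "x \<in> S \<Longrightarrow> G x (lc G x u v) w = koszul G x u v w"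
  by (intro is_lc_koszul is_lc_lc)

lemma lc_sym: "x \<in> S \<Longrightarrow> lc G x u v = lc G x v u"
  and lc_compat: "x \<in> S \<Longrightarrow> fd (\<lambda>y. G y u v) x w = G x (lc G x w u) v + G x u (lc G x w v)"
  using is_lc_lc unfolding is_lc_def by blast+

text \<open>The characterisation by \<open>is_lc\<close> does not mention linearity; it is inherited
  from the Koszul form by testing against all w.\<close>

lemma bilinear_lc:
  assumes "x \<in> S"
  shows "bilinear (lc G x)"
proof -
  interpret inner_form "G x" using ip assms by blast
  note l = koszul_linear[OF assms]
  have 1: "linear (\<lambda>v. lc G x u v)" for u
  proof (rule linearI; rule nondegenerate)
    fix a b w show "G x (lc G x u (a + b)) w = G x (lc G x u a + lc G x u b) w"
      using linear_add[OF l(2)[of u w], of a b] by (simp add: lc_koszul[OF assms])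
  next
    fix r a w show "G x (lc G x u (r *\<^sub>R a)) w = G x (r *\<^sub>R lc G x u a) w"
      using linear_cmul[OF l(2)[of u w], of r a] by (simp add: lc_koszul[OF assms])
  qed
  moreover have "(\<lambda>u. lc G x u v) = lc G x v" for v
    using lc_sym[OF assms] by blast
  ultimately show ?thesis by (simp add: bilinear_def)
qed

text \<open>In a smooth orthonormal frame the components of \<open>lc\<close> are values of the
  Koszul form on the frame, so no inverse of the metric matrix has to be differentiated.\<close>

lemma lc_differentiable:
  assumes "x0 \<in> S"
  shows "(\<lambda>x. lc G x u v) differentiable (at x0)"
proof -
  obtain T e where T: "open T" "x0 \<in> T" "T \<subseteq> S"
    and e: "\<And>i. i < DIM('e) \<Longrightarrow> smooth_on T (e i)"
    and on: "\<And>x. x \<in> T \<Longrightarrow> inner_form.orthonormal (G x) DIM('e) (\<lambda>i. e i x)"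
    using local_frame[OF assms] by metis
  have rep: "lc G x u v = (\<Sum>i<DIM('e). koszul G x u v (e i x) *\<^sub>R e i x)" if "x \<in> T" for x
    using inner_form.orthonormal_expand[OF ip on[OF that], of "lc G x u v"] that T lc_koszul
    by (simp add: subset_iff)
  have "smooth_on S (\<lambda>x. (fd (\<lambda>y. G y v w) x u + fd (\<lambda>y. G y u w) x v - fd (\<lambda>y. G y u v) x w) * (1 / 2))"
    for w
    by (intro smooth_on_mult smooth_on_diff smooth_on_add smooth_on_fd smooth_coeff smooth_on_const
        open_S)
  then have "(\<lambda>x. koszul G x u v w) differentiable (at x0)" for w
    using assms by (auto simp: koszul_def intro: smooth_on_differentiable)
  then have k: "((\<lambda>x. koszul G x u v w) has_derivative fd (\<lambda>x. koszul G x u v w) x0) (at x0)" for w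
    by (rule fd_works)
  have "(\<lambda>x. koszul G x u v (e i x)) differentiable (at x0)" if "i < DIM('e)" for i
  proof -
    have "eventually (\<lambda>x. linear (koszul G x u v)) (nhds x0)"
      using eventually_S[OF assms] koszul_linear(1) by (auto elim: eventually_mono)
    from has_derivative_linear_family[OF k this smooth_on_has_derivative[OF e[OF that] T(2)]]
    show ?thesis unfolding differentiable_def by blast
  qed
  then have "((\<lambda>x. \<Sum>i<DIM('e). koszul G x u v (e i x) *\<^sub>R e i x) has_derivative
      (\<lambda>z. \<Sum>i<DIM('e). koszul G x0 u v (e i x0) *\<^sub>R fd (e i) x0 z
        + fd (\<lambda>x. koszul G x u v (e i x)) x0 z *\<^sub>R e i x0)) (at x0)"
    using T e by (intro has_derivative_sum has_derivative_scaleR fd_works)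
      (auto intro: smooth_on_differentiable)
  then have "(\<lambda>x. \<Sum>i<DIM('e). koszul G x u v (e i x) *\<^sub>R e i x) differentiable (at x0)"
    unfolding differentiable_def by blast
  then show ?thesis
    using rep T by (subst differentiable_cong_nhds) (auto simp: eventually_nhds)
qed

lemma lc_has_derivative:
  "x \<in> S \<Longrightarrow> ((\<lambda>y. lc G y u v) has_derivative fd (\<lambda>y. lc G y u v) x) (at x)"
  by (rule fd_works[OF lc_differentiable])

lemma eventually_bilinear_lc: "x \<in> S \<Longrightarrow> eventually (\<lambda>y. bilinear (lc G y)) (nhds x)"
  using eventually_mono[OF eventually_S bilinear_lc] .

section \<open>Covariant derivatives and curvature in a chart\<close>

definition cov :: "('e \<Rightarrow> 'e) \<Rightarrow> 'e \<Rightarrow> 'e \<Rightarrow> 'e" where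
  "cov t y w = fd t y w + lc G y w (t y)"

text \<open>The tensor \<nabla>\<nabla>t(a, b), with a and b extended by constant components: the
  derivative of b along a is then the Christoffel term alone.\<close>

definition cov2 :: "('e \<Rightarrow> 'e) \<Rightarrow> 'e \<Rightarrow> 'e \<Rightarrow> 'e \<Rightarrow> 'e" where
  "cov2 t y a b = fd (\<lambda>z. cov t z b) y a + lc G y a (cov t y b) - cov t y (lc G y a b)"

text \<open>R(u, v) w for extensions with constant components, whose bracket vanishes.\<close>

definition curv :: "'e \<Rightarrow> 'e \<Rightarrow> 'e \<Rightarrow> 'e \<Rightarrow> 'e" where
  "curv y u v w = fd (\<lambda>z. lc G z v w) y u + lc G y u (lc G y v w)
     - fd (\<lambda>z. lc G z u w) y v - lc G y v (lc G y u w)"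

lemma linear_lc:
  assumes "y \<in> S"
  shows "linear (lc G y u)" "linear (\<lambda>u. lc G y u v)"
  using bilinear_lc[OF assms] by (auto simp: bilinear_def)

lemma linear_cov:
  assumes "smooth_on S t" "y \<in> S"
  shows "linear (cov t y)"
  unfolding cov_def
  by (intro linear_compose_add linear_fd smooth_on_differentiable[OF assms] linear_lc assms)

lemma cov_differentiable:
  assumes "smooth_on S t" "y \<in> S"
  shows "(\<lambda>z. cov t z w) differentiable (at y)"
proof -
  have ev: "eventually (\<lambda>x. linear (lc G x w)) (nhds y)"
    using eventually_bilinear_lc[OF assms(2)] by (auto elim!: eventually_mono simp: bilinear_def)
  have "((\<lambda>z. lc G z w (t z)) has_derivative
      (\<lambda>u. fd (\<lambda>z. lc G z w (t y)) y u + lc G y w (fd t y u))) (at y)"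
    by (rule has_derivative_linear_family[OF lc_has_derivative[OF assms(2)] ev
          smooth_on_has_derivative[OF assms]])
  then have "(\<lambda>z. lc G z w (t z)) differentiable (at y)" unfolding differentiable_def by blast
  moreover have "(\<lambda>z. fd t z w) differentiable (at y)"
    using assms smooth_on_differentiable smooth_on_fd by blast
  ultimately show ?thesis unfolding cov_def by (rule differentiable_add[rotated])
qed

lemma eventually_linear_cov:
  assumes "smooth_on S t" "y \<in> S"
  shows "eventually (\<lambda>y. linear (cov t y)) (nhds y)"
  using eventually_mono[OF eventually_S[OF assms(2)] linear_cov[OF assms(1)]] .

lemma bilinear_cov2:
  assumes "smooth_on S t" "y \<in> S"
  shows "bilinear (cov2 t y)"
proof -
  note c = linear_cov[OF assms]
  note l = linear_lc[OF assms(2)]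
  have 1: "linear (\<lambda>b. fd (\<lambda>z. cov t z b) y a)" for a
    by (rule linear_fd_family[OF cov_differentiable[OF assms] eventually_linear_cov[OF assms]])
  have 2: "linear (\<lambda>a. fd (\<lambda>z. cov t z b) y a)" for b
    by (rule linear_fd[OF cov_differentiable[OF assms]])
  show ?thesis
    unfolding bilinear_def cov2_def
    by (auto intro!: linearI simp: linear_add[OF 1] linear_add[OF 2] linear_add[OF c] linear_add[OF l(1)]
        linear_add[OF l(2)] linear_cmul[OF 1] linear_cmul[OF 2] linear_cmul[OF c] linear_cmul[OF l(1)]
        linear_cmul[OF l(2)] algebra_simps)
qed

lemma curv_antisym: "curv y u v w = - curv y v u w"
  by (simp add: curv_def)

text \<open>These are the two slots over which the trace runs; the middle one will hold the tension
  field.\<close>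

lemma bilinear_curv:
  assumes "y \<in> S"
  shows "bilinear (\<lambda>u w. curv y u v w)"
proof -
  note l = linear_lc[OF assms]
  note ev = eventually_bilinear_lc[OF assms]
  have 1: "linear (\<lambda>w. fd (\<lambda>z. lc G z v w) y u)" for u v
    by (rule linear_fd_family[OF lc_differentiable[OF assms]])
      (use ev in \<open>auto elim!: eventually_mono simp: bilinear_def\<close>)
  have 2: "linear (\<lambda>v. fd (\<lambda>z. lc G z v w) y u)" for u w
    by (rule linear_fd_family[of "\<lambda>z v. lc G z v w", OF lc_differentiable[OF assms]])
      (use ev in \<open>auto elim!: eventually_mono simp: bilinear_def\<close>)
  have 3: "linear (\<lambda>u. fd (\<lambda>z. lc G z v w) y u)" for v w
    by (rule linear_fd[OF lc_differentiable[OF assms]])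
  show ?thesis
    unfolding bilinear_def curv_def
    by (auto intro!: linearI simp: linear_add[OF 1] linear_add[OF 2] linear_add[OF 3] linear_add[OF l(1)]
        linear_add[OF l(2)] linear_cmul[OF 1] linear_cmul[OF 2] linear_cmul[OF 3] linear_cmul[OF l(1)]
        linear_cmul[OF l(2)] algebra_simps)
qed

end

section \<open>The second fundamental form of a map in charts\<close>

locale metric_map = M: smooth_metric S G + N: smooth_metric S' H
  for S :: "'e::euclidean_space set" and G and S' :: "'f::euclidean_space set" and H +
  fixes F :: "'e \<Rightarrow> 'f"
  assumes smooth_F: "smooth_on S F"
    and F_S: "x \<in> S \<Longrightarrow> F x \<in> S'"
begin

text \<open>The second fundamental form \<nabla>dF(u, v), computed on fields with constant
  components.\<close>

definition hess :: "'e \<Rightarrow> 'e \<Rightarrow> 'e \<Rightarrow> 'f" where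
  "hess x u v = fd (\<lambda>y. fd F y v) x u + lc H (F x) (fd F x u) (fd F x v) - fd F x (lc G x u v)"

lemma F_differentiable: "x \<in> S \<Longrightarrow> F differentiable (at x)"
  by (rule smooth_on_differentiable[OF smooth_F])

lemma eventually_linear_fd: "x \<in> S \<Longrightarrow> eventually (\<lambda>y. linear (fd F y)) (nhds x)"
  using eventually_mono[OF M.eventually_S linear_fd[OF F_differentiable]] .

lemma fd2_has_derivative:
  "x \<in> S \<Longrightarrow> ((\<lambda>y. fd F y v) has_derivative fd (\<lambda>y. fd F y v) x) (at x)"
  by (rule smooth_on_has_derivative[OF smooth_on_fd[OF smooth_F]])

lemma fd_field_has_derivative:
  assumes "x \<in> S" "(Y has_derivative Y') (at x)"
  shows "((\<lambda>y. fd F y (Y y)) has_derivative (\<lambda>z. fd (\<lambda>y. fd F y (Y x)) x z + fd F x (Y' z))) (at x)"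
  by (rule has_derivative_linear_family[OF fd2_has_derivative[OF assms(1)]
        eventually_linear_fd[OF assms(1)] assms(2)])

lemma compose_has_derivative:
  assumes "x \<in> S" "f differentiable (at (F x))"
  shows "((\<lambda>y. f (F y)) has_derivative (\<lambda>u. fd f (F x) (fd F x u))) (at x)"
  using diff_chain_at[OF fd_works[OF F_differentiable[OF assms(1)]] fd_works[OF assms(2)]]
  by (simp add: o_def)

text \<open>Partial derivatives commute and both connections are torsion-free.\<close>

lemma hess_sym: "x \<in> S \<Longrightarrow> hess x u v = hess x v u"
  unfolding hess_def
  using symmetric_second_derivative[OF M.open_S smooth_F, of x u v] M.lc_sym[of x u v]
    N.lc_sym[OF F_S, of x "fd F x u" "fd F x v"] by simp

lemma bilinear_hess:
  assumes x: "x \<in> S"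
  shows "bilinear (hess x)"
proof -
  note l = linear_fd[OF F_differentiable[OF x]] M.linear_lc(2)[OF x] N.linear_lc(2)[OF F_S[OF x]]
    has_derivative_linear[OF fd2_has_derivative[OF x]]
  have "linear (\<lambda>u. hess x u v)" for v
    unfolding hess_def
    by (auto intro!: linearI simp: l[THEN linear_add] l[THEN linear_cmul] algebra_simps)
  moreover have "(\<lambda>u. hess x u v) = hess x v" for v using hess_sym[OF x] by blast
  ultimately show ?thesis unfolding bilinear_def by (simp only: simp_thms)
qed

text \<open>
  \<open>K\<close> stands for the horizontal distribution. The trilinear form \<open>H (hess z u) (dF v)\<close> is symmetric
  in its first two arguments and, by differentiating the isometry condition, antisymmetric in its
  last two; hence it vanishes.
\<close>
lemma hess_horizontal:
  fixes K :: "'e \<Rightarrow> 'e set"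
  assumes x: "x \<in> S"
    and field: "\<And>u. u \<in> K x \<Longrightarrow> \<exists>X. X differentiable (at x) \<and> X x = u \<and> eventually (\<lambda>y. X y \<in> K y) (nhds x)"
    and iso: "\<And>y u v. y \<in> S \<Longrightarrow> u \<in> K y \<Longrightarrow> v \<in> K y \<Longrightarrow> H (F y) (fd F y u) (fd F y v) = G y u v"
    and adj: "\<And>w v. v \<in> K x \<Longrightarrow> H (F x) (fd F x w) (fd F x v) = G x w v"
    and onto: "\<And>w. \<exists>v\<in>K x. fd F x v = w"
    and uv: "u \<in> K x" "v \<in> K x"
  shows "hess x u v = 0"
proof -
  interpret G: inner_form "G x" using M.ip[OF x] .
  interpret H: inner_form "H (F x)" using N.ip[OF F_S[OF x]] .
  have anti: "H (F x) (hess x z a) (fd F x b) = - H (F x) (hess x z b) (fd F x a)"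
    if a: "a \<in> K x" and b: "b \<in> K x" for z a b
  proof -
    obtain X where X: "(X has_derivative fd X x) (at x)" "X x = a" "eventually (\<lambda>y. X y \<in> K y) (nhds x)"
      using field[OF a] fd_works by blast
    obtain Y where Y: "(Y has_derivative fd Y x) (at x)" "Y x = b" "eventually (\<lambda>y. Y y \<in> K y) (nhds x)"
      using field[OF b] fd_works by blast
    have bG: "eventually (\<lambda>y. bilinear (G y)) (nhds x)"
      using eventually_mono[OF M.eventually_S[OF x] inner_form.bilinear[OF M.ip]] .
    have bH: "eventually (\<lambda>y. bilinear (H (F y))) (nhds x)"
      using eventually_mono[OF M.eventually_S[OF x] inner_form.bilinear[OF N.ip[OF F_S]]] .
    have dH: "((\<lambda>y. H (F y) p q) has_derivative (\<lambda>u. fd (\<lambda>y. H y p q) (F x) (fd F x u))) (at x)" for p q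
      using N.coeff_has_derivative[OF F_S[OF x]]
      by (intro compose_has_derivative[OF x]) (auto simp: differentiable_def)
    have L: "((\<lambda>y. H (F y) (fd F y (X y)) (fd F y (Y y))) has_derivative
      (\<lambda>w. fd (\<lambda>y. H y (fd F x (X x)) (fd F x (Y x))) (F x) (fd F x w)
        + H (F x) (fd (\<lambda>y. fd F y (X x)) x w + fd F x (fd X x w)) (fd F x (Y x))
        + H (F x) (fd F x (X x)) (fd (\<lambda>y. fd F y (Y x)) x w + fd F x (fd Y x w)))) (at x)"
      by (rule has_derivative_bilinear_family[OF dH bH fd_field_has_derivative[OF x X(1)]
            fd_field_has_derivative[OF x Y(1)]])
    have R: "((\<lambda>y. G y (X y) (Y y)) has_derivative
      (\<lambda>w. fd (\<lambda>y. G y (X x) (Y x)) x w + G x (fd X x w) (Y x) + G x (X x) (fd Y x w))) (at x)"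
      by (rule has_derivative_bilinear_family[OF M.coeff_has_derivative[OF x] bG X(1) Y(1)])
    have "eventually (\<lambda>y. H (F y) (fd F y (X y)) (fd F y (Y y)) = G y (X y) (Y y)) (nhds x)"
      using X(3) Y(3) M.eventually_S[OF x] by eventually_elim (rule iso)
    from has_derivative_unique[OF L R[folded has_derivative_cong_nhds[OF this]], THEN fun_cong, of z]
    have "H (F x) (lc H (F x) (fd F x z) (fd F x a)) (fd F x b) + H (F x) (fd F x a) (lc H (F x) (fd F x z) (fd F x b))
        + H (F x) (fd (\<lambda>y. fd F y a) x z + fd F x (fd X x z)) (fd F x b)
        + H (F x) (fd F x a) (fd (\<lambda>y. fd F y b) x z + fd F x (fd Y x z))
      = G x (lc G x z a) b + G x a (lc G x z b) + G x (fd X x z) b + G x a (fd Y x z)"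
      unfolding X(2) Y(2) N.lc_compat[OF F_S[OF x]] M.lc_compat[OF x] .
    \<comment> \<open>The derivatives of the extensions \<open>X\<close> and \<open>Y\<close> may
      have vertical parts, to which the isometry condition does not apply. The hypothesis
      \<open>adj\<close> allows one arbitrary argument and absorbs them.\<close>
    moreover have "G x w b = H (F x) (fd F x w) (fd F x b)" "G x a w = H (F x) (fd F x a) (fd F x w)" for w
      using adj[OF b, of w] adj[OF a, of w] G.sym[of a] H.sym[of "fd F x a"] by simp_all
    ultimately show ?thesis
      unfolding hess_def using H.sym[of "fd F x a"] by simp
  qed
  have "H (F x) (hess x u v) w = 0" for w
  proof -
    obtain c where c: "c \<in> K x" "fd F x c = w" using onto by blast
    let ?T = "\<lambda>a b c. H (F x) (hess x a b) (fd F x c)"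
    have s: "?T a b c = ?T b a c" for a b c by (simp add: hess_sym[OF x, of a])
    \<comment> \<open>Alternating the two symmetries returns to the starting triple after three sign
      changes.\<close>
    have "?T u v c = - ?T u c v" using anti uv c by blast
    also have "\<dots> = - ?T c u v" by (simp add: s)
    also have "\<dots> = ?T c v u" using anti[OF uv, of c] by simp
    also have "\<dots> = ?T v c u" by (rule s)
    also have "\<dots> = - ?T v u c" using anti[OF c(1) uv(1), of v] by simp
    also have "\<dots> = - ?T u v c" by (simp add: s)
    finally show ?thesis using c by simp
  qed
  then show ?thesis by (intro H.nondegenerate) simp
qed

text \<open>The product rule for \<open>W\<close> produces a term with \<open>Y'\<close>, cancelled
  by the subtracted first-order term. The second derivative of \<open>F\<close> and the Christoffel
  term of \<open>G\<close> belong to \<open>hess\<close>; the Christoffel term of \<open>H\<close>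
  that completes \<open>hess\<close> is the one subtracted in \<open>cov2\<close>.\<close>

lemma second_cov_pullback:
  assumes x: "x \<in> S" and t: "smooth_on S' t" and Y: "(Y has_derivative Y') (at x)"
  defines "W \<equiv> \<lambda>y. N.cov t (F y) (fd F y (Y y))"
  shows "fd W x u + lc H (F x) (fd F x u) (W x) - N.cov t (F x) (fd F x (Y' u + lc G x u (Y x)))
    = N.cov2 t (F x) (fd F x u) (fd F x (Y x)) + N.cov t (F x) (hess x u (Y x))"
proof -
  note c = N.linear_cov[OF t F_S[OF x]]
  have "eventually (\<lambda>y. linear (N.cov t (F y))) (nhds x)"
    using eventually_mono[OF M.eventually_S[OF x] N.linear_cov[OF t F_S]] .
  from has_derivative_linear_family[OF compose_has_derivative[OF x
      N.cov_differentiable[OF t F_S[OF x]]] this fd_field_has_derivative[OF x Y]]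
  have "fd W x u = fd (\<lambda>z. N.cov t z (fd F x (Y x))) (F x) (fd F x u)
      + N.cov t (F x) (fd (\<lambda>y. fd F y (Y x)) x u + fd F x (Y' u))"
    unfolding W_def by (simp only: fd_eq)
  moreover have "linear (fd F x)" by (rule linear_fd[OF F_differentiable[OF x]])
  ultimately show ?thesis
    unfolding N.cov2_def hess_def W_def by (simp add: linear_add linear_diff c)
qed

end

section \<open>Riemannian submersions in charts\<close>

locale linear_submersion = G: inner_form G + H: inner_form H
  for G :: "'e::euclidean_space \<Rightarrow> 'e \<Rightarrow> real" and H :: "'f::euclidean_space \<Rightarrow> 'f \<Rightarrow> real" +
  fixes L :: "'e \<Rightarrow> 'f"
  assumes linear_L: "linear L" and surj_L: "surj L"
begin

definition horizontal :: "'e set" where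
  "horizontal = {u. \<forall>v. L v = 0 \<longrightarrow> G u v = 0}"

text \<open>The adjoint of \<open>L\<close> for the two inner products. It becomes the horizontal
  lift once \<open>L\<close> is an isometry on horizontal vectors; for a general surjection it is
  only a map into the horizontal space.\<close>

definition lift :: "'f \<Rightarrow> 'e" where
  "lift w = (SOME u. \<forall>v. G u v = H (L v) w)"

lemma G_lift: "G (lift w) v = H (L v) w"
proof -
  have "linear (\<lambda>v. H (L v) w)"
    using linear_compose[OF linear_L H.lin_left[of w]] by (simp add: o_def)
  from someI_ex[OF G.riesz[OF this]] show ?thesis by (simp add: lift_def)
qed

lemma lift_horizontal: "lift w \<in> horizontal"
  by (simp add: horizontal_def G_lift)

lemma linear_lift: "linear lift"
  by (rule linearI; rule G.nondegenerate) (simp_all add: G_lift)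

lemma horizontal_vertical_zero: "u \<in> horizontal \<Longrightarrow> L u = 0 \<Longrightarrow> u = 0"
  using G.eq_zero_iff[of u] by (auto simp: horizontal_def)

text \<open>A vector killed by \<open>L\<close> after \<open>lift\<close> has a lift that is both
  horizontal and vertical, hence zero, and is therefore orthogonal to the range of \<open>L\<close>.
  An injective endomorphism is onto.\<close>

lemma lift_onto: "\<exists>w'. L (lift w') = w"
proof -
  have lin: "linear (\<lambda>w. L (lift w))"
    using linear_compose[OF linear_lift linear_L] by (simp add: o_def)
  have "w = 0" if "L (lift w) = 0" for w
  proof -
    have "lift w = 0" using horizontal_vertical_zero[OF lift_horizontal that] .
    then have "H (L v) w = 0" for v using G_lift[of w v] by simp
    moreover obtain v where "w = L v" using surj_L by (rule surjE)
    ultimately have "H w w = 0" by metis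
    then show ?thesis using H.eq_zero_iff by blast
  qed
  then have "inj (\<lambda>w. L (lift w))" using linear_injective_0[OF lin] by blast
  then have "surj (\<lambda>w. L (lift w))" using linear_injective_imp_surjective[OF lin] by blast
  then show ?thesis by (metis surjD)
qed

text \<open>The kernel is the Euclidean orthogonal complement of the range of the Euclidean adjoint,
  which is injective because \<open>L\<close> is onto. The dimension is independent of the inner
  product, so the Euclidean one may replace \<open>G\<close>.\<close>

lemma dim_vertical: "dim {u. L u = 0} = DIM('e) - DIM('f)"
proof -
  have adj: "linear (adjoint L)" by (rule adjoint_linear[OF linear_L])
  have "inj (adjoint L)"
  proof (subst linear_injective_0[OF adj], intro allI impI)
    fix y assume "adjoint L y = 0"
    then have "L v \<bullet> y = 0" for v using adjoint_works[OF linear_L, of v y] by simp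
    moreover obtain v where "y = L v" using surj_L by (rule surjE)
    ultimately have "y \<bullet> y = 0" by metis
    then show "y = 0" by simp
  qed
  then have 1: "dim (range (adjoint L)) = DIM('f)"
    using dim_image_eq[OF adj, of UNIV] by (simp add: span_UNIV)
  have "{u. L u = 0} = {y \<in> UNIV. \<forall>x \<in> range (adjoint L). orthogonal x y}"
  proof -
    have "L u = 0 \<longleftrightarrow> (\<forall>w. adjoint L w \<bullet> u = 0)" for u
    proof
      assume "\<forall>w. adjoint L w \<bullet> u = 0"
      then have "L u \<bullet> L u = 0"
        using adjoint_works[OF linear_L, of u "L u"] by (simp add: inner_commute)
      then show "L u = 0" by simp
    next
      assume "L u = 0"
      then show "\<forall>w. adjoint L w \<bullet> u = 0"
        using adjoint_works[OF linear_L, of u] by (simp add: inner_commute)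
    qed
    then show ?thesis by (auto simp: orthogonal_def)
  qed
  moreover have "dim {y \<in> UNIV. \<forall>x \<in> range (adjoint L). orthogonal x y} + dim (range (adjoint L)) = dim (UNIV::'e set)"
    by (rule dim_subspace_orthogonal_to_vectors) (auto intro: linear_subspace_image[OF adj])
  ultimately show ?thesis using 1 by (simp add: dim_UNIV)
qed

end

locale linear_riemannian_submersion = linear_submersion +
  assumes iso: "u \<in> horizontal \<Longrightarrow> v \<in> horizontal \<Longrightarrow> H (L u) (L v) = G u v"
begin

text \<open>The vertical part of w contributes to neither side.\<close>

lemma adj: "v \<in> horizontal \<Longrightarrow> H (L w) (L v) = G w v"
proof -
  assume v: "v \<in> horizontal"
  obtain w' where w': "L (lift w') = L w" using lift_onto by blast
  have "L (w - lift w') = 0" using w' linear_diff[OF linear_L] by simp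
  then have "G v (w - lift w') = 0" using v unfolding horizontal_def by blast
  then have "G w v = G (lift w') v" using G.sym[of v] by simp
  also have "\<dots> = H (L (lift w')) (L v)" using iso[OF lift_horizontal v] by simp
  finally show ?thesis by (simp add: w')
qed

text \<open>Every test vector is the image of some lift, and on lifts \<open>adj\<close> and the
  adjoint property of \<open>lift\<close> give the same value.\<close>

lemma L_lift: "L (lift w) = w"
proof (rule H.nondegenerate)
  fix y
  obtain w' where w': "L (lift w') = y" using lift_onto by blast
  have "H (L (lift w)) (L (lift w')) = G (lift w) (lift w')"
    by (rule adj[OF lift_horizontal])
  also have "\<dots> = H y w" by (simp add: G_lift w')
  finally show "H (L (lift w)) y = H w y" by (simp add: w' H.sym[of y])
qed

lemma lift_L: "u \<in> horizontal \<Longrightarrow> lift (L u) = u"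
  by (rule G.nondegenerate) (metis G.sym G_lift adj)

lemma lift_expand:
  assumes "G.orthonormal DIM('a) e"
  shows "lift w = (\<Sum>i<DIM('a). H w (L (e i)) *\<^sub>R e i)"
proof -
  have "lift w = (\<Sum>i<DIM('a). G (lift w) (e i) *\<^sub>R e i)"
    by (rule G.orthonormal_expand[OF assms])
  then show ?thesis by (simp add: G_lift H.sym[of w])
qed

lemma trace_push_L:
  fixes B :: "'b \<Rightarrow> 'b \<Rightarrow> 'v::real_vector"
  assumes "G.orthonormal DIM('a) e" "H.orthonormal DIM('b) \<epsilon>" "bilinear B"
  shows "(\<Sum>i<DIM('a). B (L (e i)) (L (e i))) = (\<Sum>j<DIM('b). B (\<epsilon> j) (\<epsilon> j))"
proof (rule trace_push[OF G.inner_form_axioms H.inner_form_axioms assms])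
  fix w
  show "\<exists>w'. L w' = w \<and> (\<forall>u. H (L u) w = G u w')"
    using L_lift G_lift G.sym by metis
qed

lemma adapted_trace:
  fixes B :: "'a \<Rightarrow> 'a \<Rightarrow> 'v::real_vector"
  assumes "G.orthonormal DIM('a) e" and v: "G.orthonormal (DIM('a) - DIM('b)) v"
    and Lv: "\<And>s. s < DIM('a) - DIM('b) \<Longrightarrow> L (v s) = 0"
    and \<epsilon>: "H.orthonormal DIM('b) \<epsilon>" and B: "bilinear B"
    and B0: "\<And>u. u \<in> horizontal \<Longrightarrow> B u u = 0"
  shows "(\<Sum>i<DIM('a). B (e i) (e i)) = (\<Sum>s<DIM('a) - DIM('b). B (v s) (v s))"
proof -
  let ?k = "DIM('a) - DIM('b)"
  have "DIM('b) \<le> DIM('a)"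
    using dim_image_le[OF linear_L, of UNIV] surj_L by (simp add: dim_UNIV)
  then have k: "DIM('a) = ?k + DIM('b)" by simp
  \<comment> \<open>The vertical vectors take the first m - n indices; the shifted index then runs
    through the lifts of \<epsilon>.\<close>
  define e' where "e' = (\<lambda>i. if i < ?k then v i else lift (\<epsilon> (i - ?k)))"
  have "G (lift (\<epsilon> i)) (lift (\<epsilon> j)) = H (\<epsilon> i) (\<epsilon> j)" for i j
    by (simp add: G_lift L_lift H.sym[of "\<epsilon> i"])
  moreover have "G (lift w) (v s) = 0" "G (v s) (lift w) = 0" if "s < ?k" for s w
    using Lv[OF that] by (simp_all add: G_lift G.sym[of "v s"])
  ultimately have "G.orthonormal DIM('a) e'"
    using v \<epsilon> k by (auto simp: G.orthonormal_def H.orthonormal_def e'_def)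
  then have "(\<Sum>i<DIM('a). B (e i) (e i)) = (\<Sum>i<DIM('a). B (e' i) (e' i))"
    by (rule trace_frame_independent[OF G.inner_form_axioms assms(1) _ B])
  also have "\<dots> = (\<Sum>i<?k. B (e' i) (e' i)) + (\<Sum>i\<in>{?k..<DIM('a)}. B (e' i) (e' i))"
    by (subst sum.union_disjoint[symmetric]) (auto intro!: sum.cong)
  also have "\<dots> = (\<Sum>s<?k. B (v s) (v s))"
    by (simp add: e'_def B0 lift_horizontal)
  finally show ?thesis .
qed

end

section \<open>Riemannian submersions between open sets\<close>

locale metric_submersion = metric_map +
  assumes surj_fd: "x \<in> S \<Longrightarrow> surj (fd F x)"
    and iso_fd: "x \<in> S \<Longrightarrow> u \<in> linear_submersion.horizontal (G x) (fd F x) \<Longrightarrow>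
      v \<in> linear_submersion.horizontal (G x) (fd F x) \<Longrightarrow>
      H (F x) (fd F x u) (fd F x v) = G x u v"
begin

lemma linear_riemannian_submersion:
  assumes "x \<in> S"
  shows "linear_riemannian_submersion (G x) (H (F x)) (fd F x)"
proof -
  interpret linear_submersion "G x" "H (F x)" "fd F x"
    using assms by (intro linear_submersion.intro linear_submersion_axioms.intro M.ip N.ip F_S
        linear_fd F_differentiable surj_fd)
  show ?thesis by unfold_locales (rule iso_fd[OF assms])
qed

abbreviation "hor x \<equiv> linear_submersion.horizontal (G x) (fd F x)"
abbreviation "hlift x \<equiv> linear_submersion.lift (G x) (H (F x)) (fd F x)"

text \<open>Smoothness is read off the expansion of \<open>L\<^sup>* L u\<close> in a local orthonormal frame.\<close>
lemma smooth_horizontal_part: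
  assumes "x \<in> S"
  shows "\<exists>T. open T \<and> x \<in> T \<and> T \<subseteq> S \<and> (\<forall>u. smooth_on T (\<lambda>y. hlift y (fd F y u)))"
proof -
  obtain T e where T: "open T" "x \<in> T" "T \<subseteq> S" and e: "\<And>i. i < DIM('a) \<Longrightarrow> smooth_on T (e i)"
    and on: "\<And>y. y \<in> T \<Longrightarrow> inner_form.orthonormal (G y) DIM('a) (\<lambda>i. e i y)"
    using M.local_frame[OF assms] by metis
  have F: "smooth_on T F" using smooth_F T smooth_on_subset by blast
  have HF: "smooth_on T (\<lambda>y. H (F y) a b)" for a b
    using T F_S by (intro smooth_on_compose[OF T(1) N.smooth_coeff F]) auto
  have ipH: "inner_form (H (F y))" if "y \<in> T" for y using that T F_S N.ip by blast
  have HFF: "smooth_on T (\<lambda>y. H (F y) (X y) (Y y))" if "smooth_on T X" "smooth_on T Y" for X Y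
    by (rule smooth_on_bilinear_family[OF T(1) inner_form.bilinear[OF ipH] HF that])
  have "smooth_on T (\<lambda>y. \<Sum>i<DIM('a). H (F y) (fd F y u) (fd F y (e i y)) *\<^sub>R e i y)" for u
    using T F e by (intro smooth_on_sum smooth_on_scaleR HFF smooth_on_fd smooth_on_fd_field) auto
  moreover have "hlift y (fd F y u) = (\<Sum>i<DIM('a). H (F y) (fd F y u) (fd F y (e i y)) *\<^sub>R e i y)"
    if "y \<in> T" for y u
    using linear_riemannian_submersion.lift_expand[OF linear_riemannian_submersion on[OF that]] that T
    by blast
  ultimately have "smooth_on T (\<lambda>y. hlift y (fd F y u))" for u
    using smooth_on_cong[OF T(1)] by (metis (no_types, lifting))
  then show ?thesis using T by blast
qed

lemma hess_horizontal_zero: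
  assumes x: "x \<in> S" and uv: "u \<in> hor x" "v \<in> hor x"
  shows "hess x u v = 0"
proof -
  interpret L: linear_riemannian_submersion "G x" "H (F x)" "fd F x"
    by (rule linear_riemannian_submersion[OF x])
  obtain T where T: "open T" "x \<in> T" "T \<subseteq> S" "\<And>u. smooth_on T (\<lambda>y. hlift y (fd F y u))"
    using smooth_horizontal_part[OF x] by blast
  have lin_sub: "linear_submersion (G y) (H (F y)) (fd F y)" if "y \<in> S" for y
    using linear_riemannian_submersion[OF that] by (simp add: linear_riemannian_submersion_def)
  show ?thesis
  proof (rule hess_horizontal[where K = hor, OF x _ _ _ _ uv])
    fix u assume u: "u \<in> hor x"
    \<comment> \<open>The extension of u is the horizontal part of the constant field u: horizontal
      at every point of the domain, and equal to u at x because u is horizontal.\<close>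
    have "eventually (\<lambda>y. hlift y (fd F y u) \<in> hor y) (nhds x)"
      by (rule eventually_mono[OF M.eventually_S[OF x] linear_submersion.lift_horizontal[OF lin_sub]])
    then show "\<exists>X. X differentiable (at x) \<and> X x = u \<and> eventually (\<lambda>y. X y \<in> hor y) (nhds x)"
      using T L.lift_L[OF u] smooth_on_differentiable
      by (intro exI[of _ "\<lambda>y. hlift y (fd F y u)"]) blast
  next
    fix w show "\<exists>v\<in>hor x. fd F x v = w" using L.L_lift L.lift_horizontal by blast
  qed (use L.adj iso_fd in auto)
qed

text \<open>A basis of the kernel at x is extended by constant fields, whose horizontal parts are
  then removed; at x this changes nothing. Gram-Schmidt stays in the span of these vertical
  fields.\<close>

lemma smooth_vertical_frame:
  assumes x: "x \<in> S"
  shows "\<exists>T e. open T \<and> x \<in> T \<and> T \<subseteq> S \<and> (\<forall>i<DIM('a) - DIM('b). smooth_on T (e i)) \<and>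
    (\<forall>y\<in>T. inner_form.orthonormal (G y) (DIM('a) - DIM('b)) (\<lambda>i. e i y)) \<and>
    (\<forall>y\<in>T. \<forall>i<DIM('a) - DIM('b). fd F y (e i y) = 0)"
proof -
  let ?k = "DIM('a) - DIM('b)"
  interpret L: linear_riemannian_submersion "G x" "H (F x)" "fd F x"
    by (rule linear_riemannian_submersion[OF x])
  obtain T where T: "open T" "x \<in> T" "T \<subseteq> S" "\<And>u. smooth_on T (\<lambda>y. hlift y (fd F y u))"
    using smooth_horizontal_part[OF x] by blast
  interpret T: smooth_metric T G
    by (rule M.smooth_metric_subset[OF T(1,3)])
  obtain b where b: "b \<subseteq> {u. fd F x u = 0}" "independent b" "card b = ?k"
    using basis_exists[of "{u. fd F x u = 0}"] L.dim_vertical by metis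
  have "finite b" using b(2) independent_imp_finite by blast
  then obtain f where f: "bij_betw f {..<?k} b"
    using ex_bij_betw_nat_finite b(3) by (metis atLeast0LessThan)
  define f' where "f' = (\<lambda>i y. f i - hlift y (fd F y (f i)))"
  have f'x: "f' i x = f i" if "i < ?k" for i
  proof -
    have "fd F x (f i) = 0" using f b(1) that by (auto simp: bij_betw_def)
    then show ?thesis using linear_0[OF L.linear_lift] by (simp add: f'_def)
  qed
  have vert: "fd F y (f' i y) = 0" if "y \<in> T" for i y
  proof -
    interpret Ly: linear_riemannian_submersion "G y" "H (F y)" "fd F y"
      using linear_riemannian_submersion that T by blast
    show ?thesis by (simp add: f'_def linear_diff[OF Ly.linear_L] Ly.L_lift)
  qed
  have "\<exists>T' e. open T' \<and> x \<in> T' \<and> T' \<subseteq> T \<and> (\<forall>i<?k. smooth_on T' (e i)) \<and>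
    (\<forall>y\<in>T'. inner_form.orthonormal (G y) ?k (\<lambda>i. e i y)) \<and>
    (\<forall>y\<in>T'. \<forall>i<?k. e i y \<in> span ((\<lambda>i. f' i y) ` {..<?k}))"
  proof (rule T.gram_schmidt[OF T(2)])
    show "smooth_on T (f' i)" for i
      unfolding f'_def by (intro smooth_on_diff smooth_on_const T)
    show "inj_on (\<lambda>i. f' i x) {..<?k}" using f f'x by (auto simp: bij_betw_def inj_on_def)
    have "(\<lambda>i. f' i x) ` {..<?k} = b" using f f'x by (auto simp: bij_betw_def)
    then show "independent ((\<lambda>i. f' i x) ` {..<?k})" using b(2) by simp
  qed
  then obtain T' e where T': "open T'" "x \<in> T'" "T' \<subseteq> T" "\<And>i. i < ?k \<Longrightarrow> smooth_on T' (e i)"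
    "\<And>y. y \<in> T' \<Longrightarrow> inner_form.orthonormal (G y) ?k (\<lambda>i. e i y)"
    "\<And>y i. y \<in> T' \<Longrightarrow> i < ?k \<Longrightarrow> e i y \<in> span ((\<lambda>i. f' i y) ` {..<?k})"
    by metis
  have "fd F y (e i y) = 0" if y: "y \<in> T'" and i: "i < ?k" for y i
  proof -
    have "linear (fd F y)" using y T T' by (intro linear_fd F_differentiable) auto
    then show ?thesis
      by (rule linear_eq_0_on_span[OF _ _ T'(6)[OF y i]]) (use vert y T' in auto)
  qed
  then show ?thesis
    using T T' by (intro exI[of _ T'] exI[of _ e]) auto
qed

end

section \<open>Charts\<close>

lemma chart_cinv: "chart c \<Longrightarrow> p \<in> cdom c \<Longrightarrow> cinv c (cmap c p) = p"
  by (auto simp: chart_def homeomorphism_def)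

lemma open_chart_image:
  assumes "chart c" "open U"
  shows "open (cmap c ` (U \<inter> cdom c))"
proof -
  have h: "homeomorphism (cdom c) (cmap c ` cdom c) (cmap c) (cinv c)"
    and o: "open (cmap c ` cdom c)"
    using assms(1) by (auto simp: chart_def)
  have "openin (top_of_set (cdom c)) (U \<inter> cdom c)"
    using openin_open_Int[OF assms(2), of "cdom c"] by (simp only: Int_commute)
  from homeomorphism_imp_open_map[OF h this] show ?thesis
    using o openin_open_trans by blast
qed

lemma eventually_chart:
  assumes "chart c" "p \<in> cdom c" "eventually P (nhds p)"
  shows "eventually (\<lambda>x. cinv c x \<in> cdom c \<and> cmap c (cinv c x) = x \<and> P (cinv c x)) (nhds (cmap c p))"
proof -
  obtain U where U: "open U" "p \<in> U" "\<And>q. q \<in> U \<Longrightarrow> P q"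
    using assms(3) unfolding eventually_nhds by blast
  have "eventually (\<lambda>x. x \<in> cmap c ` (U \<inter> cdom c)) (nhds (cmap c p))"
    using open_chart_image[OF assms(1) U(1)] U(2) assms(2)
    by (intro eventually_nhds_in_open) auto
  then show ?thesis
    by (rule eventually_mono) (use U(3) chart_cinv[OF assms(1)] in auto)
qed

lemma smooth_atlas_chart: "smooth_atlas A \<Longrightarrow> c \<in> A \<Longrightarrow> chart c"
  by (simp add: smooth_atlas_def)

lemma open_cdom: "smooth_atlas A \<Longrightarrow> c \<in> A \<Longrightarrow> open (cdom c)"
  by (simp add: smooth_atlas_def chart_def)

lemma eventually_cdom: "smooth_atlas A \<Longrightarrow> c \<in> A \<Longrightarrow> p \<in> cdom c \<Longrightarrow> eventually (\<lambda>q. q \<in> cdom c) (nhds p)"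
  by (intro eventually_nhds_in_open open_cdom)

lemma open_carrier: "smooth_atlas A \<Longrightarrow> open (carrier A)"
  unfolding carrier_def using open_cdom by blast

lemma chart_at: "p \<in> carrier A \<Longrightarrow> chart_at A p \<in> A \<and> p \<in> cdom (chart_at A p)"
  unfolding chart_at_def carrier_def by (rule someI_ex) auto

lemma tangent_map_ident: "tangent_map (\<lambda>x. x) c d p = fd (cmap d \<circ> cinv c) (cmap c p)"
  by (simp add: tangent_map_def o_def)

lemma tangent_map_same:
  assumes "chart c" "p \<in> cdom c"
  shows "tangent_map (\<lambda>x. x) c c p = (\<lambda>u. u)"
proof -
  have "eventually (\<lambda>x. (cmap c \<circ> cinv c) x = x) (nhds (cmap c p))"
    using eventually_chart[OF assms, of "\<lambda>_. True"] by (auto elim: eventually_mono)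
  then show ?thesis unfolding tangent_map_ident by (subst fd_cong) auto
qed

lemma smooth_on_transition:
  "smooth_atlas A \<Longrightarrow> c \<in> A \<Longrightarrow> d \<in> A \<Longrightarrow> smooth_on (cmap c ` (cdom c \<inter> cdom d)) (cmap d \<circ> cinv c)"
  by (simp add: smooth_atlas_def)

lemma change_chart:
  assumes A: "smooth_atlas A" "c \<in> A" "d \<in> A" and p: "p \<in> cdom c" "p \<in> cdom d"
    and f: "(f \<circ> cinv d) differentiable (at (cmap d p))"
  shows "((f \<circ> cinv c) has_derivative
    (\<lambda>u. fd (f \<circ> cinv d) (cmap d p) (tangent_map (\<lambda>x. x) c d p u))) (at (cmap c p))"
proof -
  have cp: "cinv c (cmap c p) = p" using smooth_atlas_chart[OF A(1,2)] p chart_cinv by blast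
  have "((cmap d \<circ> cinv c) has_derivative tangent_map (\<lambda>x. x) c d p) (at (cmap c p))"
    unfolding tangent_map_ident
    by (rule smooth_on_has_derivative[OF smooth_on_transition[OF A]]) (use p in auto)
  moreover have "((f \<circ> cinv d) has_derivative fd (f \<circ> cinv d) (cmap d p)) (at ((cmap d \<circ> cinv c) (cmap c p)))"
    using fd_works[OF f] by (simp add: cp)
  ultimately have "((f \<circ> cinv d) \<circ> (cmap d \<circ> cinv c) has_derivative
      fd (f \<circ> cinv d) (cmap d p) \<circ> tangent_map (\<lambda>x. x) c d p) (at (cmap c p))"
    by (rule diff_chain_at)
  moreover have "eventually (\<lambda>x. (f \<circ> cinv c) x = ((f \<circ> cinv d) \<circ> (cmap d \<circ> cinv c)) x) (nhds (cmap c p))"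
    using eventually_chart[OF smooth_atlas_chart[OF A(1,2)] p(1) eventually_cdom[OF A(1,3) p(2)]]
    by (rule eventually_mono) (use chart_cinv[OF smooth_atlas_chart[OF A(1,3)]] in auto)
  ultimately show ?thesis
    by (simp add: has_derivative_cong_nhds o_def)
qed

text \<open>A \<open>vfield\<close> is any family of components; this says that those at p represent
  one tangent vector.\<close>

definition tangent_at :: "('a, 'e::euclidean_space) chart set \<Rightarrow> ('a, 'e) vfield \<Rightarrow> 'a \<Rightarrow> bool" where
  "tangent_at A X p \<longleftrightarrow> (\<forall>c\<in>A. \<forall>d\<in>A. p \<in> cdom c \<longrightarrow> p \<in> cdom d \<longrightarrow>
     X d p = tangent_map (\<lambda>x. x) c d p (X c p))"

lemma smooth_vfield_tangent_at: "smooth_vfield_on A U X \<Longrightarrow> p \<in> U \<Longrightarrow> tangent_at A X p"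
  unfolding smooth_vfield_on_def tangent_at_def by blast

lemma smooth_vfield_differentiable:
  "smooth_vfield_on A U X \<Longrightarrow> c \<in> A \<Longrightarrow> p \<in> U \<Longrightarrow> p \<in> cdom c \<Longrightarrow> (X c \<circ> cinv c) differentiable (at (cmap c p))"
  by (rule smooth_on_differentiable[of "cmap c ` (U \<inter> cdom c)"]) (auto simp: smooth_vfield_on_def)

text \<open>Tangency and the chain rule trade the default chart inside \<open>deriv_along\<close>
  for c.\<close>

lemma deriv_along_chart:
  assumes A: "smooth_atlas A" "c \<in> A" and p: "p \<in> cdom c" and X: "tangent_at A X p"
    and f: "(f \<circ> cinv c) differentiable (at (cmap c p))"
  shows "deriv_along A X f p = fd (f \<circ> cinv c) (cmap c p) (X c p)"
proof -
  have c0: "chart_at A p \<in> A" "p \<in> cdom (chart_at A p)"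
    using chart_at[of p A] A(2) p unfolding carrier_def by blast+
  have "X c p = tangent_map (\<lambda>x. x) (chart_at A p) c p (X (chart_at A p) p)"
    using X c0 A(2) p unfolding tangent_at_def by blast
  then show ?thesis
    by (simp add: deriv_along_def Let_def fd_eq[OF change_chart[OF A(1) c0(1) A(2) c0(2) p f]])
qed

lemma smooth_metric_chart:
  assumes "riemannian_manifold A g" "c \<in> A"
  shows "smooth_metric (cmap c ` cdom c) (\<lambda>x. g c (cinv c x))"
proof (rule smooth_metric.intro)
  have c: "chart c" and m: "riemannian_metric A g"
    using assms by (auto simp: riemannian_manifold_def intro: smooth_atlas_chart)
  show "open (cmap c ` cdom c)" using c by (simp add: chart_def)
  show "smooth_on (cmap c ` cdom c) (\<lambda>x. g c (cinv c x) u v)" for u v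
    using m assms(2) by (simp add: riemannian_metric_def)
  fix x assume "x \<in> cmap c ` cdom c"
  then have "cinv c x \<in> cdom c" using chart_cinv[OF c] by auto
  then show "inner_form (g c (cinv c x))"
    using m assms(2) unfolding riemannian_metric_def inner_form_def by blast
qed

lemma christoffel_eq_lc:
  "chart c \<Longrightarrow> p \<in> cdom c \<Longrightarrow> christoffel g c p = lc (\<lambda>x. g c (cinv c x)) (cmap c p)"
  by (simp add: christoffel_def lc_def is_lc_def chart_cinv)

section \<open>Riemannian submersions between manifolds\<close>

locale riem_submersion =
  fixes A :: "('a::{t2_space,second_countable_topology}, 'e::euclidean_space) chart set"
    and g :: "('a, 'e) metric"
    and B :: "('b::{t2_space,second_countable_topology}, 'f::euclidean_space) chart set"
    and h :: "('b, 'f) metric"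
    and \<phi> :: "'a \<Rightarrow> 'b"
  assumes mfd_A: "riemannian_manifold A g"
    and mfd_B: "riemannian_manifold B h"
    and submersion: "riemannian_submersion A g B h \<phi>"
begin

lemma atlas_A: "smooth_atlas A" and atlas_B: "smooth_atlas B"
  using mfd_A mfd_B by (auto simp: riemannian_manifold_def)

lemmas chart_A = smooth_atlas_chart[OF atlas_A]
lemmas chart_B = smooth_atlas_chart[OF atlas_B]

lemma smooth_phi: "smooth_map A B \<phi>"
  using submersion by (simp add: riemannian_submersion_def)

lemma eventually_phi:
  assumes "p \<in> carrier A" "eventually P (nhds (\<phi> p))"
  shows "eventually (\<lambda>q. P (\<phi> q)) (nhds p)"
proof -
  have "continuous_on (carrier A) \<phi>" using smooth_phi by (simp add: smooth_map_def)
  then have "isCont \<phi> p"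
    using assms(1) open_carrier[OF atlas_A] continuous_on_eq_continuous_at by blast
  then have "filterlim \<phi> (nhds (\<phi> p)) (nhds p)"
    unfolding isCont_def tendsto_at_iff_tendsto_nhds .
  then show ?thesis using assms(2) by (simp add: filterlim_iff)
qed

abbreviation rep :: "('a, 'e) chart \<Rightarrow> ('b, 'f) chart \<Rightarrow> 'e \<Rightarrow> 'f" where
  "rep c d \<equiv> cmap d \<circ> \<phi> \<circ> cinv c"
abbreviation dom_rep :: "('a, 'e) chart \<Rightarrow> ('b, 'f) chart \<Rightarrow> 'e set" where
  "dom_rep c d \<equiv> cmap c ` (cdom c \<inter> \<phi> -` cdom d)"
abbreviation range_rep :: "('b, 'f) chart \<Rightarrow> 'f set" where
  "range_rep d \<equiv> cmap d ` cdom d"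
abbreviation G :: "('a, 'e) chart \<Rightarrow> 'e \<Rightarrow> 'e \<Rightarrow> 'e \<Rightarrow> real" where
  "G c \<equiv> \<lambda>x. g c (cinv c x)"
abbreviation H :: "('b, 'f) chart \<Rightarrow> 'f \<Rightarrow> 'f \<Rightarrow> 'f \<Rightarrow> real" where
  "H d \<equiv> \<lambda>x. h d (cinv d x)"

lemma cdom_carrier: "c \<in> A \<Longrightarrow> p \<in> cdom c \<Longrightarrow> p \<in> carrier A"
  by (auto simp: carrier_def)

lemma smooth_rep: "c \<in> A \<Longrightarrow> d \<in> B \<Longrightarrow> smooth_on (dom_rep c d) (rep c d)"
  using smooth_phi by (simp add: smooth_map_def)

lemma rep_differentiable:
  "c \<in> A \<Longrightarrow> d \<in> B \<Longrightarrow> p \<in> cdom c \<Longrightarrow> \<phi> p \<in> cdom d \<Longrightarrow> rep c d differentiable (at (cmap c p))"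
  by (rule smooth_on_differentiable[OF smooth_rep]) auto

lemma tangent_map_phi: "tangent_map \<phi> c d p = fd (rep c d) (cmap c p)"
  by (simp add: tangent_map_def)

lemma open_dom_rep:
  assumes "c \<in> A" "d \<in> B"
  shows "open (dom_rep c d)"
proof -
  have "cdom c \<subseteq> carrier A" using cdom_carrier[OF assms(1)] by blast
  then have "continuous_on (cdom c) \<phi>"
    using smooth_phi continuous_on_subset unfolding smooth_map_def by blast
  then have "open (\<phi> -` cdom d \<inter> cdom c)"
    using continuous_on_open_vimage[OF open_cdom[OF atlas_A assms(1)], of \<phi>]
      open_cdom[OF atlas_B assms(2)] by blast
  from open_chart_image[OF chart_A[OF assms(1)] this] show ?thesis
    by (simp add: Int_commute Int_left_commute)
qed

text \<open>Makes a field on \<phi>(M) one that can be differentiated. The surjective derivative in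
  charts has a linear right inverse, so the open mapping theorem puts the image point into the
  interior of the image; the chart d carries this neighbourhood back to the target.\<close>

lemma open_image_phi: "open (\<phi> ` carrier A)"
proof (subst open_subopen, intro ballI)
  fix q assume "q \<in> \<phi> ` carrier A"
  then obtain p where p: "p \<in> carrier A" "q = \<phi> p" by blast
  then obtain c where c: "c \<in> A" "p \<in> cdom c" by (auto simp: carrier_def)
  have "\<phi> p \<in> carrier B" using smooth_phi p unfolding smooth_map_def by blast
  then obtain d where d: "d \<in> B" "\<phi> p \<in> cdom d" by (auto simp: carrier_def)
  let ?F = "rep c d" and ?S = "dom_rep c d"
  have cp: "cinv c (cmap c p) = p" using chart_cinv[OF chart_A] c by blast
  have L: "linear (fd ?F (cmap c p))"
    using rep_differentiable c d by (intro linear_fd)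
  have "surj (fd ?F (cmap c p))"
    using submersion c d unfolding riemannian_submersion_def tangent_map_phi by blast
  then obtain k where k: "linear k" "fd ?F (cmap c p) \<circ> k = id"
    using linear_surjective_right_inverse[OF L] by blast
  have o: "open ?S" by (rule open_dom_rep[OF c(1) d(1)])
  have pS: "cmap c p \<in> ?S" using c d by blast
  have "?F (cmap c p) \<in> interior (?F ` ?S)"
  proof (rule sussmann_open_mapping[OF o smooth_on_continuous[OF smooth_rep] pS])
    show "(?F has_derivative fd ?F (cmap c p)) (at (cmap c p))"
      by (rule fd_works[OF rep_differentiable]) (use c d in auto)
    show "bounded_linear k" using k by (simp add: linear_conv_bounded_linear)
    show "cmap c p \<in> interior ?S" using interior_open[OF o] pS by simp
  qed (use c d k in auto)
  then have q: "cmap d q \<in> interior (?F ` ?S)" by (simp add: cp p)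
  let ?V = "cmap d -` interior (?F ` ?S) \<inter> cdom d"
  have "continuous_on (cdom d) (cmap d)"
    using chart_B[OF d(1)] by (auto simp: chart_def homeomorphism_def)
  then have "open ?V"
    using continuous_on_open_vimage[OF open_cdom[OF atlas_B d(1)]] open_interior by blast
  moreover have "?V \<subseteq> \<phi> ` carrier A"
  proof
    fix y assume y: "y \<in> ?V"
    then have "cmap d y \<in> ?F ` ?S" using interior_subset by blast
    then obtain p' where p': "p' \<in> cdom c" "\<phi> p' \<in> cdom d" "cmap d y = ?F (cmap c p')" by auto
    then have "cmap d y = cmap d (\<phi> p')" using chart_cinv[OF chart_A[OF c(1)]] by simp
    then have "y = \<phi> p'"
      using chart_cinv[OF chart_B[OF d(1)]] y p'(2) by (metis IntD2)
    then show "y \<in> \<phi> ` carrier A" using p' cdom_carrier[OF c(1)] by blast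
  qed
  ultimately show "\<exists>T. open T \<and> q \<in> T \<and> T \<subseteq> \<phi> ` carrier A"
    using q d p by (intro exI[of _ ?V]) auto
qed

text \<open>The definition tests all target charts. One suffices, since another chart only composes
  the differential with the derivative of a coordinate change, a linear map.\<close>

lemma vertical_space_chart:
  assumes "c \<in> A" "d \<in> B" "p \<in> cdom c" "\<phi> p \<in> cdom d"
  shows "vertical_space B \<phi> c p = {u. fd (rep c d) (cmap c p) u = 0}"
proof -
  have "fd (rep c d') (cmap c p) u = 0"
    if u: "fd (rep c d) (cmap c p) u = 0" and d': "d' \<in> B" "\<phi> p \<in> cdom d'" for u d'
  proof -
    have cp: "cinv c (cmap c p) = p" using chart_cinv[OF chart_A] assms by blast
    have "((cmap d' \<circ> cinv d) has_derivative fd (cmap d' \<circ> cinv d) (cmap d (\<phi> p)))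
        (at (rep c d (cmap c p)))"
      using smooth_on_has_derivative[OF smooth_on_transition[OF atlas_B assms(2) d'(1)]] assms(4) d'(2)
      by (auto simp: cp)
    from diff_chain_at[OF fd_works[OF rep_differentiable[OF assms]] this]
    have "((cmap d' \<circ> cinv d) \<circ> rep c d has_derivative
        fd (cmap d' \<circ> cinv d) (cmap d (\<phi> p)) \<circ> fd (rep c d) (cmap c p)) (at (cmap c p))" .
    note 1 = fd_eq[OF this]
    have 2: "eventually (\<lambda>x. ((cmap d' \<circ> cinv d) \<circ> rep c d) x = rep c d' x) (nhds (cmap c p))"
    proof -
      have "eventually (\<lambda>q. \<phi> q \<in> cdom d) (nhds p)"
        by (rule eventually_phi[OF cdom_carrier[OF assms(1,3)] eventually_cdom[OF atlas_B assms(2,4)]])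
      from eventually_chart[OF chart_A[OF assms(1)] assms(3) this] show ?thesis
        by (rule eventually_mono) (simp add: chart_cinv[OF chart_B[OF assms(2)]])
    qed
    have "fd (rep c d') (cmap c p) =
        fd (cmap d' \<circ> cinv d) (cmap d (\<phi> p)) \<circ> fd (rep c d) (cmap c p)"
      using 1 unfolding fd_cong[OF 2] .
    moreover have "linear (fd (cmap d' \<circ> cinv d) (cmap d (\<phi> p)))"
      using smooth_on_differentiable[OF smooth_on_transition[OF atlas_B assms(2) d'(1)]] assms(4) d'(2)
      by (intro linear_fd) auto
    ultimately show ?thesis using u linear_0 by auto
  qed
  then show ?thesis using assms(2,4) by (auto simp: vertical_space_def tangent_map_phi)
qed

text \<open>The bridge to the Euclidean theory. Horizontality in the two senses agrees because the
  vertical space is the kernel of the differential in a single target chart.\<close>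

lemma metric_submersion_chart:
  assumes c: "c \<in> A" and d: "d \<in> B"
  shows "metric_submersion (dom_rep c d) (G c) (range_rep d) (H d) (rep c d)"
proof -
  have cinv: "cinv c (cmap c p) = p" if "p \<in> cdom c" for p
    using chart_cinv[OF chart_A[OF c] that] .
  interpret M: smooth_metric "dom_rep c d" "G c"
    by (rule smooth_metric.smooth_metric_subset[OF smooth_metric_chart[OF mfd_A c] open_dom_rep[OF c d]])
      auto
  interpret N: smooth_metric "range_rep d" "H d"
    by (rule smooth_metric_chart[OF mfd_B d])
  interpret metric_map "dom_rep c d" "G c" "range_rep d" "H d" "rep c d"
  proof (unfold_locales)
    show "smooth_on (dom_rep c d) (rep c d)" by (rule smooth_rep[OF c d])
    show "rep c d x \<in> range_rep d" if "x \<in> dom_rep c d" for x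
      using that cinv by auto
  qed
  have surj: "surj (fd (rep c d) x)" if "x \<in> dom_rep c d" for x
    using that submersion c d unfolding riemannian_submersion_def tangent_map_phi by blast
  show ?thesis
  proof (unfold_locales)
    fix x u v assume x: "x \<in> dom_rep c d"
    interpret L: linear_submersion "G c x" "H d (rep c d x)" "fd (rep c d) x"
      using x by (intro linear_submersion.intro linear_submersion_axioms.intro M.ip N.ip F_S
          linear_fd F_differentiable surj)
    obtain p where p: "p \<in> cdom c" "\<phi> p \<in> cdom d" "x = cmap c p" using x by blast
    assume "u \<in> L.horizontal" "v \<in> L.horizontal"
    then have "u \<in> horizontal_space g B \<phi> c p" "v \<in> horizontal_space g B \<phi> c p"
      unfolding horizontal_space_def vertical_space_chart[OF c d p(1,2)] L.horizontal_def
      using p cinv by auto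
    then have "h d (\<phi> p) (fd (rep c d) x u) (fd (rep c d) x v) = g c p u v"
      using submersion c d p unfolding riemannian_submersion_def tangent_map_phi by blast
    then show "H d (rep c d x) (fd (rep c d) x u) (fd (rep c d) x v) = G c x u v"
      using p cinv chart_cinv[OF chart_B[OF d]] by simp
  qed (rule surj)
qed

abbreviation "sff c d \<equiv> metric_map.hess (G c) (H d) (rep c d)"
abbreviation "cov d \<equiv> smooth_metric.cov (H d)"
abbreviation "cov2 d \<equiv> smooth_metric.cov2 (H d)"
abbreviation "curv d \<equiv> smooth_metric.curv (H d)"

text \<open>
  The derivative along \<open>X\<close> at \<open>p\<close> may be computed in the chart \<open>c\<close>. The second alternative serves
  the fields \<open>\<nabla>\<^sub>X Y\<close>, whose transformation law under coordinate changes is then not needed on the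
  domain.
\<close>
definition components_at :: "('a, 'e) vfield \<Rightarrow> ('a, 'e) chart \<Rightarrow> 'a \<Rightarrow> bool" where
  "components_at X c p \<longleftrightarrow> tangent_at A X p \<or> c = chart_at A p"

lemma deriv_along_components:
  assumes "c \<in> A" "p \<in> cdom c" "components_at X c p" "(f \<circ> cinv c) differentiable (at (cmap c p))"
  shows "deriv_along A X f p = fd (f \<circ> cinv c) (cmap c p) (X c p)"
  using assms(3) unfolding components_at_def
proof
  show ?thesis if "tangent_at A X p" using deriv_along_chart[OF atlas_A assms(1,2) that assms(4)] .
qed (simp add: deriv_along_def Let_def)

section \<open>The second fundamental form of the submersion\<close>

lemma push_chart:
  assumes "c \<in> A" "d \<in> B" "p \<in> cdom c" "\<phi> p \<in> cdom d" "components_at X c p"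
  shows "push A \<phi> X d p = fd (rep c d) (cmap c p) (X c p)"
  unfolding push_def by (rule deriv_along_components[OF assms(1,3,5) rep_differentiable[OF assms(1-4)]])

lemma rep_at: "c \<in> A \<Longrightarrow> p \<in> cdom c \<Longrightarrow> rep c d (cmap c p) = cmap d (\<phi> p)"
  using chart_cinv[OF chart_A] by simp

lemma eventually_rep:
  assumes "c \<in> A" "d \<in> B" "p \<in> cdom c" "\<phi> p \<in> cdom d" "open U" "p \<in> U"
  shows "eventually (\<lambda>x. cinv c x \<in> cdom c \<and> cmap c (cinv c x) = x \<and> \<phi> (cinv c x) \<in> cdom d \<and> cinv c x \<in> U)
    (nhds (cmap c p))"
proof -
  have "eventually (\<lambda>q. \<phi> q \<in> cdom d) (nhds p)"
    by (rule eventually_phi[OF cdom_carrier[OF assms(1,3)] eventually_cdom[OF atlas_B assms(2,4)]])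
  then have "eventually (\<lambda>q. \<phi> q \<in> cdom d \<and> q \<in> U) (nhds p)"
    using assms(5,6) by (intro eventually_conj eventually_nhds_in_open)
  from eventually_chart[OF chart_A[OF assms(1)] assms(3) this] show ?thesis .
qed

text \<open>Identifies the form traced in \<open>tension\<close>. Only the value of \<open>X\<close>
  at p matters, read in the default chart; \<open>Y\<close> is differentiated and must be a smooth
  field near p.\<close>

lemma second_fundamental_form:
  assumes p: "p \<in> carrier A" and d: "d \<in> B" "\<phi> p \<in> cdom d"
    and U: "open U" "p \<in> U" and Y: "smooth_vfield_on A U Y"
  defines "c \<equiv> chart_at A p"
  shows "nabla_along A h \<phi> X (push A \<phi> Y) d p - push A \<phi> (nabla A g X Y) d p
    = sff c d (cmap c p) (X c p) (Y c p)"
proof -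
  have c: "c \<in> A" "p \<in> cdom c" using chart_at[OF p] by (auto simp: c_def)
  interpret metric_submersion "dom_rep c d" "G c" "range_rep d" "H d" "rep c d"
    by (rule metric_submersion_chart[OF c(1) d(1)])
  have x: "cmap c p \<in> dom_rep c d" using c d by blast
  let ?F = "rep c d" and ?x = "cmap c p"
  have comp: "components_at Z c p" for Z by (simp add: components_at_def c_def)
  have cp: "cinv c ?x = p" using chart_cinv[OF chart_A] c by blast
  have y: "((Y c \<circ> cinv c) has_derivative fd (Y c \<circ> cinv c) ?x) (at ?x)"
    by (rule fd_works[OF smooth_vfield_differentiable[OF Y c(1) U(2) c(2)]])
  \<comment> \<open>At a nearby point \<open>push\<close> uses the default chart of that point,
    which need not be c; tangency of \<open>Y\<close> there makes c equally valid.\<close>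
  have ev: "eventually (\<lambda>z. (push A \<phi> Y d \<circ> cinv c) z = fd ?F z ((Y c \<circ> cinv c) z)) (nhds ?x)"
    using eventually_rep[OF c(1) d(1) c(2) d(2) U]
  proof eventually_elim
    case (elim z)
    then show ?case
      using push_chart[OF c(1) d(1), of "cinv c z" Y] smooth_vfield_tangent_at[OF Y]
      by (simp add: components_at_def)
  qed
  have "deriv_along A X (push A \<phi> Y d) p = fd (\<lambda>z. fd ?F z ((Y c \<circ> cinv c) z)) ?x (X c p)"
    unfolding deriv_along_def Let_def c_def[symmetric] fd_cong[OF ev] ..
  also have "\<dots> = fd (\<lambda>y. fd ?F y (Y c p)) ?x (X c p) + fd ?F ?x (fd (Y c \<circ> cinv c) ?x (X c p))"
    unfolding fd_eq[OF fd_field_has_derivative[OF x y]] by (simp add: cp)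
  finally have 1: "deriv_along A X (push A \<phi> Y d) p = \<dots>" .
  have 2: "nabla A g X Y c p = fd (Y c \<circ> cinv c) ?x (X c p) + lc (G c) ?x (X c p) (Y c p)"
    by (simp add: nabla_def deriv_along_def c_def[symmetric] christoffel_eq_lc[OF chart_A[OF c(1)] c(2)])
  have "linear (fd ?F ?x)" by (rule linear_fd[OF F_differentiable[OF x]])
  then show ?thesis
    unfolding nabla_along_def 1 push_chart[OF c(1) d(1) c(2) d(2) comp] 2 hess_def
      christoffel_eq_lc[OF chart_B[OF d(1)] d(2)] rep_at[OF c]
    by (simp add: linear_add)
qed

section \<open>Sections along the submersion that come from the target\<close>

text \<open>The target chart is cut down to an open \<open>W\<close> because the component function
  of T is smooth only over \<phi>(M); the source shrinks to the preimage.\<close>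

lemma metric_map_chart:
  assumes c: "c \<in> A" and d: "d \<in> B" and W: "open W"
  shows "metric_map (cmap c ` (cdom c \<inter> \<phi> -` (W \<inter> cdom d))) (G c) (cmap d ` (W \<inter> cdom d)) (H d) (rep c d)"
proof -
  interpret metric_submersion "dom_rep c d" "G c" "range_rep d" "H d" "rep c d"
    by (rule metric_submersion_chart[OF c d])
  have N: "smooth_metric (cmap d ` (W \<inter> cdom d)) (H d)"
    by (rule N.smooth_metric_subset[OF open_chart_image[OF chart_B[OF d] W]]) blast
  have sub: "cmap c ` (cdom c \<inter> \<phi> -` (W \<inter> cdom d)) \<subseteq> dom_rep c d" by blast
  have "cmap c ` (cdom c \<inter> \<phi> -` (W \<inter> cdom d)) = dom_rep c d \<inter> rep c d -` (cmap d ` (W \<inter> cdom d))"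
  proof (intro set_eqI iffI)
    fix x assume "x \<in> dom_rep c d \<inter> rep c d -` (cmap d ` (W \<inter> cdom d))"
    then obtain p q where p: "p \<in> cdom c" "\<phi> p \<in> cdom d" "x = cmap c p"
      and q: "q \<in> W" "q \<in> cdom d" "rep c d x = cmap d q" by blast
    have "\<phi> p = q"
      using q p rep_at[OF c p(1)] chart_cinv[OF chart_B[OF d]] by metis
    then show "x \<in> cmap c ` (cdom c \<inter> \<phi> -` (W \<inter> cdom d))" using p q by blast
  qed (auto simp: chart_cinv[OF chart_A[OF c]])
  moreover have "open (dom_rep c d \<inter> rep c d -` (cmap d ` (W \<inter> cdom d)))"
    using continuous_on_open_vimage[OF M.open_S, of "rep c d"] smooth_on_continuous[OF smooth_F]
      smooth_metric.open_S[OF N] by (metis Int_commute)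
  ultimately have M: "smooth_metric (cmap c ` (cdom c \<inter> \<phi> -` (W \<inter> cdom d))) (G c)"
    using M.smooth_metric_subset sub by metis
  show ?thesis
  proof (intro metric_map.intro M N metric_map_axioms.intro)
    show "smooth_on (cmap c ` (cdom c \<inter> \<phi> -` (W \<inter> cdom d))) (rep c d)"
      by (rule smooth_on_subset[OF smooth_F sub])
  qed (auto simp: chart_cinv[OF chart_A[OF c]])
qed

lemma eventually_rep_in:
  assumes "c \<in> A" "d \<in> B" "p \<in> cdom c" "\<phi> p \<in> cdom d" "open W" "\<phi> p \<in> W" "open U" "p \<in> U"
  shows "eventually (\<lambda>x. cinv c x \<in> cdom c \<and> cmap c (cinv c x) = x \<and> \<phi> (cinv c x) \<in> cdom d
    \<and> \<phi> (cinv c x) \<in> W \<and> cinv c x \<in> U) (nhds (cmap c p))"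
proof -
  have "eventually (\<lambda>q. \<phi> q \<in> W) (nhds p)"
    by (rule eventually_phi[OF cdom_carrier[OF assms(1,3)] eventually_nhds_in_open[OF assms(5,6)]])
  from eventually_chart[OF chart_A[OF assms(1)] assms(3) this]
    eventually_rep[OF assms(1-4,7,8)] show ?thesis
    by eventually_elim simp
qed

text \<open>Chart form of the characteristic property of the pull-back connection: along T o \<phi>
  it differentiates T in direction d\<phi>(Y).\<close>

lemma nabla_along_pullback:
  assumes c: "c \<in> A" "p \<in> cdom c" and d: "d \<in> B" "\<phi> p \<in> cdom d" and W: "open W" "\<phi> p \<in> W"
    and comp: "components_at Y c p" and t: "smooth_on (cmap d ` (W \<inter> cdom d)) t"
    and V: "\<And>q. q \<in> carrier A \<Longrightarrow> \<phi> q \<in> W \<Longrightarrow> \<phi> q \<in> cdom d \<Longrightarrow> V d q = t (cmap d (\<phi> q))"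
  shows "nabla_along A h \<phi> Y V d p = cov d t (cmap d (\<phi> p)) (fd (rep c d) (cmap c p) (Y c p))"
proof -
  interpret metric_map "cmap c ` (cdom c \<inter> \<phi> -` (W \<inter> cdom d))" "G c" "cmap d ` (W \<inter> cdom d)" "H d" "rep c d"
    by (rule metric_map_chart[OF c(1) d(1) W(1)])
  have x: "cmap c p \<in> cmap c ` (cdom c \<inter> \<phi> -` (W \<inter> cdom d))" using c d W by blast
  have ev: "eventually (\<lambda>z. (V d \<circ> cinv c) z = t (rep c d z)) (nhds (cmap c p))"
    using eventually_rep_in[OF c(1) d(1) c(2) d(2) W open_UNIV UNIV_I]
    by eventually_elim (use V cdom_carrier[OF c(1)] in simp)
  have D: "((\<lambda>z. t (rep c d z)) has_derivative
      (\<lambda>u. fd t (rep c d (cmap c p)) (fd (rep c d) (cmap c p) u))) (at (cmap c p))"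
    by (rule compose_has_derivative[OF x smooth_on_differentiable[OF t F_S[OF x]]])
  then have "(V d \<circ> cinv c) differentiable (at (cmap c p))"
    unfolding differentiable_cong_nhds[OF ev] by (rule differentiableI)
  from deriv_along_components[OF c comp this]
  have "deriv_along A Y (V d) p = fd t (cmap d (\<phi> p)) (fd (rep c d) (cmap c p) (Y c p))"
    unfolding fd_cong[OF ev] fd_eq[OF D] rep_at[OF c] .
  then show ?thesis
    unfolding nabla_along_def N.cov_def push_chart[OF c(1) d(1) c(2) d(2) comp]
      christoffel_eq_lc[OF chart_B[OF d(1)] d(2)] V[OF cdom_carrier[OF c] W(2) d(2)] by simp
qed

lemma second_derivative_pullback:
  assumes p: "p \<in> carrier A" and d: "d \<in> B" "\<phi> p \<in> cdom d" and W: "open W" "\<phi> p \<in> W"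
    and U: "open U" "p \<in> U" and Y: "smooth_vfield_on A U Y"
    and t: "smooth_on (cmap d ` (W \<inter> cdom d)) t"
    and V: "\<And>q. q \<in> carrier A \<Longrightarrow> \<phi> q \<in> W \<Longrightarrow> \<phi> q \<in> cdom d \<Longrightarrow> V d q = t (cmap d (\<phi> q))"
  defines "c \<equiv> chart_at A p"
  shows "nabla_along A h \<phi> X (nabla_along A h \<phi> Y V) d p - nabla_along A h \<phi> (nabla A g X Y) V d p
    = cov2 d t (cmap d (\<phi> p)) (push A \<phi> X d p) (push A \<phi> Y d p)
      + cov d t (cmap d (\<phi> p)) (sff c d (cmap c p) (X c p) (Y c p))"
proof -
  have c: "c \<in> A" "p \<in> cdom c" using chart_at[OF p] by (auto simp: c_def)
  interpret metric_map "cmap c ` (cdom c \<inter> \<phi> -` (W \<inter> cdom d))" "G c" "cmap d ` (W \<inter> cdom d)" "H d" "rep c d"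
    by (rule metric_map_chart[OF c(1) d(1) W(1)])
  have x: "cmap c p \<in> cmap c ` (cdom c \<inter> \<phi> -` (W \<inter> cdom d))" using c d W by blast
  let ?F = "rep c d" and ?x = "cmap c p" and ?y = "Y c \<circ> cinv c"
  have comp: "components_at Z c p" for Z by (simp add: components_at_def c_def)
  have cp: "cinv c ?x = p" using chart_cinv[OF chart_A] c by blast
  have y: "(?y has_derivative fd ?y ?x) (at ?x)"
    by (rule fd_works[OF smooth_vfield_differentiable[OF Y c(1) U(2) c(2)]])
  let ?W = "\<lambda>z. cov d t (?F z) (fd ?F z (?y z))"
  have ev: "eventually (\<lambda>z. (nabla_along A h \<phi> Y V d \<circ> cinv c) z = ?W z) (nhds ?x)"
    using eventually_rep_in[OF c(1) d(1) c(2) d(2) W U]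
  proof eventually_elim
    case (elim z)
    then show ?case
      using nabla_along_pullback[where V = V, OF c(1) _ d(1) _ W(1) _ _ t V, of "cinv c z" Y] smooth_vfield_tangent_at[OF Y]
      by (simp add: components_at_def)
  qed
  have 1: "deriv_along A X (nabla_along A h \<phi> Y V d) p = fd ?W ?x (X c p)"
    unfolding deriv_along_def Let_def c_def[symmetric] fd_cong[OF ev] ..
  have 2: "nabla A g X Y c p = fd ?y ?x (X c p) + lc (G c) ?x (X c p) (?y ?x)"
    by (simp add: nabla_def deriv_along_def c_def[symmetric] christoffel_eq_lc[OF chart_A[OF c(1)] c(2)] cp)
  have 3: "nabla_along A h \<phi> Y V d p = ?W ?x"
    using eventually_nhds_x_imp_x[OF ev] by (simp add: cp)
  \<comment> \<open>The field \<nabla>_X Y is used at p alone, where c is the default chart, so its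
    tangency is not at stake.\<close>
  have 4: "nabla_along A h \<phi> (nabla A g X Y) V d p = cov d t (?F ?x) (fd ?F ?x (nabla A g X Y c p))"
    unfolding rep_at[OF c] by (rule nabla_along_pullback[where V = V, OF c d W comp t V])
  have 5: "Y c p = ?y ?x" by (simp add: cp)
  have "nabla_along A h \<phi> X (nabla_along A h \<phi> Y V) d p
      = fd ?W ?x (X c p) + lc (H d) (?F ?x) (fd ?F ?x (X c p)) (?W ?x)"
    unfolding nabla_along_def[of A h \<phi> X] 1 3 push_chart[OF c(1) d(1) c(2) d(2) comp]
      christoffel_eq_lc[OF chart_B[OF d(1)] d(2)] rep_at[OF c] ..
  then show ?thesis
    unfolding 4 2 push_chart[OF c(1) d(1) c(2) d(2) comp] rep_at[OF c, symmetric] 5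
    using second_cov_pullback[OF x t y, of "X c p"] by simp
qed

end

text \<open>Coordinate changes in opposite directions are mutually inverse, so their derivatives are
  onto; the isometry condition is the invariance of the metric.\<close>

lemma riem_submersion_ident:
  assumes "riemannian_manifold B h"
  shows "riem_submersion B h B h (\<lambda>x. x)"
proof
  have at: "smooth_atlas B" and m: "riemannian_metric B h"
    using assms by (auto simp: riemannian_manifold_def)
  have "surj (tangent_map (\<lambda>x. x) c d p)" if c: "c \<in> B" "p \<in> cdom c" and d: "d \<in> B" "p \<in> cdom d" for c d p
  proof -
    have "(cmap d \<circ> cinv c) differentiable (at (cmap c p))"
      by (rule smooth_on_differentiable[OF smooth_on_transition[OF at c(1) d(1)]]) (use c d in blast)
    from fd_eq[OF change_chart[OF at d(1) c(1) d(2) c(2) this]]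
    have "(\<lambda>u. u) = (\<lambda>u. tangent_map (\<lambda>x. x) c d p (tangent_map (\<lambda>x. x) d c p u))"
      using tangent_map_same[OF smooth_atlas_chart[OF at d(1)] d(2)]
      by (simp add: tangent_map_ident)
    then show ?thesis by (metis surjI)
  qed
  moreover have "smooth_map B B (\<lambda>x. x)"
    using at by (auto simp: smooth_map_def smooth_atlas_def o_def)
  ultimately show "riemannian_submersion B h B h (\<lambda>x. x)"
    using m unfolding riemannian_submersion_def riemannian_metric_def by auto
qed (fact assms)+

text \<open>
  The identity of the target is a Riemannian submersion whose horizontal space is everything, so its
  second fundamental form vanishes. This is the transformation law of the Levi-Civita connection.
\<close>
lemma hess_ident_zero:
  assumes "riemannian_manifold B h" "c \<in> B" "d \<in> B" "p \<in> cdom c" "p \<in> cdom d"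
  shows "metric_map.hess (\<lambda>x. h c (cinv c x)) (\<lambda>x. h d (cinv d x)) (cmap d \<circ> (\<lambda>x. x) \<circ> cinv c) (cmap c p) u v = 0"
proof -
  interpret I: riem_submersion B h B h "\<lambda>x. x" by (rule riem_submersion_ident[OF assms(1)])
  interpret metric_submersion "I.dom_rep c d" "I.G c" "I.range_rep d" "I.H d" "I.rep c d"
    by (rule I.metric_submersion_chart[OF assms(2,3)])
  have x: "cmap c p \<in> I.dom_rep c d" using assms by auto
  interpret L: linear_riemannian_submersion "I.G c (cmap c p)" "I.H d (I.rep c d (cmap c p))" "fd (I.rep c d) (cmap c p)"
    by (rule linear_riemannian_submersion[OF x])
  have "inj (fd (I.rep c d) (cmap c p))"
    using linear_surjective_imp_injective[OF L.linear_L L.surj_L] by simp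
  then have "w \<in> L.horizontal" for w
    using linear_injective_0[OF L.linear_L] inner_form.simps(8)[OF L.G.inner_form_axioms]
    by (auto simp: L.horizontal_def)
  then show ?thesis by (intro hess_horizontal_zero[OF x])
qed

section \<open>Local frames on manifolds\<close>

lemma tangent_map_trans:
  assumes A: "smooth_atlas A" "c \<in> A" "d \<in> A" "d' \<in> A"
    and p: "p \<in> cdom c" "p \<in> cdom d" "p \<in> cdom d'"
  shows "tangent_map (\<lambda>x. x) c d' p u = tangent_map (\<lambda>x. x) d d' p (tangent_map (\<lambda>x. x) c d p u)"
proof -
  have "(cmap d' \<circ> cinv d) differentiable (at (cmap d p))"
    by (rule smooth_on_differentiable[OF smooth_on_transition[OF A(1,3,4)]]) (use p in blast)
  from fd_eq[OF change_chart[OF A(1-3) p(1,2) this]] show ?thesis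
    by (simp add: tangent_map_ident[of c d'] tangent_map_ident[of d d'])
qed

text \<open>Prescribes the components in one chart and obtains the others by the Jacobian, so the
  transformation law holds by the chain rule.\<close>

definition extend :: "('a, 'e::euclidean_space) chart \<Rightarrow> ('e \<Rightarrow> 'e) \<Rightarrow> ('a, 'e) vfield" where
  "extend c e = (\<lambda>d q. tangent_map (\<lambda>x. x) c d q (e (cmap c q)))"

lemma open_chart_vimage:
  assumes "chart c" "open T"
  shows "open (cmap c -` T \<inter> cdom c)"
proof -
  have "open (cdom c)" "continuous_on (cdom c) (cmap c)"
    using assms(1) by (auto simp: chart_def homeomorphism_def)
  then show ?thesis using continuous_on_open_vimage assms(2) by blast
qed

lemma smooth_vfield_extend:
  assumes A: "smooth_atlas A" and c: "c \<in> A" and T: "open T" and e: "smooth_on T e"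
  shows "smooth_vfield_on A (cmap c -` T \<inter> cdom c) (extend c e)"
  unfolding smooth_vfield_on_def
proof (intro conjI ballI)
  let ?U = "cmap c -` T \<inter> cdom c"
  note ch = smooth_atlas_chart[OF A]
  fix c' d p assume "c' \<in> A" "d \<in> A" "p \<in> ?U \<inter> cdom c' \<inter> cdom d"
  then show "extend c e d p = tangent_map (\<lambda>x. x) c' d p (extend c e c' p)"
    unfolding extend_def by (intro tangent_map_trans[OF A c]) blast+
next
  let ?U = "cmap c -` T \<inter> cdom c"
  note ch = smooth_atlas_chart[OF A]
  fix d assume d: "d \<in> A"
  let ?S = "cmap d ` (?U \<inter> cdom d)"
  let ?T = "cmap c ` (?U \<inter> cdom d)"
  let ?\<tau> = "cmap d \<circ> cinv c" and ?\<sigma> = "cmap c \<circ> cinv d"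
  have oS: "open ?S" by (rule open_chart_image[OF ch[OF d] open_chart_vimage[OF ch[OF c] T]])
  have "?T = cmap c ` ((?U \<inter> cdom d) \<inter> cdom c)" by blast
  moreover have "open \<dots>"
    by (intro open_chart_image ch c open_Int open_chart_vimage T open_cdom[OF A d])
  ultimately have oT: "open ?T" by simp
  have "smooth_on ?T ?\<tau>"
    by (rule smooth_on_subset[OF smooth_on_transition[OF A c d]]) blast
  moreover have "smooth_on ?T e" by (rule smooth_on_subset[OF e]) blast
  ultimately have "smooth_on ?T (\<lambda>w. fd ?\<tau> w (e w))" by (rule smooth_on_fd_field[OF oT])
  moreover have "smooth_on ?S ?\<sigma>"
    by (rule smooth_on_subset[OF smooth_on_transition[OF A d c]]) blast
  moreover have "?\<sigma> ` ?S \<subseteq> ?T" using chart_cinv[OF ch[OF d]] by auto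
  ultimately have "smooth_on ?S (\<lambda>z. fd ?\<tau> (?\<sigma> z) (e (?\<sigma> z)))"
    by (rule smooth_on_compose[OF oS])
  then show "smooth_on ?S (extend c e d \<circ> cinv d)"
    by (simp add: extend_def tangent_map_ident o_def)
qed

lemma metric_invariant:
  "riemannian_manifold A g \<Longrightarrow> c \<in> A \<Longrightarrow> d \<in> A \<Longrightarrow> p \<in> cdom c \<Longrightarrow> p \<in> cdom d \<Longrightarrow>
    g d p (tangent_map (\<lambda>x. x) c d p u) (tangent_map (\<lambda>x. x) c d p v) = g c p u v"
  unfolding riemannian_manifold_def riemannian_metric_def by blast

lemma orthonormal_extend:
  assumes A: "riemannian_manifold A g" and c: "c \<in> A" and T: "open T" "T \<subseteq> cmap c ` cdom c"
    and e: "\<And>i. i < k \<Longrightarrow> smooth_on T (e i)"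
    and on: "\<And>x. x \<in> T \<Longrightarrow> inner_form.orthonormal (g c (cinv c x)) k (\<lambda>i. e i x)"
  shows "orthonormal_on A g (cmap c -` T \<inter> cdom c) k (\<lambda>i. extend c (e i))"
proof -
  have at: "smooth_atlas A" using A by (simp add: riemannian_manifold_def)
  have "g d p (extend c (e i) d p) (extend c (e j) d p) = (if i = j then 1 else 0)"
    if "d \<in> A" "p \<in> cdom d" "p \<in> cdom c" "cmap c p \<in> T" "i < k" "j < k" for d p i j
  proof -
    have "inner_form (g c p)"
      using smooth_metric.ip[OF smooth_metric_chart[OF A c], of "cmap c p"]
        chart_cinv[OF smooth_atlas_chart[OF at c]] that by auto
    then show ?thesis
      using on[OF that(4)] that chart_cinv[OF smooth_atlas_chart[OF at c]]
      by (simp add: extend_def metric_invariant[OF A c] inner_form.orthonormal_def)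
  qed
  then show ?thesis
    unfolding orthonormal_on_def using smooth_vfield_extend[OF at c T(1)] e by auto
qed

text \<open>Gram-Schmidt in one chart supplies a frame, so the choice operator returns a genuine
  orthonormal frame near p.\<close>

lemma onframe_at:
  fixes A :: "('a::{t2_space,second_countable_topology}, 'e::euclidean_space) chart set"
  assumes A: "riemannian_manifold A g" and p: "p \<in> carrier A"
  shows "\<exists>U. open U \<and> p \<in> U \<and> U \<subseteq> carrier A \<and> orthonormal_on A g U DIM('e) (onframe_at A g p)"
proof -
  have at: "smooth_atlas A" using A by (simp add: riemannian_manifold_def)
  obtain c where c: "c \<in> A" "p \<in> cdom c" using p by (auto simp: carrier_def)
  interpret smooth_metric "cmap c ` cdom c" "\<lambda>x. g c (cinv c x)"
    by (rule smooth_metric_chart[OF A c(1)])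
  obtain T e where T: "open T" "cmap c p \<in> T" "T \<subseteq> cmap c ` cdom c"
    and e: "\<And>i. i < DIM('e) \<Longrightarrow> smooth_on T (e i)"
    and on: "\<And>x. x \<in> T \<Longrightarrow> inner_form.orthonormal (g c (cinv c x)) DIM('e) (\<lambda>i. e i x)"
    using local_frame[of "cmap c p"] c by blast
  have "orthonormal_on A g (cmap c -` T \<inter> cdom c) DIM('e) (\<lambda>i. extend c (e i))"
    by (rule orthonormal_extend[OF A c(1) T(1,3) e on])
  then have "\<exists>e U. open U \<and> p \<in> U \<and> U \<subseteq> carrier A \<and> orthonormal_on A g U DIM('e) e"
    using open_chart_vimage[OF smooth_atlas_chart[OF at c(1)] T(1)] T(2) c
    by (intro exI[of _ "\<lambda>i. extend c (e i)"] exI[of _ "cmap c -` T \<inter> cdom c"]) (auto simp: carrier_def)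
  from someI_ex[OF this] show ?thesis unfolding onframe_at_def .
qed

lemma orthonormal_on_at:
  assumes "riemannian_manifold A g" "orthonormal_on A g U k e" "p \<in> U" "c \<in> A" "p \<in> cdom c"
  shows "inner_form.orthonormal (g c p) k (\<lambda>i. e i c p)"
proof -
  have "smooth_atlas A" using assms(1) by (simp add: riemannian_manifold_def)
  then have "cinv c (cmap c p) = p" using chart_cinv smooth_atlas_chart assms by blast
  then have "inner_form (g c p)"
    using smooth_metric.ip[OF smooth_metric_chart[OF assms(1,4)], of "cmap c p"] assms by auto
  then show ?thesis
    using assms by (auto simp: inner_form.orthonormal_def orthonormal_on_def)
qed

lemma deriv_along_cong:
  assumes "smooth_atlas A" "p \<in> carrier A" "eventually (\<lambda>q. f q = f' q) (nhds p)"
  shows "deriv_along A X f p = deriv_along A X f' p"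
proof -
  have c: "chart_at A p \<in> A" "p \<in> cdom (chart_at A p)" using chart_at[OF assms(2)] by auto
  have "eventually (\<lambda>x. (f \<circ> cinv (chart_at A p)) x = (f' \<circ> cinv (chart_at A p)) x)
      (nhds (cmap (chart_at A p) p))"
    using eventually_chart[OF smooth_atlas_chart[OF assms(1) c(1)] c(2) assms(3)]
    by (auto elim: eventually_mono)
  then show ?thesis unfolding deriv_along_def Let_def by (subst fd_cong) auto
qed

section \<open>The tension field\<close>

context riem_submersion
begin

lemma push_smooth_vfield:
  assumes "c \<in> A" "d \<in> B" "p \<in> cdom c" "\<phi> p \<in> cdom d" "smooth_vfield_on A U X" "p \<in> U"
  shows "push A \<phi> X d p = fd (rep c d) (cmap c p) (X c p)"
  by (rule push_chart[OF assms(1-4)]) (simp add: components_at_def smooth_vfield_tangent_at[OF assms(5,6)])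

lemma vertical_space_change_chart:
  assumes "c \<in> A" "c' \<in> A" "p \<in> cdom c" "p \<in> cdom c'" "u \<in> vertical_space B \<phi> c p"
  shows "tangent_map (\<lambda>x. x) c c' p u \<in> vertical_space B \<phi> c' p"
  unfolding vertical_space_def
proof (intro CollectI ballI impI)
  fix d assume d: "d \<in> B" "\<phi> p \<in> cdom d"
  have "fd (rep c d) (cmap c p) u = 0"
    using assms(5) d by (simp add: vertical_space_def tangent_map_phi)
  moreover have "rep c d = (cmap d \<circ> \<phi>) \<circ> cinv c" ..
  ultimately show "tangent_map \<phi> c' d p (tangent_map (\<lambda>x. x) c c' p u) = 0"
    using fd_eq[OF change_chart[OF atlas_A assms(1-4) rep_differentiable[OF assms(2) d(1) assms(4) d(2)]]]
    by (simp add: tangent_map_phi)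
qed

lemma vertical_onframe_at:
  assumes p: "p \<in> carrier A"
  shows "\<exists>U. open U \<and> p \<in> U \<and> U \<subseteq> carrier A \<and>
     orthonormal_on A g U (DIM('e) - DIM('f)) (vertical_onframe_at A g B \<phi> p) \<and>
     (\<forall>c\<in>A. \<forall>q \<in> U \<inter> cdom c. \<forall>s < DIM('e) - DIM('f).
       vertical_onframe_at A g B \<phi> p s c q \<in> vertical_space B \<phi> c q)"
proof -
  let ?k = "DIM('e) - DIM('f)"
  obtain c where c: "c \<in> A" "p \<in> cdom c" using p by (auto simp: carrier_def)
  have "\<phi> p \<in> carrier B" using smooth_phi p unfolding smooth_map_def by blast
  then obtain d where d: "d \<in> B" "\<phi> p \<in> cdom d" by (auto simp: carrier_def)
  interpret metric_submersion "dom_rep c d" "G c" "range_rep d" "H d" "rep c d"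
    by (rule metric_submersion_chart[OF c(1) d(1)])
  obtain T e where T: "open T" "cmap c p \<in> T" "T \<subseteq> dom_rep c d"
    and e: "\<And>i. i < ?k \<Longrightarrow> smooth_on T (e i)"
    and on: "\<And>x. x \<in> T \<Longrightarrow> inner_form.orthonormal (G c x) ?k (\<lambda>i. e i x)"
    and vert: "\<And>x i. x \<in> T \<Longrightarrow> i < ?k \<Longrightarrow> fd (rep c d) x (e i x) = 0"
    using smooth_vertical_frame[of "cmap c p"] c d by blast
  let ?U = "cmap c -` T \<inter> cdom c"
  have "orthonormal_on A g ?U ?k (\<lambda>i. extend c (e i))"
    by (rule orthonormal_extend[OF mfd_A c(1) T(1) _ e on]) (use T(3) in blast)
  moreover have "extend c (e s) c' q \<in> vertical_space B \<phi> c' q"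
    if "c' \<in> A" "q \<in> ?U" "q \<in> cdom c'" "s < ?k" for c' q s
  proof -
    have "cmap c q \<in> dom_rep c d" using T(3) that(2) by blast
    then obtain q' where q': "q' \<in> cdom c" "\<phi> q' \<in> cdom d" "cmap c q = cmap c q'"
      by blast
    then have "\<phi> q \<in> cdom d"
      using chart_cinv[OF chart_A[OF c(1)]] that(2) by (metis IntD2)
    then have "e s (cmap c q) \<in> vertical_space B \<phi> c q"
      using vert that vertical_space_chart[OF c(1) d(1)] by auto
    then show ?thesis
      unfolding extend_def using vertical_space_change_chart[OF c(1) that(1)] that by blast
  qed
  ultimately have "\<exists>e U. open U \<and> p \<in> U \<and> U \<subseteq> carrier A \<and> orthonormal_on A g U ?k e \<and>
     (\<forall>c\<in>A. \<forall>q \<in> U \<inter> cdom c. \<forall>s < ?k. e s c q \<in> vertical_space B \<phi> c q)"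
    using open_chart_vimage[OF chart_A[OF c(1)] T(1)] T(2) c cdom_carrier[OF c(1)]
    by (intro exI[of _ "\<lambda>i. extend c (e i)"] exI[of _ ?U]) auto
  from someI_ex[OF this] show ?thesis unfolding vertical_onframe_at_def .
qed

lemma tension_sff:
  assumes p: "p \<in> carrier A" and d: "d \<in> B" "\<phi> p \<in> cdom d"
  defines "c \<equiv> chart_at A p"
  shows "tension A g h \<phi> d p
    = (\<Sum>i<DIM('e). sff c d (cmap c p) (onframe_at A g p i c p) (onframe_at A g p i c p))"
proof -
  obtain U where U: "open U" "p \<in> U" "orthonormal_on A g U DIM('e) (onframe_at A g p)"
    using onframe_at[OF mfd_A p] by blast
  have X: "smooth_vfield_on A U (onframe_at A g p i)" if "i < DIM('e)" for i
    using U(3) that by (simp add: orthonormal_on_def)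
  show ?thesis
    unfolding tension_def metric_trace_def c_def
    by (intro sum.cong refl second_fundamental_form[OF p d U(1,2) X]) auto
qed

text \<open>The definite description has exactly one solution, the lift of the image of
  \<open>X\<close>, because lifting the image of a horizontal vector gives it back. The difference
  from \<open>X\<close> is vertical and invisible to the differential.\<close>

lemma fd_horizontal_part:
  assumes c: "c \<in> A" "p \<in> cdom c" and d: "d \<in> B" "\<phi> p \<in> cdom d"
  shows "fd (rep c d) (cmap c p) (horizontal_part g B \<phi> X c p) = fd (rep c d) (cmap c p) (X c p)"
proof -
  interpret metric_submersion "dom_rep c d" "G c" "range_rep d" "H d" "rep c d"
    by (rule metric_submersion_chart[OF c(1) d(1)])
  have cp: "cinv c (cmap c p) = p" using chart_cinv[OF chart_A] c by blast
  interpret L: linear_riemannian_submersion "G c (cmap c p)" "H d (rep c d (cmap c p))" "fd (rep c d) (cmap c p)"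
    by (rule linear_riemannian_submersion) (use c d in blast)
  let ?L = "fd (rep c d) (cmap c p)"
  have V: "vertical_space B \<phi> c p = {u. ?L u = 0}"
    by (rule vertical_space_chart[OF c(1) d(1) c(2) d(2)])
  have hor: "horizontal_space g B \<phi> c p = L.horizontal"
    unfolding horizontal_space_def V L.horizontal_def by (auto simp: cp)
  have "horizontal_part g B \<phi> X c p \<in> horizontal_space g B \<phi> c p \<and>
      X c p - horizontal_part g B \<phi> X c p \<in> vertical_space B \<phi> c p"
    unfolding horizontal_part_def
  proof (rule theI)
    show "L.lift (?L (X c p)) \<in> horizontal_space g B \<phi> c p \<and>
        X c p - L.lift (?L (X c p)) \<in> vertical_space B \<phi> c p"
      unfolding hor V
      by (simp add: L.lift_horizontal linear_diff[OF L.linear_L] L.L_lift del: comp_apply)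
    fix u assume "u \<in> horizontal_space g B \<phi> c p \<and> X c p - u \<in> vertical_space B \<phi> c p"
    then have u: "u \<in> L.horizontal" "?L (X c p) = ?L u"
      unfolding hor V by (auto simp: linear_diff[OF L.linear_L])
    show "u = L.lift (?L (X c p))" using L.lift_L[OF u(1)] unfolding u(2) ..
  qed
  then show ?thesis unfolding V by (simp add: linear_diff[OF L.linear_L])
qed

lemma tension_mean_curvature:
  assumes p: "p \<in> carrier A" and d: "d \<in> B" "\<phi> p \<in> cdom d" and dim: "DIM('f) < DIM('e)"
  shows "tension A g h \<phi> d p
    = - real (DIM('e) - DIM('f)) *\<^sub>R push A \<phi> (mean_curvature A g B \<phi>) d p"
proof -
  let ?k = "DIM('e) - DIM('f)"
  define c where "c = chart_at A p"
  have c: "c \<in> A" "p \<in> cdom c" using chart_at[OF p] by (auto simp: c_def)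
  let ?x = "cmap c p" and ?F = "rep c d"
  interpret metric_submersion "dom_rep c d" "G c" "range_rep d" "H d" "rep c d"
    by (rule metric_submersion_chart[OF c(1) d(1)])
  have x: "?x \<in> dom_rep c d" using c d by blast
  have cp: "cinv c ?x = p" using chart_cinv[OF chart_A] c by blast
  interpret L: linear_riemannian_submersion "G c ?x" "H d (?F ?x)" "fd ?F ?x"
    by (rule linear_riemannian_submersion[OF x])
  obtain U where U: "open U" "p \<in> U" "orthonormal_on A g U DIM('e) (onframe_at A g p)"
    using onframe_at[OF mfd_A p] by blast
  define v where "v = vertical_onframe_at A g B \<phi> p"
  obtain U' where U': "open U'" "p \<in> U'" "orthonormal_on A g U' ?k v"
    and vert: "\<And>c q s. c \<in> A \<Longrightarrow> q \<in> U' \<Longrightarrow> q \<in> cdom c \<Longrightarrow> s < ?k \<Longrightarrow> v s c q \<in> vertical_space B \<phi> c q"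
    using vertical_onframe_at[OF p] unfolding v_def by blast
  have v: "smooth_vfield_on A U' (v s)" if "s < ?k" for s
    using U'(3) that by (simp add: orthonormal_on_def)
  have "\<phi> p \<in> carrier B" using d by (auto simp: carrier_def)
  then obtain W where W: "open W" "\<phi> p \<in> W" "orthonormal_on B h W DIM('f) (onframe_at B h (\<phi> p))"
    using onframe_at[OF mfd_B] by blast
  have push_v: "push A \<phi> (v s) d q = 0" if q: "q \<in> U'" "q \<in> cdom c" "\<phi> q \<in> cdom d" and s: "s < ?k" for s q
    using push_smooth_vfield[OF c(1) d(1) q(2,3) v[OF s] q(1)] vert[OF c(1) q(1,2) s]
      vertical_space_chart[OF c(1) d(1) q(2,3)] by simp
  have sff_v: "sff c d ?x (v s c p) (v s c p) = - fd ?F ?x (nabla A g (v s) (v s) c p)" if s: "s < ?k" for s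
  proof -
    \<comment> \<open>The differential kills \<open>v s\<close> on a whole neighbourhood, so the
      first term of \<nabla>d\<phi>(v_s, v_s) is the derivative of zero and only the second
      survives.\<close>
    have "eventually (\<lambda>q. push A \<phi> (v s) d q = 0) (nhds p)"
      using eventually_nhds_in_open[OF U'(1,2)] eventually_cdom[OF atlas_A c]
        eventually_phi[OF p eventually_cdom[OF atlas_B d]]
      by eventually_elim (rule push_v[OF _ _ _ s])
    then have "deriv_along A (v s) (push A \<phi> (v s) d) p = deriv_along A (v s) (\<lambda>_. 0) p"
      by (rule deriv_along_cong[OF atlas_A p])
    also have "\<dots> = 0" by (simp add: deriv_along_def o_def)
    finally have "nabla_along A h \<phi> (v s) (push A \<phi> (v s)) d p = 0"
      using push_v[OF U'(2) c(2) d(2) s] linear_0[OF N.linear_lc(1)[OF F_S[OF x], unfolded rep_at[OF c]]]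
      by (simp add: nabla_along_def christoffel_eq_lc[OF chart_B[OF d(1)] d(2)] rep_at[OF c])
    moreover have "push A \<phi> (nabla A g (v s) (v s)) d p = fd ?F ?x (nabla A g (v s) (v s) c p)"
      by (rule push_chart[OF c(1) d(1) c(2) d(2)]) (simp add: components_at_def c_def)
    ultimately show ?thesis
      using second_fundamental_form[OF p d U'(1,2) v[OF s], of "v s"] by (simp add: c_def)
  qed
  have "tension A g h \<phi> d p = (\<Sum>i<DIM('e). sff c d ?x (onframe_at A g p i c p) (onframe_at A g p i c p))"
    unfolding c_def by (rule tension_sff[OF p d])
  also have "\<dots> = (\<Sum>s<?k. sff c d ?x (v s c p) (v s c p))"
  proof (rule L.adapted_trace[OF _ _ _ _ bilinear_hess[OF x] hess_horizontal_zero[OF x]])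
    show "L.G.orthonormal DIM('e) (\<lambda>i. onframe_at A g p i c p)"
      using orthonormal_on_at[OF mfd_A U(3,2) c] by (simp add: cp)
    show "L.G.orthonormal ?k (\<lambda>s. v s c p)"
      using orthonormal_on_at[OF mfd_A U'(3,2) c] by (simp add: cp)
    show "L.H.orthonormal DIM('f) (\<lambda>j. onframe_at B h (\<phi> p) j d (\<phi> p))"
      using orthonormal_on_at[OF mfd_B W(3,2) d] chart_cinv[OF chart_B[OF d(1)] d(2)]
      by (simp add: cp)
    show "fd ?F ?x (v s c p) = 0" if "s < ?k" for s
      using vert[OF c(1) U'(2) c(2) that] vertical_space_chart[OF c(1) d(1) c(2) d(2)] by simp
  qed
  also have "\<dots> = - (\<Sum>s<?k. fd ?F ?x (nabla A g (v s) (v s) c p))"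
    by (simp add: sff_v sum_negf)
  finally have 1: "tension A g h \<phi> d p = \<dots>" .
  have "push A \<phi> (mean_curvature A g B \<phi>) d p = fd ?F ?x (mean_curvature A g B \<phi> c p)"
    by (rule push_chart[OF c(1) d(1) c(2) d(2)]) (simp add: components_at_def c_def)
  also have "\<dots> = (1 / real ?k) *\<^sub>R (\<Sum>s<?k. fd ?F ?x (nabla A g (v s) (v s) c p))"
    unfolding mean_curvature_def Let_def v_def[symmetric] linear_cmul[OF L.linear_L]
      linear_sum[OF L.linear_L] fd_horizontal_part[OF c d] ..
  finally have 2: "push A \<phi> (mean_curvature A g B \<phi>) d p = \<dots>" .
  \<comment> \<open>The factor m - n cancels the normalisation of the mean curvature because m >
    n.\<close>
  have "- r * (1 / r) = -1" if "r \<noteq> 0" for r :: real using that by simp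
  moreover have "real ?k \<noteq> 0" using dim by simp
  ultimately have "- real ?k * (1 / real ?k) = -1" by blast
  then show ?thesis unfolding 1 2 scaleR_scaleR by (simp only: scaleR_minus1_left)
qed

end

section \<open>The bitension field\<close>

text \<open>Along the identity \<open>push\<close> converts components from the default chart to d,
  which is no change exactly when the field is tangent.\<close>

lemma nabla_along_ident:
  assumes B: "riemannian_manifold B h" and d: "d \<in> B" "q \<in> cdom d" and X: "tangent_at B X q"
  shows "push B (\<lambda>x. x) X d q = X d q"
    and "nabla_along B h (\<lambda>x. x) X V d q = nabla B h X V d q"
proof -
  interpret I: riem_submersion B h B h "\<lambda>x. x" by (rule riem_submersion_ident[OF B])
  show *: "push B (\<lambda>x. x) X d q = X d q"
    using I.push_chart[OF d(1,1,2,2), of X] X tangent_map_same[OF I.chart_A[OF d(1)] d(2)]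
    by (simp add: I.components_at_def tangent_map_def)
  show "nabla_along B h (\<lambda>x. x) X V d q = nabla B h X V d q"
    by (simp add: nabla_along_def nabla_def *)
qed

text \<open>The formula for pulled back fields applied to the identity, whose second fundamental
  form vanishes. The work lies in replacing each \<open>nabla_along\<close> by \<open>nabla\<close>,
  in a chart d that need not be the default one.\<close>

lemma trace_nabla2_frame:
  fixes B :: "('b::{t2_space,second_countable_topology}, 'f::euclidean_space) chart set"
  assumes B: "riemannian_manifold B h" and d: "d \<in> B" "q \<in> cdom d" and W: "open W" "q \<in> W"
    and T: "smooth_vfield_on B W T"
  shows "trace_nabla2 B h T d q = (\<Sum>j<DIM('f). smooth_metric.cov2 (\<lambda>x. h d (cinv d x)) (T d \<circ> cinv d)
    (cmap d q) (onframe_at B h q j d q) (onframe_at B h q j d q))"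
  unfolding trace_nabla2_def metric_trace_def
proof (intro sum.cong refl)
  interpret I: riem_submersion B h B h "\<lambda>x. x" by (rule riem_submersion_ident[OF B])
  have q: "q \<in> carrier B" using d by (auto simp: carrier_def)
  obtain U where U: "open U" "q \<in> U" "orthonormal_on B h U DIM('f) (onframe_at B h q)"
    using onframe_at[OF B q] by blast
  define c where "c = chart_at B q"
  have c: "c \<in> B" "q \<in> cdom c" using chart_at[OF q] by (auto simp: c_def)
  have t: "smooth_on (cmap d ` (W \<inter> cdom d)) (T d \<circ> cinv d)"
    using T d(1) by (simp add: smooth_vfield_on_def)
  fix j assume "j \<in> {..<DIM('f)}"
  then have X: "smooth_vfield_on B U (onframe_at B h q j)"
    using U(3) by (simp add: orthonormal_on_def)
  let ?X = "onframe_at B h q j"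
  have tX: "tangent_at B ?X q'" if "q' \<in> U" for q' by (rule smooth_vfield_tangent_at[OF X that])
  have ev: "eventually (\<lambda>q. q \<in> U \<and> q \<in> cdom d) (nhds q)"
    using eventually_nhds_in_open[OF U(1,2)] eventually_cdom[OF I.atlas_A d] by eventually_elim simp
  have "deriv_along B ?X (push B (\<lambda>x. x) ?X d) q = deriv_along B ?X (?X d) q"
    by (rule deriv_along_cong[OF I.atlas_A q], rule eventually_mono[OF ev])
      (use nabla_along_ident(1)[OF B d(1) _ tX] in auto)
  then have "nabla_along B h (\<lambda>x. x) ?X (push B (\<lambda>x. x) ?X) d q = nabla B h ?X ?X d q"
    by (simp add: nabla_along_def nabla_def nabla_along_ident(1)[OF B d tX[OF U(2)]])
  \<comment> \<open>Here the transformation law is extracted: the left side carries the components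
    of \<nabla>_X X from the default chart to d, and vanishing of the second fundamental form says
    that they match the components computed in d.\<close>
  then have push_nabla: "push B (\<lambda>x. x) (nabla B h ?X ?X) d q = nabla B h ?X ?X d q"
    using I.second_fundamental_form[OF q d U(1,2) X, of ?X]
      hess_ident_zero[OF B c(1) d(1) c(2) d(2)] by (simp add: c_def)
  have "deriv_along B ?X (nabla_along B h (\<lambda>x. x) ?X T d) q = deriv_along B ?X (nabla B h ?X T d) q"
    by (rule deriv_along_cong[OF I.atlas_A q], rule eventually_mono[OF ev])
      (use nabla_along_ident(2)[OF B d(1) _ tX] in auto)
  then have 1: "nabla_along B h (\<lambda>x. x) ?X (nabla_along B h (\<lambda>x. x) ?X T) d q = nabla B h ?X (nabla B h ?X T) d q"
    unfolding nabla_along_def[of B h _ ?X "nabla_along B h (\<lambda>x. x) ?X T"]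
      nabla_def[of B h ?X "nabla B h ?X T"]
    by (simp only: nabla_along_ident[OF B d tX[OF U(2)]])
  have 2: "nabla_along B h (\<lambda>x. x) (nabla B h ?X ?X) T d q = nabla B h (nabla B h ?X ?X) T d q"
    by (simp add: nabla_along_def nabla_def[of B h "nabla B h ?X ?X"] push_nabla)
  have "linear (I.cov d (T d \<circ> cinv d) (cmap d q))"
  proof -
    interpret N: smooth_metric "cmap d ` (W \<inter> cdom d)" "I.H d"
      by (rule smooth_metric.smooth_metric_subset[OF smooth_metric_chart[OF B d(1)]
            open_chart_image[OF I.chart_A[OF d(1)] W(1)]]) blast
    show ?thesis by (rule N.linear_cov[OF t]) (use d W in blast)
  qed
  then have 0: "I.cov d (T d \<circ> cinv d) (cmap d q) 0 = 0" by (rule linear_0)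
  have "T d q' = (T d \<circ> cinv d) (cmap d q')" if "q' \<in> cdom d" for q'
    using chart_cinv[OF I.chart_A[OF d(1)] that] by simp
  then have "nabla_along B h (\<lambda>x. x) ?X (nabla_along B h (\<lambda>x. x) ?X T) d q
      - nabla_along B h (\<lambda>x. x) (nabla B h ?X ?X) T d q
    = I.cov2 d (T d \<circ> cinv d) (cmap d q) (push B (\<lambda>x. x) ?X d q) (push B (\<lambda>x. x) ?X d q)
      + I.cov d (T d \<circ> cinv d) (cmap d q) (I.sff c d (cmap c q) (?X c q) (?X c q))"
    unfolding c_def by (intro I.second_derivative_pullback[OF q d W U(1,2) X t])
  then show "nabla B h ?X (nabla B h ?X T) d q - nabla B h (nabla B h ?X ?X) T d q
    = I.cov2 d (T d \<circ> cinv d) (cmap d q) (?X d q) (?X d q)"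
    unfolding 1 2 nabla_along_ident(1)[OF B d tX[OF U(2)]]
      hess_ident_zero[OF B c(1) d(1) c(2) d(2)] 0 by simp
qed

lemma nabla_chart:
  assumes B: "riemannian_manifold B h" and d: "d \<in> B" "q \<in> cdom d" and W: "q \<in> W"
    and T: "smooth_vfield_on B W T" and X: "tangent_at B X q"
  shows "nabla B h X T d q = smooth_metric.cov (\<lambda>x. h d (cinv d x)) (T d \<circ> cinv d) (cmap d q) (X d q)"
proof -
  have at: "smooth_atlas B" using B by (simp add: riemannian_manifold_def)
  note ch = smooth_atlas_chart[OF at d(1)]
  interpret smooth_metric "cmap d ` cdom d" "\<lambda>x. h d (cinv d x)" by (rule smooth_metric_chart[OF B d(1)])
  show ?thesis
    using deriv_along_chart[OF at d X smooth_vfield_differentiable[OF T d(1) W d(2)]]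
    by (simp add: nabla_def cov_def christoffel_eq_lc[OF ch d(2)] chart_cinv[OF ch d(2)])
qed

text \<open>Covariant derivatives of fields constant in d are Christoffel terms. This is shown on
  the whole chart domain, since they are differentiated once more.\<close>

lemma curvature_chart:
  assumes B: "riemannian_manifold B h" and d: "d \<in> B" "q \<in> cdom d"
  shows "curvature B h d q u v w = smooth_metric.curv (\<lambda>x. h d (cinv d x)) (cmap d q) u v w"
proof -
  have at: "smooth_atlas B" using B by (simp add: riemannian_manifold_def)
  note ch = smooth_atlas_chart[OF at d(1)]
  interpret smooth_metric "cmap d ` cdom d" "\<lambda>x. h d (cinv d x)" by (rule smooth_metric_chart[OF B d(1)])
  have x: "cmap d q \<in> cmap d ` cdom d" using d by blast
  have q: "q \<in> carrier B" using d by (auto simp: carrier_def)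
  let ?C = "const_field d"
  have C: "?C u d q' = u" if "q' \<in> cdom d" for u q'
    using tangent_map_same[OF ch that] by (simp add: const_field_def)
  have tC: "tangent_at B (?C u) q'" if "q' \<in> cdom d" for u q'
    unfolding tangent_at_def const_field_def using tangent_map_trans[OF at d(1)] that by blast
  have ev: "eventually (\<lambda>q. q \<in> cdom d) (nhds q)" by (rule eventually_cdom[OF at d])
  have D0: "deriv_along B X (?C w d) q' = 0" if "q' \<in> cdom d" for X w q'
  proof -
    have "deriv_along B X (?C w d) q' = deriv_along B X (\<lambda>_. w) q'"
      by (rule deriv_along_cong[OF at])
        (use that d(1) eventually_cdom[OF at d(1) that] C in \<open>auto simp: carrier_def elim: eventually_mono\<close>)
    then show ?thesis by (simp add: deriv_along_def o_def)
  qed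
  have n1: "nabla B h (?C v) (?C w) d q' = lc (\<lambda>x. h d (cinv d x)) (cmap d q') v w" if "q' \<in> cdom d" for v w q'
    by (simp add: nabla_def D0[OF that] C[OF that] christoffel_eq_lc[OF ch that])
  have n2: "nabla B h (?C u) (nabla B h (?C v) (?C w)) d q
      = fd (\<lambda>z. lc (\<lambda>x. h d (cinv d x)) z v w) (cmap d q) u
        + lc (\<lambda>x. h d (cinv d x)) (cmap d q) u (lc (\<lambda>x. h d (cinv d x)) (cmap d q) v w)" for u v w
  proof -
    have e: "eventually (\<lambda>z. (nabla B h (?C v) (?C w) d \<circ> cinv d) z = lc (\<lambda>x. h d (cinv d x)) z v w) (nhds (cmap d q))"
      using eventually_chart[OF ch d(2) ev] by eventually_elim (use n1 in simp)
    then have "(nabla B h (?C v) (?C w) d \<circ> cinv d) differentiable (at (cmap d q))"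
      using differentiable_cong_nhds[OF e] lc_differentiable[OF x] by blast
    from deriv_along_chart[OF at d tC[OF d(2)] this]
    have "deriv_along B (?C u) (nabla B h (?C v) (?C w) d) q = fd (\<lambda>z. lc (\<lambda>x. h d (cinv d x)) z v w) (cmap d q) u"
      unfolding fd_cong[OF e] C[OF d(2)] .
    then show ?thesis
      by (simp add: nabla_def[of B h "?C u"] n1[OF d(2)] C[OF d(2)] christoffel_eq_lc[OF ch d(2)])
  qed
  have "bracket B (?C u) (?C v) d q = 0"
    by (simp add: bracket_def D0[OF d(2)])
  then have "nabla B h (bracket B (?C u) (?C v)) (?C w) d q = 0"
    using linear_0[OF linear_lc(2)[OF x]]
    by (simp add: nabla_def D0[OF d(2)] christoffel_eq_lc[OF ch d(2)])
  then show ?thesis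
    by (simp add: curvature_def curvature_op_def n2 curv_def)
qed

context riem_submersion
begin

lemma bitension_basic:
  assumes T: "smooth_vfield_on B (\<phi> ` carrier A) T"
    and factors: "factors_through A B \<phi> (tension A g h \<phi>) T"
    and p: "p \<in> carrier A" and d: "d \<in> B" "\<phi> p \<in> cdom d"
  shows "bitension A g B h \<phi> d p
    = trace_nabla2 B h T d (\<phi> p) + nabla B h T T d (\<phi> p) + ricci B h T d (\<phi> p)"
proof -
  define c where "c = chart_at A p"
  have c: "c \<in> A" "p \<in> cdom c" using chart_at[OF p] by (auto simp: c_def)
  let ?x = "cmap c p" and ?F = "rep c d" and ?y = "cmap d (\<phi> p)" and ?t = "T d \<circ> cinv d"
  let ?W = "\<phi> ` carrier A"
  let ?e = "\<lambda>i. onframe_at A g p i" and ?\<epsilon> = "\<lambda>j. onframe_at B h (\<phi> p) j d (\<phi> p)"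
  have W: "open ?W" "\<phi> p \<in> ?W" using open_image_phi p by auto
  interpret metric_submersion "dom_rep c d" "G c" "range_rep d" "H d" "rep c d"
    by (rule metric_submersion_chart[OF c(1) d(1)])
  interpret N': smooth_metric "cmap d ` (?W \<inter> cdom d)" "H d"
    by (rule N.smooth_metric_subset[OF open_chart_image[OF chart_B[OF d(1)] W(1)]]) blast
  have x: "?x \<in> dom_rep c d" using c d by blast
  have y: "?y \<in> cmap d ` (?W \<inter> cdom d)" "?y \<in> range_rep d" using d W by blast+
  have cp: "cinv c ?x = p" using chart_cinv[OF chart_A] c by blast
  interpret L: linear_riemannian_submersion "G c ?x" "H d (?F ?x)" "fd ?F ?x"
    by (rule linear_riemannian_submersion[OF x])
  have t: "smooth_on (cmap d ` (?W \<inter> cdom d)) ?t"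
    using T d(1) by (simp add: smooth_vfield_on_def)
  have tau: "tension A g h \<phi> d q = T d (\<phi> q)" if "q \<in> carrier A" "\<phi> q \<in> cdom d" for q
    using factors that d(1) by (simp add: factors_through_def)
  have V: "tension A g h \<phi> d q = ?t (cmap d (\<phi> q))" if "q \<in> carrier A" "\<phi> q \<in> cdom d" for q
    using tau[OF that] chart_cinv[OF chart_B[OF d(1)] that(2)] by simp
  obtain U where U: "open U" "p \<in> U" "orthonormal_on A g U DIM('e) (onframe_at A g p)"
    using onframe_at[OF mfd_A p] by blast
  have e: "smooth_vfield_on A U (?e i)" if "i < DIM('e)" for i
    using U(3) that by (simp add: orthonormal_on_def)
  have push_e: "push A \<phi> (?e i) d p = fd ?F ?x (?e i c p)" if "i < DIM('e)" for i
    by (rule push_smooth_vfield[OF c(1) d(1) c(2) d(2) e[OF that] U(2)])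
  have "\<phi> p \<in> carrier B" using d by (auto simp: carrier_def)
  then obtain W' where W': "\<phi> p \<in> W'" "orthonormal_on B h W' DIM('f) (onframe_at B h (\<phi> p))"
    using onframe_at[OF mfd_B] by blast
  have on_e: "L.G.orthonormal DIM('e) (\<lambda>i. ?e i c p)"
    using orthonormal_on_at[OF mfd_A U(3,2) c] by (simp add: cp)
  have on_\<epsilon>: "L.H.orthonormal DIM('f) ?\<epsilon>"
    using orthonormal_on_at[OF mfd_B W'(2,1) d] chart_cinv[OF chart_B[OF d(1)] d(2)] by (simp add: cp)
  have "- laplacian_along A g h \<phi> (tension A g h \<phi>) d p
      = (\<Sum>i<DIM('e). cov2 d ?t ?y (fd ?F ?x (?e i c p)) (fd ?F ?x (?e i c p))
          + cov d ?t ?y (sff c d ?x (?e i c p) (?e i c p)))"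
    unfolding laplacian_along_def metric_trace_def minus_minus
  proof (intro sum.cong refl)
    fix i assume "i \<in> {..<DIM('e)}"
    then have i: "i < DIM('e)" by simp
    show "nabla_along A h \<phi> (?e i) (nabla_along A h \<phi> (?e i) (tension A g h \<phi>)) d p
        - nabla_along A h \<phi> (nabla A g (?e i) (?e i)) (tension A g h \<phi>) d p
      = cov2 d ?t ?y (fd ?F ?x (?e i c p)) (fd ?F ?x (?e i c p))
          + cov d ?t ?y (sff c d ?x (?e i c p) (?e i c p))"
      unfolding push_e[OF i, symmetric] unfolding c_def
      by (rule second_derivative_pullback[where V = "tension A g h \<phi>", OF p d W U(1,2) e[OF i] t V])
  qed
  also have "\<dots> = (\<Sum>j<DIM('f). cov2 d ?t ?y (?\<epsilon> j) (?\<epsilon> j)) + cov d ?t ?y (tension A g h \<phi> d p)"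
    unfolding sum.distrib L.trace_push_L[OF on_e on_\<epsilon> N'.bilinear_cov2[OF t y(1)]]
      tension_sff[OF p d, folded c_def] linear_sum[OF N'.linear_cov[OF t y(1)]] ..
  also have "\<dots> = trace_nabla2 B h T d (\<phi> p) + nabla B h T T d (\<phi> p)"
    by (simp add: trace_nabla2_frame[OF mfd_B d W T] tau[OF p d(2)]
        nabla_chart[OF mfd_B d W(2) T smooth_vfield_tangent_at[OF T W(2)]])
  finally have 1: "- laplacian_along A g h \<phi> (tension A g h \<phi>) d p = \<dots>" .
  have "metric_trace A g (\<lambda>X Y d p. curvature B h d (\<phi> p) (push A \<phi> X d p) (tension A g h \<phi> d p) (push A \<phi> Y d p)) d p
      = (\<Sum>i<DIM('e). curv d ?y (fd ?F ?x (?e i c p)) (T d (\<phi> p)) (fd ?F ?x (?e i c p)))"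
    unfolding metric_trace_def curvature_chart[OF mfd_B d] tau[OF p d(2)]
    by (intro sum.cong refl) (simp add: push_e)
  also have "\<dots> = (\<Sum>j<DIM('f). curv d ?y (?\<epsilon> j) (T d (\<phi> p)) (?\<epsilon> j))"
    by (rule L.trace_push_L[OF on_e on_\<epsilon> N.bilinear_curv[OF y(2)]])
  \<comment> \<open>The bitension field has T in the second slot of the curvature,
    \<open>ricci\<close> has it in the first; antisymmetry reverses the sign with which the Ricci
    term enters.\<close>
  also have "\<dots> = - ricci B h T d (\<phi> p)"
    unfolding ricci_def metric_trace_def curvature_chart[OF mfd_B d] sum_negf[symmetric]
    by (intro sum.cong refl N.curv_antisym)
  finally show ?thesis
    unfolding bitension_def 1 by simp
qed

end

text \<open>Identifying the tension field with a field on \<phi>(M) takes two clauses: such a T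
  exists, which keeps the equivalence from being vacuous, and the equivalence holds for every T that
  represents it.\<close>

theorem corollary2p3:
  fixes A :: "('a::{t2_space,second_countable_topology}, 'e::euclidean_space) chart set"
    and g :: "('a, 'e) metric"
    and B :: "('b::{t2_space,second_countable_topology}, 'f::euclidean_space) chart set"
    and h :: "('b, 'f) metric"
    and \<phi> :: "'a \<Rightarrow> 'b"
  assumes "riemannian_manifold A g"
    and "riemannian_manifold B h"
    and "DIM('e) > DIM('f)"
    and "riemannian_submersion A g B h \<phi>"
    and "basic A g B \<phi> (mean_curvature A g B \<phi>)"
  shows "(\<exists>T. smooth_vfield_on B (\<phi> ` carrier A) T \<and>
              factors_through A B \<phi> (tension A g h \<phi>) T) \<and>
         (\<forall>T. smooth_vfield_on B (\<phi> ` carrier A) T \<and>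
              factors_through A B \<phi> (tension A g h \<phi>) T \<longrightarrow>
           (biharmonic A g B h \<phi> \<longleftrightarrow>
             (\<forall>q \<in> \<phi> ` carrier A. \<forall>d\<in>B. q \<in> cdom d \<longrightarrow>
               trace_nabla2 B h T d q + nabla B h T T d q + ricci B h T d q = 0)))"
proof (intro conjI allI impI)
  interpret riem_submersion A g B h \<phi>
    using assms(1,2,4) by (rule riem_submersion.intro)
  let ?m = "- real (DIM('e) - DIM('f))"
  obtain W where W: "smooth_vfield_on B (carrier B) W"
    "factors_through A B \<phi> (push A \<phi> (mean_curvature A g B \<phi>)) W"
    using assms(5) unfolding basic_def by blast
  \<comment> \<open>\<open>W\<close> is \<phi>-related to the mean curvature field, and the tension
    field is -(m - n) times the image of the latter. It lives on the whole target and is restricted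
    to the image.\<close>
  let ?T = "\<lambda>d q. ?m *\<^sub>R W d q"
  have sub: "\<phi> ` carrier A \<subseteq> carrier B" using smooth_phi by (simp add: smooth_map_def)
  have "smooth_vfield_on B (\<phi> ` carrier A) ?T"
    unfolding smooth_vfield_on_def
  proof (intro conjI ballI)
    fix c d q assume *: "c \<in> B" "d \<in> B" "q \<in> \<phi> ` carrier A \<inter> cdom c \<inter> cdom d"
    have "W d q = tangent_map (\<lambda>x. x) c d q (W c q)"
      using W(1) * sub unfolding smooth_vfield_on_def by blast
    moreover have "linear (tangent_map (\<lambda>x. x) c d q)"
      unfolding tangent_map_ident
      by (intro linear_fd smooth_on_differentiable[OF smooth_on_transition[OF atlas_B *(1,2)]])
        (use * in blast)
    ultimately show "?m *\<^sub>R W d q = tangent_map (\<lambda>x. x) c d q (?m *\<^sub>R W c q)"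
      by (simp only: linear_cmul)
  next
    fix d assume d: "d \<in> B"
    have "smooth_on (cmap d ` (carrier B \<inter> cdom d)) (W d \<circ> cinv d)"
      using W(1) d by (simp add: smooth_vfield_on_def)
    then have "smooth_on (cmap d ` (\<phi> ` carrier A \<inter> cdom d)) (W d \<circ> cinv d)"
      by (rule smooth_on_subset) (use sub in blast)
    from smooth_on_scaleR[OF open_chart_image[OF chart_B[OF d] open_image_phi] smooth_on_const[of _ ?m] this]
    show "smooth_on (cmap d ` (\<phi> ` carrier A \<inter> cdom d)) (?T d \<circ> cinv d)"
      by (simp add: o_def)
  qed
  moreover have "factors_through A B \<phi> (tension A g h \<phi>) ?T"
    using W(2) tension_mean_curvature[OF _ _ _ assms(3)] by (simp add: factors_through_def)
  ultimately show "\<exists>T. smooth_vfield_on B (\<phi> ` carrier A) T \<and> factors_through A B \<phi> (tension A g h \<phi>) T"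
    by blast
next
  interpret riem_submersion A g B h \<phi>
    using assms(1,2,4) by (rule riem_submersion.intro)
  fix T assume T: "smooth_vfield_on B (\<phi> ` carrier A) T \<and> factors_through A B \<phi> (tension A g h \<phi>) T"
  show "biharmonic A g B h \<phi> \<longleftrightarrow> (\<forall>q \<in> \<phi> ` carrier A. \<forall>d\<in>B. q \<in> cdom d \<longrightarrow>
      trace_nabla2 B h T d q + nabla B h T T d q + ricci B h T d q = 0)"
    using bitension_basic[OF conjunct1[OF T] conjunct2[OF T]] by (auto simp: biharmonic_def)
qed

end
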